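(* Let $k$ be a field, $n$ a positive integer, $q\in k^\times$ not a root of unity, and $A=\mathcal{O}_q(M_n(k))$. Let $1\le t,l,l'\le n$, and set $$P_{t,l}^-=\langle [I\mid J] : |I|=t+1\rangle+\langle [I\mid J] : |I|=t\text{ and }I\subseteq\{1,\dots,l\}\rangle,$$ $$P_{t,l}^+=\langle [I\mid J] : |I|=t+1\rangle+\langle [I\mid J] : |I|=t\text{ and }I\subseteq\{n-l+1,\dots,n\}\rangle,$$ $$Q_{t,l'}^-=\langle [I\mid J] : |I|=t+1\rangle+\langle [I\mid J] : |I|=t\text{ and }J\subseteq\{1,\dots,l'\}\rangle,$$ $$Q_{t,l'}^+=\langle [I\mid J] : |I|=t+1\rangle+\langle [I\mid J] : |I|=t\text{ and }J\subseteq\{n-l'+1,\dots,n\}\rangle.$$ Then the ideals $P_{t,l}^{\pm}+Q_{t,l'}^{\pm}$ (all four choices of signs, chosen independently) are $H$-prime ideals of $A$.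
   Context: $A=\mathcal{O}_q(M_n(k))$ is the $k$-algebra with generators $X_{ij}$ ($1\le i,j\le n$) and relations $X_{ij}X_{lj}=qX_{lj}X_{ij}$ for $i<l$; $X_{ij}X_{im}=qX_{im}X_{ij}$ for $j<m$; $X_{ij}X_{lm}=X_{lm}X_{ij}$ for $i<l$, $j>m$; $X_{ij}X_{lm}-X_{lm}X_{ij}=(q-q^{-1})X_{im}X_{lj}$ for $i<l$, $j<m$. For subsets $I=\{i_1<\cdots<i_s\}$, $J=\{j_1<\cdots<j_s\}$ of $\{1,\dots,n\}$ of the same cardinality, the quantum minor is $[I\mid J]=\sum_{\sigma\in S_s}(-q)^{\ell(\sigma)}X_{i_1j_{\sigma(1)}}\cdots X_{i_sj_{\sigma(s)}}$; whenever $[I\mid J]$ is written, $|I|=|J|$ is understood. (If $t+1>n$ there are no minors of size $t+1$.) $\langle\cdot\rangle$ denotes the two-sided ideal generated. The torus $H=(k^\times)^n\times(k^\times)^n$ acts on $A$ by $k$-algebra automorphisms via $(\alpha_1,\dots,\alpha_n,\beta_1,\dots,\beta_n).X_{ij}=\alpha_i\beta_jX_{ij}$. An $H$-prime ideal is a proper $H$-invariant ideal $P$ such that whenever $P\supseteq IJ$ for $H$-invariant ideals $I,J$, then $P\supseteq I$ or $P\supseteq J$. *)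

theory Defs
  imports
    "HOL-Algebra.QuotRing"
    "HOL-Algebra.Ideal_Product"
    "HOL-Combinatorics.Permutations"
    "HOL-Library.Poly_Mapping"
begin

section \<open>The free algebra on the generators X i j\<close>

text \<open>
  Words form a monoid under concatenation, written additively because the convolution product of
  \<^typ>\<open>'a \<Rightarrow>\<^sub>0 'b\<close> is defined over an additive (not necessarily commutative) exponent monoid.
  Hence \<^typ>\<open>(nat \<times> nat) list \<Rightarrow>\<^sub>0 'k\<close> is the free associative algebra on letters (i, j).
\<close>

instantiation list :: (type) monoid_add
begin

definition zero_list :: "'a list" where "zero_list = []"

definition plus_list :: "'a list \<Rightarrow> 'a list \<Rightarrow> 'a list" where "plus_list u v = u @ v"

instance by standard (simp_all add: zero_list_def plus_list_def)

end

type_synonym 'k ncpoly = "(nat \<times> nat) list \<Rightarrow>\<^sub>0 'k"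

definition const :: "'k::field \<Rightarrow> 'k ncpoly" where
  "const c = Poly_Mapping.single [] c"

definition X :: "nat \<Rightarrow> nat \<Rightarrow> 'k::field ncpoly" where
  "X i j = Poly_Mapping.single [(i, j)] 1"

definition free_algebra :: "nat \<Rightarrow> ('k::field) ncpoly ring" where
  "free_algebra n =
     \<lparr>carrier = {f. Poly_Mapping.keys f \<subseteq> lists ({1..n} \<times> {1..n})},
      monoid.mult = (*), one = 1, zero = 0, add = (+)\<rparr>"

section \<open>The algebra of quantum matrices\<close>

definition quantum_relations :: "nat \<Rightarrow> 'k::field \<Rightarrow> 'k ncpoly set" where
  "quantum_relations n q =
     {X i j * X l j - const q * X l j * X i j | i l j.
        i \<in> {1..n} \<and> l \<in> {1..n} \<and> j \<in> {1..n} \<and> i < l}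
   \<union> {X i j * X i m - const q * X i m * X i j | i j m.
        i \<in> {1..n} \<and> j \<in> {1..n} \<and> m \<in> {1..n} \<and> j < m}
   \<union> {X i j * X l m - X l m * X i j | i j l m.
        i \<in> {1..n} \<and> j \<in> {1..n} \<and> l \<in> {1..n} \<and> m \<in> {1..n} \<and> i < l \<and> j > m}
   \<union> {X i j * X l m - X l m * X i j - const (q - inverse q) * X i m * X l j | i j l m.
        i \<in> {1..n} \<and> j \<in> {1..n} \<and> l \<in> {1..n} \<and> m \<in> {1..n} \<and> i < l \<and> j < m}"

definition quantum_ideal :: "nat \<Rightarrow> 'k::field \<Rightarrow> 'k ncpoly set" where
  "quantum_ideal n q = Idl\<^bsub>free_algebra n\<^esub> (quantum_relations n q)"

definition quantum_matrices :: "nat \<Rightarrow> 'k::field \<Rightarrow> 'k ncpoly set ring" where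
  "quantum_matrices n q = free_algebra n Quot quantum_ideal n q"

definition qclass :: "nat \<Rightarrow> 'k::field \<Rightarrow> 'k ncpoly \<Rightarrow> 'k ncpoly set" where
  "qclass n q f = quantum_ideal n q +>\<^bsub>free_algebra n\<^esub> f"

section \<open>Quantum minors\<close>

text \<open>Permutations act on the positions 0, ..., s - 1; the Coxeter length of a permutation is its
  number of inversions.\<close>

definition perm_length :: "nat \<Rightarrow> (nat \<Rightarrow> nat) \<Rightarrow> nat" where
  "perm_length s \<sigma> = card {(a, b). a < b \<and> b < s \<and> \<sigma> a > \<sigma> b}"

definition minor_poly :: "'k::field \<Rightarrow> nat set \<Rightarrow> nat set \<Rightarrow> 'k ncpoly" where
  "minor_poly q I J =
     (\<Sum>\<sigma> | \<sigma> permutes {..<card I}.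
        const ((- q) ^ perm_length (card I) \<sigma>) *
        (\<Prod>r\<leftarrow>[0..<card I]. X (sorted_list_of_set I ! r) (sorted_list_of_set J ! \<sigma> r)))"

definition quantum_minor ::
    "nat \<Rightarrow> 'k::field \<Rightarrow> nat set \<Rightarrow> nat set \<Rightarrow> 'k ncpoly set" where
  "quantum_minor n q I J = qclass n q (minor_poly q I J)"

definition minors_ideal ::
    "nat \<Rightarrow> 'k::field \<Rightarrow> nat \<Rightarrow> nat set \<Rightarrow> nat set \<Rightarrow> 'k ncpoly set set" where
  "minors_ideal n q s U V =
     Idl\<^bsub>quantum_matrices n q\<^esub>
       {quantum_minor n q I J | I J. I \<subseteq> U \<and> J \<subseteq> V \<and> card I = s \<and> card J = s}"

definition P_minus :: "nat \<Rightarrow> 'k::field \<Rightarrow> nat \<Rightarrow> nat \<Rightarrow> 'k ncpoly set set" where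
  "P_minus n q t l =
     minors_ideal n q (t + 1) {1..n} {1..n} <+>\<^bsub>quantum_matrices n q\<^esub>
     minors_ideal n q t {1..l} {1..n}"

definition P_plus :: "nat \<Rightarrow> 'k::field \<Rightarrow> nat \<Rightarrow> nat \<Rightarrow> 'k ncpoly set set" where
  "P_plus n q t l =
     minors_ideal n q (t + 1) {1..n} {1..n} <+>\<^bsub>quantum_matrices n q\<^esub>
     minors_ideal n q t {n - l + 1..n} {1..n}"

definition Q_minus :: "nat \<Rightarrow> 'k::field \<Rightarrow> nat \<Rightarrow> nat \<Rightarrow> 'k ncpoly set set" where
  "Q_minus n q t l' =
     minors_ideal n q (t + 1) {1..n} {1..n} <+>\<^bsub>quantum_matrices n q\<^esub>
     minors_ideal n q t {1..n} {1..l'}"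

definition Q_plus :: "nat \<Rightarrow> 'k::field \<Rightarrow> nat \<Rightarrow> nat \<Rightarrow> 'k ncpoly set set" where
  "Q_plus n q t l' =
     minors_ideal n q (t + 1) {1..n} {1..n} <+>\<^bsub>quantum_matrices n q\<^esub>
     minors_ideal n q t {1..n} {n - l' + 1..n}"

section \<open>The torus action and H-prime ideals\<close>

definition torus :: "nat \<Rightarrow> ((nat \<Rightarrow> 'k::field) \<times> (nat \<Rightarrow> 'k)) set" where
  "torus n = ({1..n} \<rightarrow>\<^sub>E UNIV - {0}) \<times> ({1..n} \<rightarrow>\<^sub>E UNIV - {0})"

text \<open>The algebra endomorphism of the free algebra substituting
  \<open>const (\<alpha> i * \<beta> j) * X i j\<close> for \<open>X i j\<close>. It preserves \<^const>\<open>quantum_ideal\<close>, so the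
  induced map on the quotient sends a coset to its image (lemma \<open>torus_act_qclass\<close> below).\<close>

definition free_torus_act ::
    "(nat \<Rightarrow> 'k::field) \<times> (nat \<Rightarrow> 'k) \<Rightarrow> 'k ncpoly \<Rightarrow> 'k ncpoly" where
  "free_torus_act h f =
     (\<Sum>w\<in>Poly_Mapping.keys f.
        const (Poly_Mapping.lookup f w) *
        (\<Prod>(i, j)\<leftarrow>w. const (fst h i * snd h j) * X i j))"

definition torus_act ::
    "(nat \<Rightarrow> 'k::field) \<times> (nat \<Rightarrow> 'k) \<Rightarrow> 'k ncpoly set \<Rightarrow> 'k ncpoly set" where
  "torus_act h a = free_torus_act h ` a"

definition H_invariant_ideal :: "nat \<Rightarrow> 'k::field \<Rightarrow> 'k ncpoly set set \<Rightarrow> bool" where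
  "H_invariant_ideal n q I \<longleftrightarrow>
     ideal I (quantum_matrices n q) \<and> (\<forall>h\<in>torus n. \<forall>a\<in>I. torus_act h a \<in> I)"

definition H_prime_ideal :: "nat \<Rightarrow> 'k::field \<Rightarrow> 'k ncpoly set set \<Rightarrow> bool" where
  "H_prime_ideal n q P \<longleftrightarrow>
     H_invariant_ideal n q P \<and> P \<noteq> carrier (quantum_matrices n q) \<and>
     (\<forall>I J. H_invariant_ideal n q I \<longrightarrow> H_invariant_ideal n q J \<longrightarrow>
        ideal_prod (quantum_matrices n q) I J \<subseteq> P \<longrightarrow> I \<subseteq> P \<or> J \<subseteq> P)"

section \<open>Well-definedness\<close>

lemma free_algebra_simps [simp]:
  "carrier (free_algebra n) = {f. Poly_Mapping.keys f \<subseteq> lists ({1..n} \<times> {1..n})}"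
  "monoid.mult (free_algebra n) = (*)" "one (free_algebra n) = 1"
  "zero (free_algebra n) = 0" "add (free_algebra n) = (+)"
  by (simp_all add: free_algebra_def)

lemma keys_mult_lists:
  fixes f g :: "'k::field ncpoly"
  assumes "Poly_Mapping.keys f \<subseteq> lists S" "Poly_Mapping.keys g \<subseteq> lists S"
  shows "Poly_Mapping.keys (f * g) \<subseteq> lists S"
proof
  fix w assume "w \<in> Poly_Mapping.keys (f * g)"
  then obtain a b where "w = a @ b" "a \<in> Poly_Mapping.keys f" "b \<in> Poly_Mapping.keys g"
    using Poly_Mapping.keys_mult[of f g] by (auto simp: plus_list_def)
  then show "w \<in> lists S" using assms by auto
qed

lemma ring_free_algebra: "ring (free_algebra n :: ('k::field) ncpoly ring)"
proof (rule ringI)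
  let ?L = "lists ({1..n} \<times> {1..n})"
  have add: "Poly_Mapping.keys (f + g) \<subseteq> ?L"
    if "Poly_Mapping.keys f \<subseteq> ?L" "Poly_Mapping.keys g \<subseteq> ?L" for f g :: "'k ncpoly"
    using that Poly_Mapping.keys_add[of f g] by blast
  have neg: "\<exists>g. Poly_Mapping.keys g \<subseteq> ?L \<and> g + f = 0"
    if "Poly_Mapping.keys f \<subseteq> ?L" for f :: "'k ncpoly"
    using that by (intro exI[of _ "- f"]) (auto simp: subset_iff in_keys_iff)
  show "abelian_group (free_algebra n :: 'k ncpoly ring)"
    by (rule abelian_groupI) (use add neg in \<open>simp_all add: add.assoc add.commute\<close>)
  show "Group.monoid (free_algebra n :: 'k ncpoly ring)"
    by (rule monoidI) (simp_all add: mult.assoc zero_list_def keys_mult_lists)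
qed (simp_all add: algebra_simps)

definition word_weight :: "(nat \<Rightarrow> 'k::field) \<times> (nat \<Rightarrow> 'k) \<Rightarrow> (nat \<times> nat) list \<Rightarrow> 'k" where
  "word_weight h w = (\<Prod>(i, j)\<leftarrow>w. fst h i * snd h j)"

lemma const_mult: "const a * Poly_Mapping.single w b = Poly_Mapping.single w (a * b)"
  by (simp add: const_def mult_single plus_list_def)

lemma prod_list_X:
  "(\<Prod>(i, j)\<leftarrow>w. const (fst h i * snd h j) * X i j) = Poly_Mapping.single w (word_weight h w)"
  by (induction w)
    (auto simp: word_weight_def X_def const_mult mult_single plus_list_def zero_list_def
      simp flip: single_one)

lemma free_torus_act_singles:
  "free_torus_act h f =
     (\<Sum>w\<in>Poly_Mapping.keys f. Poly_Mapping.single w (Poly_Mapping.lookup f w * word_weight h w))"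
  by (simp add: free_torus_act_def prod_list_X const_mult)

lemma lookup_free_torus_act:
  "Poly_Mapping.lookup (free_torus_act h f) w = Poly_Mapping.lookup f w * word_weight h w"
  by (simp add: free_torus_act_singles lookup_sum lookup_single when_def in_keys_iff)

lemma free_torus_act_add: "free_torus_act h (f + g) = free_torus_act h f + free_torus_act h g"
  by (rule poly_mapping_eqI) (simp add: lookup_free_torus_act lookup_add algebra_simps)

lemma free_torus_act_diff: "free_torus_act h (f - g) = free_torus_act h f - free_torus_act h g"
  by (rule poly_mapping_eqI) (simp add: lookup_free_torus_act lookup_minus algebra_simps)

lemma free_torus_act_zero: "free_torus_act h 0 = 0"
  by (rule poly_mapping_eqI) (simp add: lookup_free_torus_act)

lemma free_torus_act_sum: "free_torus_act h (\<Sum>x\<in>S. f x) = (\<Sum>x\<in>S. free_torus_act h (f x))"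
  by (induction S rule: infinite_finite_induct)
    (simp_all add: free_torus_act_add free_torus_act_zero)

lemma free_torus_act_single:
  "free_torus_act h (Poly_Mapping.single w c) = Poly_Mapping.single w (c * word_weight h w)"
  by (rule poly_mapping_eqI) (simp add: lookup_free_torus_act lookup_single when_def)

lemma free_torus_act_const: "free_torus_act h (const c) = const c"
  by (simp add: const_def free_torus_act_single word_weight_def)

lemma free_torus_act_one: "free_torus_act h 1 = 1"
  by (simp add: free_torus_act_single word_weight_def zero_list_def flip: single_one)

lemma free_torus_act_X: "free_torus_act h (X i j) = const (fst h i * snd h j) * X i j"
  by (simp add: X_def free_torus_act_single word_weight_def const_mult)

lemma sum_singles:
  "f = (\<Sum>w\<in>Poly_Mapping.keys f. Poly_Mapping.single w (Poly_Mapping.lookup f w))"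
  by (rule poly_mapping_eqI) (simp add: lookup_sum lookup_single when_def in_keys_iff)

lemma free_torus_act_mult: "free_torus_act h (f * g) = free_torus_act h f * free_torus_act h g"
proof -
  let ?s = "\<lambda>f w. Poly_Mapping.single w (Poly_Mapping.lookup f w) :: 'a ncpoly"
  have "free_torus_act h (f * g) = free_torus_act h
      ((\<Sum>w\<in>Poly_Mapping.keys f. ?s f w) * (\<Sum>w\<in>Poly_Mapping.keys g. ?s g w))"
    using sum_singles[of f] sum_singles[of g] by simp
  also have "\<dots> = (\<Sum>w\<in>Poly_Mapping.keys f. \<Sum>v\<in>Poly_Mapping.keys g.
      free_torus_act h (?s f w) * free_torus_act h (?s g v))"
    by (simp add: sum_product free_torus_act_sum mult_single free_torus_act_single
        word_weight_def plus_list_def mult_ac)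
  also have "\<dots> = free_torus_act h (\<Sum>w\<in>Poly_Mapping.keys f. ?s f w)
      * free_torus_act h (\<Sum>w\<in>Poly_Mapping.keys g. ?s g w)"
    by (simp add: sum_product free_torus_act_sum)
  finally show ?thesis
    using sum_singles[of f] sum_singles[of g] by simp
qed

lemma keys_X [simp]: "Poly_Mapping.keys (X i j :: 'k::field ncpoly) = {[(i, j)]}"
  by (simp add: X_def)

lemma keys_const: "Poly_Mapping.keys (const c) \<subseteq> {[]}"
  by (simp add: const_def)

lemma quantum_relations_carrier:
  "quantum_relations n (q :: 'k::field) \<subseteq> carrier (free_algebra n)"
proof -
  let ?L = "lists ({1..n} \<times> {1..n})"
  have c: "Poly_Mapping.keys (const c :: 'k ncpoly) \<subseteq> ?L" for c
    using keys_const[of c] by auto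
  have d: "Poly_Mapping.keys (f - g) \<subseteq> ?L"
    if "Poly_Mapping.keys f \<subseteq> ?L" "Poly_Mapping.keys g \<subseteq> ?L" for f g :: "'k ncpoly"
    proof -
    have "Poly_Mapping.keys (f - g) \<subseteq> Poly_Mapping.keys f \<union> Poly_Mapping.keys g"
      by (auto simp: in_keys_iff lookup_minus)
    then show ?thesis using that by blast
  qed
  have x: "Poly_Mapping.keys (X i j :: 'k ncpoly) \<subseteq> ?L" if "i \<in> {1..n}" "j \<in> {1..n}" for i j
    using that by simp
  have "Poly_Mapping.keys r \<subseteq> ?L" if "r \<in> quantum_relations n q" for r
    using that unfolding quantum_relations_def Un_iff mem_Collect_eq
    by (elim disjE exE conjE; simp only:) (intro d keys_mult_lists c x; assumption)+
  then show ?thesis by auto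
qed

lemma ideal_quantum_ideal: "ideal (quantum_ideal n q) (free_algebra n)"
  unfolding quantum_ideal_def
  by (rule ring.genideal_ideal[OF ring_free_algebra quantum_relations_carrier])

lemma ring_quantum_matrices: "ring (quantum_matrices n q)"
  unfolding quantum_matrices_def by (rule ideal.quotient_is_ring[OF ideal_quantum_ideal])

lemma free_torus_act_relation:
  fixes q :: "'k::field"
  assumes "r \<in> quantum_relations n q"
  shows "\<exists>c. free_torus_act h r = const c * r"
proof -
  note expand = free_torus_act_diff free_torus_act_single X_def const_mult mult_single plus_list_def
    right_diff_distrib word_weight_def
  consider i l j where "r = X i j * X l j - const q * (X l j * X i j)"
    | i j m where "r = X i j * X i m - const q * (X i m * X i j)"
    | i j l m where "r = X i j * X l m - X l m * X i j"
    | i j l m where "r = X i j * X l m - X l m * X i j - const (q - inverse q) * (X i m * X l j)"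
    using assms unfolding quantum_relations_def mult.assoc by blast
  then show ?thesis
  proof cases
    case (1 i l j)
    have "free_torus_act h r = const (fst h i * snd h j * (fst h l * snd h j)) * r"
      unfolding 1 by (simp add: expand mult_ac)
    then show ?thesis ..
  next
    case (2 i j m)
    have "free_torus_act h r = const (fst h i * snd h j * (fst h i * snd h m)) * r"
      unfolding 2 by (simp add: expand mult_ac)
    then show ?thesis ..
  next
    case (3 i j l m)
    have "free_torus_act h r = const (fst h i * snd h j * (fst h l * snd h m)) * r"
      unfolding 3 by (simp add: expand mult_ac)
    then show ?thesis ..
  next
    case (4 i j l m)
    have "free_torus_act h r = const (fst h i * snd h j * (fst h l * snd h m)) * r"
      unfolding 4 by (simp add: expand mult_ac right_diff_distrib')
    then show ?thesis ..
  qed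
qed

lemma keys_free_torus_act:
  "Poly_Mapping.keys (free_torus_act h f) \<subseteq> Poly_Mapping.keys f"
  by (auto simp: in_keys_iff lookup_free_torus_act)

lemma free_torus_act_quantum_ideal:
  fixes q :: "'k::field"
  assumes "f \<in> quantum_ideal n q"
  shows "free_torus_act h f \<in> quantum_ideal n q"
proof -
  let ?F = "free_algebra n :: 'k ncpoly ring"
  interpret Q: ideal "quantum_ideal n q" ?F by (rule ideal_quantum_ideal)
  let ?J = "{f \<in> carrier ?F. free_torus_act h f \<in> quantum_ideal n q}"
  have act: "free_torus_act h f \<in> carrier ?F" if "f \<in> carrier ?F" for f
    using that keys_free_torus_act[of h f] by auto
  have "ideal ?J ?F"
  proof (rule idealI[OF ring_free_algebra])
    have neg: "\<ominus>\<^bsub>?F\<^esub> f = - f" if "f \<in> carrier ?F" for f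
      using Q.l_neg[OF that] unfolding eq_neg_iff_add_eq_0 by simp
    show "subgroup ?J (add_monoid ?F)"
    proof (rule Q.add.subgroupI)
      show "?J \<subseteq> carrier ?F" by blast
      have "0 \<in> ?J" using additive_subgroup.zero_closed[OF Q.is_additive_subgroup] by (simp add: free_torus_act_zero)
      then show "?J \<noteq> {}" by blast
    next
      fix f assume f: "f \<in> ?J"
      then have fc: "f \<in> carrier ?F" by blast
      have "free_torus_act h (- f) = - free_torus_act h f"
        using free_torus_act_diff[of h 0 f] by (simp add: free_torus_act_zero)
      moreover have "- free_torus_act h f \<in> quantum_ideal n q"
        using f additive_subgroup.a_inv_closed[OF Q.is_additive_subgroup, of "free_torus_act h f"] neg[OF act[OF fc]] by simp
      moreover have "- f \<in> carrier ?F" using neg[OF fc] Q.add.inv_closed[OF fc] by simp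
      ultimately show "\<ominus>\<^bsub>?F\<^esub> f \<in> ?J" using neg[OF fc] by simp
    next
      fix f g assume "f \<in> ?J" "g \<in> ?J"
      then show "f \<oplus>\<^bsub>?F\<^esub> g \<in> ?J"
        using Q.add.m_closed[of f g] additive_subgroup.a_closed[OF Q.is_additive_subgroup,
            of "free_torus_act h f" "free_torus_act h g"]
        by (simp add: free_torus_act_add)
    qed
  next
    fix f g assume fg: "f \<in> ?J" "g \<in> carrier ?F"
    then show "g \<otimes>\<^bsub>?F\<^esub> f \<in> ?J"
      using Q.I_l_closed[of "free_torus_act h f" "free_torus_act h g"] act[of g]
        keys_mult_lists[of g _ f] by (simp add: free_torus_act_mult)
    show "f \<otimes>\<^bsub>?F\<^esub> g \<in> ?J"
      using fg Q.I_r_closed[of "free_torus_act h f" "free_torus_act h g"] act[of g]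
        keys_mult_lists[of f _ g] by (simp add: free_torus_act_mult)
  qed
  moreover have "quantum_relations n q \<subseteq> ?J"
  proof
    fix r assume r: "r \<in> quantum_relations n q"
    obtain c where c: "free_torus_act h r = const c * r"
      using free_torus_act_relation[OF r] by blast
    have rQ: "r \<in> quantum_ideal n q"
      using r ring.genideal_self[OF ring_free_algebra quantum_relations_carrier]
      unfolding quantum_ideal_def by blast
    have "const c \<in> carrier ?F" using keys_const[of c] by auto
    then have "const c * r \<in> quantum_ideal n q" using Q.I_l_closed[OF rQ] by simp
    then show "r \<in> ?J" using c subsetD[OF quantum_relations_carrier r] by simp
  qed
  ultimately have "quantum_ideal n q \<subseteq> ?J"
    unfolding quantum_ideal_def by (rule ring.genideal_minimal[OF ring_free_algebra])
  then show ?thesis using assms by blast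
qed

lemma torus_act_qclass:
  fixes q :: "'k::field"
  assumes h: "h \<in> torus n" and f: "f \<in> carrier (free_algebra n)"
  shows "torus_act h (qclass n q f) = qclass n q (free_torus_act h f)"
proof -
  let ?Q = "quantum_ideal n q"
  interpret Q: ideal ?Q "free_algebra n :: 'k ncpoly ring" by (rule ideal_quantum_ideal)
  have coset: "qclass n q g = (\<lambda>r. r + g) ` ?Q" for g
    by (auto simp: qclass_def a_r_coset_def')
  define h' where "h' = (\<lambda>i. inverse (fst h i), \<lambda>j. inverse (snd h j))"
  have nz: "fst h i \<noteq> 0" "snd h i \<noteq> 0" if "i \<in> {1..n}" for i
    using h that by (auto simp: torus_def PiE_iff)
  have weight: "word_weight h' w * word_weight h w = 1" if "w \<in> lists ({1..n} \<times> {1..n})" for w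
    using that
  proof (induction w)
    case (Cons x w)
    obtain i j where x: "x = (i, j)" by fastforce
    have "fst h i * snd h j * inverse (fst h i * snd h j) = 1"
      using Cons nz(1)[of i] nz(2)[of j] by (intro right_inverse) (auto simp: x)
    moreover have "word_weight h' (x # w) * word_weight h (x # w)
        = (fst h i * snd h j * inverse (fst h i * snd h j)) * (word_weight h' w * word_weight h w)"
      by (simp add: x word_weight_def h'_def)
    ultimately show ?case using Cons.IH by simp
  qed (simp add: word_weight_def)
  have inv: "free_torus_act h (free_torus_act h' r) = r" if "r \<in> ?Q" for r
  proof (rule poly_mapping_eqI)
    fix w
    have "Poly_Mapping.lookup r w = 0" if "w \<notin> lists ({1..n} \<times> {1..n})"
      using Q.a_Hcarr[OF \<open>r \<in> ?Q\<close>] that by (auto simp: in_keys_iff)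
    then show "Poly_Mapping.lookup (free_torus_act h (free_torus_act h' r)) w
        = Poly_Mapping.lookup r w"
      using weight[of w] by (cases "w \<in> lists ({1..n} \<times> {1..n})")
        (simp_all add: lookup_free_torus_act mult.assoc)
  qed
  have "free_torus_act h ` ?Q = ?Q"
  proof
    show "free_torus_act h ` ?Q \<subseteq> ?Q" using free_torus_act_quantum_ideal by blast
    show "?Q \<subseteq> free_torus_act h ` ?Q"
    proof
      fix r assume r: "r \<in> ?Q"
      then have "r = free_torus_act h (free_torus_act h' r)" using inv by simp
      then show "r \<in> free_torus_act h ` ?Q"
        using free_torus_act_quantum_ideal[OF r] by (rule image_eqI)
    qed
  qed
  then have "(\<lambda>r. r + free_torus_act h f) ` free_torus_act h ` ?Q
      = (\<lambda>r. r + free_torus_act h f) ` ?Q" by (rule arg_cong)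
  then show ?thesis
    unfolding torus_act_def coset image_image free_torus_act_add .
qed

corollary torus_act_generator:
  assumes "h \<in> torus n" "i \<in> {1..n}" "j \<in> {1..n}"
  shows "torus_act h (qclass n q (X i j)) = qclass n q (const (fst h i * snd h j) * X i j)"
  using assms by (subst torus_act_qclass) (simp_all add: free_torus_act_X)

corollary torus_act_ring_hom:
  assumes h: "h \<in> torus n"
  shows "torus_act h \<in> ring_hom (quantum_matrices n q) (quantum_matrices n q)"
proof -
  interpret Q: ideal "quantum_ideal n q" "free_algebra n" by (rule ideal_quantum_ideal)
  let ?F = "free_algebra n :: 'a ncpoly ring" and ?A = "quantum_matrices n q"
  have hom: "qclass n q \<in> ring_hom ?F ?A"
    unfolding qclass_def quantum_matrices_def by (rule Q.rcos_ring_hom)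
  have surj: "\<exists>f \<in> carrier ?F. x = qclass n q f" if "x \<in> carrier ?A" for x
    using that unfolding quantum_matrices_def FactRing_def A_RCOSETS_def' qclass_def by (simp del: free_algebra_simps)
  have act: "free_torus_act h f \<in> carrier ?F" if "f \<in> carrier ?F" for f
    using that keys_free_torus_act[of h f] by auto
  note coset = torus_act_qclass[OF h, where q = q]
  show ?thesis
  proof (rule ring_hom_memI)
    show "torus_act h \<one>\<^bsub>?A\<^esub> = \<one>\<^bsub>?A\<^esub>"
      using coset[OF Q.one_closed] ring_hom_one[OF hom, symmetric] by (simp add: free_torus_act_one)
  next
    fix x assume "x \<in> carrier ?A"
    from surj[OF this] obtain f where f: "f \<in> carrier ?F" "x = qclass n q f" by (rule bexE)
    then show "torus_act h x \<in> carrier ?A"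
      using coset[OF f(1)] ring_hom_closed[OF hom act[OF f(1)]] by (simp only:)
  next
    fix x y assume x: "x \<in> carrier ?A" and y: "y \<in> carrier ?A"
    from surj[OF x] obtain f where f: "f \<in> carrier ?F" "x = qclass n q f" by (rule bexE)
    from surj[OF y] obtain g where g: "g \<in> carrier ?F" "y = qclass n q g" by (rule bexE)
    show "torus_act h (x \<otimes>\<^bsub>?A\<^esub> y) = torus_act h x \<otimes>\<^bsub>?A\<^esub> torus_act h y"
      unfolding f(2) g(2) coset[OF f(1)] coset[OF g(1)] ring_hom_mult[OF hom f(1) g(1), symmetric]
        ring_hom_mult[OF hom act[OF f(1)] act[OF g(1)], symmetric]
        coset[OF Q.m_closed[OF f(1) g(1)]] by (simp only: free_torus_act_mult free_algebra_simps)
    show "torus_act h (x \<oplus>\<^bsub>?A\<^esub> y) = torus_act h x \<oplus>\<^bsub>?A\<^esub> torus_act h y"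
      unfolding f(2) g(2) coset[OF f(1)] coset[OF g(1)] ring_hom_add[OF hom f(1) g(1), symmetric]
        ring_hom_add[OF hom act[OF f(1)] act[OF g(1)], symmetric]
        coset[OF Q.add.m_closed[OF f(1) g(1)]] by (simp only: free_torus_act_add free_algebra_simps)
  qed
qed

end

theory Submission
  imports Defs "HOL-Library.Product_Lexorder" "HOL.Vector_Spaces"
begin

text \<open>
  Each of the four ideals is the kernel of a homomorphism to a domain, so it is even completely prime.
  Reversing the order of rows and columns is an anti-automorphism and reduces the claim to minors
  with \<open>I \<subseteq> {1..l}\<close>. For these, the generic matrix is evaluated at a product of bidiagonal quantum
  matrices with entries in a quantum torus, truncated so that the network of paths which expresses
  its minors (a quantum Lindstrom lemma) makes the prescribed minors vanish.

  Modulo the relations and the prescribed minors, each polynomial is a combination of the ordered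
  monomials whose multiset of letters contains no diagonal of a prescribed minor. These stay
  linearly independent after evaluation, by a count: products of minors along a pair of tableaux
  have pairwise distinct leading exponents in the torus, and growth diagrams (of RSK type when the
  two sides are opposite, of Burge type when they agree) inject the multisets above into the pairs
  of tableaux admitted by the network, preserving the total degree.
\<close>

section \<open>Linear operators on function spaces\<close>

text \<open>The obstacle is that leading exponents do not separate monomials. The leading exponent
  of a single entry splits into a row part and a column part, so \<open>X 1 1 * X 2 2\<close> and
  \<open>X 1 2 * X 2 1\<close>, where nonzero, have the same one. Products of minors along tableaux
  are separated. Independence is therefore proved for these products and transferred by counting:
  within the span of the evaluated standard words of degree at most d lie as many independent
  products as there are standard words, so the words are independent too. The sequences f and g join
  the two halves. A minor of the network is nonzero exactly when its r-th row index is at least f r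
  and its r-th column index, counted from the side in question, at least g r. In the growth diagram
  of a standard multiset, row r of a shape is present only where the same bounds hold. The diagonal
  of a minor is an increasing chain of letters; counting columns from the right makes it a
  decreasing one. This is why each choice of sides has its own growth rule and its own
  network.\<close>

typedef (overloaded) ('e, 'k::field) operator =
  "{F :: ('e \<Rightarrow> 'k) \<Rightarrow> 'e \<Rightarrow> 'k. \<forall>c g h. F (\<lambda>x. c * g x + h x) = (\<lambda>x. c * F g x + F h x)}"
  morphisms app Operator
  by (rule exI[of _ id]) simp

setup_lifting type_definition_operator

instantiation operator :: (type, field) ring
begin
lift_definition zero_operator :: "('a, 'b) operator" is "\<lambda>g x. 0" by simp
lift_definition plus_operator :: "('a, 'b) operator \<Rightarrow> ('a, 'b) operator \<Rightarrow> ('a, 'b) operator"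
  is "\<lambda>F G g x. F g x + G g x" by (simp add: fun_eq_iff algebra_simps)
lift_definition minus_operator :: "('a, 'b) operator \<Rightarrow> ('a, 'b) operator \<Rightarrow> ('a, 'b) operator"
  is "\<lambda>F G g x. F g x - G g x" by (simp add: fun_eq_iff algebra_simps)
lift_definition uminus_operator :: "('a, 'b) operator \<Rightarrow> ('a, 'b) operator"
  is "\<lambda>F g x. - F g x" by (simp add: fun_eq_iff algebra_simps)
lift_definition times_operator :: "('a, 'b) operator \<Rightarrow> ('a, 'b) operator \<Rightarrow> ('a, 'b) operator"
  is "\<lambda>F G g. F (G g)" by simp

lemma app_add_fun: "app F (\<lambda>x. g x + h x) = (\<lambda>x. app F g x + app F h x)"
proof -
  have "app F (\<lambda>x. 1 * g x + h x) = (\<lambda>x. 1 * app F g x + app F h x)" using app[of F] by blast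
  then show ?thesis by simp
qed

instance
proof
  fix a b c :: "('a, 'b) operator"
  show "a * (b + c) = a * b + a * c"
    by (rule app_inject[THEN iffD1]) (simp add: times_operator.rep_eq plus_operator.rep_eq app_add_fun)
qed (transfer; simp add: fun_eq_iff algebra_simps)+
end

instantiation operator :: (type, field) monoid_mult
begin
lift_definition one_operator :: "('a, 'b) operator" is "\<lambda>g. g" by simp
instance by standard (transfer; simp)+
end

lemma app_zero: "app 0 g x = 0" by transfer simp
lemma app_one: "app 1 g = g" by transfer simp
lemma app_add: "app (F + G) g x = app F g x + app G g x" by transfer simp
lemma app_mult: "app (F * G) g = app F (app G g)" by transfer simp
lemma app_sum: "app (\<Sum>i\<in>A. F i) g x = (\<Sum>i\<in>A. app (F i) g x)"
  by (induction A rule: infinite_finite_induct) (simp_all add: app_zero app_add)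

lift_definition scal :: "'k::field \<Rightarrow> ('e, 'k) operator" is "\<lambda>c g x. c * g x"
  by (simp add: fun_eq_iff algebra_simps)

lemma app_scal: "app (scal c) g x = c * g x" by transfer simp

lemma scal_comm: "scal c * F = F * scal c"
proof (transfer, rule ext)
  fix c :: 'b and F :: "('a \<Rightarrow> 'b) \<Rightarrow> 'a \<Rightarrow> 'b" and g
  assume *: "\<forall>c g h. F (\<lambda>x. c * g x + h x) = (\<lambda>x. c * F g x + F h x)"
  have z: "F (\<lambda>x. 0) = (\<lambda>x. 0)" using spec[OF spec[OF spec[OF *, of "-1"], of "\<lambda>x. 0"], of "\<lambda>x. 0"] by simp
  show "(\<lambda>x. c * F g x) = F (\<lambda>x. c * g x)"
    using spec[OF spec[OF spec[OF *, of c], of g], of "\<lambda>x. 0"] z by simp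
qed

lemma scal_left_commute: "F * (scal c * G) = scal c * (F * G)"
  by (metis scal_comm mult.assoc)

lemma scal_add: "scal (c + d) = scal c + scal d" by transfer (simp add: fun_eq_iff algebra_simps)
lemma scal_minus: "scal (- c) = - scal c" by transfer (simp add: fun_eq_iff algebra_simps)
lemma scal_mult: "scal (c * d) = scal c * scal d" by transfer (simp add: fun_eq_iff algebra_simps)
lemma scal_scal: "scal c * (scal d * F) = scal (c * d) * F" by (simp add: scal_mult mult.assoc)
lemma scal_0 [simp]: "scal 0 = 0" by transfer (simp add: fun_eq_iff)
lemma scal_1 [simp]: "scal 1 = 1" by transfer (simp add: fun_eq_iff)

text \<open>Supplies spans, independence and the bound on the size of independent sets for the count
  of dimensions.\<close>

interpretation operator_space: vector_space "\<lambda>c F. scal c * F :: ('e, 'k::field) operator"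
  by unfold_locales (simp_all add: algebra_simps scal_add scal_mult)

section \<open>Quantum tori\<close>

text \<open>Variables are triples (level, position, kind). On each level the variables
  \<open>a\<^sub>i = (k, i, False)\<close> and \<open>b\<^sub>i = (k, i, True)\<close> are to be the entries of a bidiagonal quantum matrix,
  which forces \<open>b\<^sub>i a\<^sub>i = q a\<^sub>i b\<^sub>i\<close> and \<open>a\<^sub>i b\<^sub>i\<^sub>+\<^sub>1 = q b\<^sub>i\<^sub>+\<^sub>1 a\<^sub>i\<close>; all other pairs commute.\<close>

type_synonym expo = "(nat \<times> nat \<times> bool) \<Rightarrow>\<^sub>0 nat"

definition linear_ext :: "('v \<Rightarrow> nat) \<Rightarrow> ('v \<Rightarrow>\<^sub>0 nat) \<Rightarrow> nat" where
  "linear_ext h u = (\<Sum>p\<in>Poly_Mapping.keys u. Poly_Mapping.lookup u p * h p)"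

lemma linear_ext_superset:
  assumes "finite S" "Poly_Mapping.keys u \<subseteq> S"
  shows "linear_ext h u = (\<Sum>p\<in>S. Poly_Mapping.lookup u p * h p)"
  unfolding linear_ext_def by (rule sum.mono_neutral_left) (use assms in \<open>auto simp: in_keys_iff\<close>)

lemma linear_ext_add: "linear_ext h (u + v) = linear_ext h u + linear_ext h v"
proof -
  let ?S = "Poly_Mapping.keys u \<union> Poly_Mapping.keys v"
  have "Poly_Mapping.keys (u + v) \<subseteq> ?S" by (rule Poly_Mapping.keys_add)
  then show ?thesis
    using linear_ext_superset[of ?S "u + v" h] linear_ext_superset[of ?S u h]
      linear_ext_superset[of ?S v h]
    by (simp add: lookup_add algebra_simps sum.distrib)
qed

lemma linear_ext_0 [simp]: "linear_ext h 0 = 0" by (simp add: linear_ext_def)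

lemma linear_ext_single [simp]: "linear_ext h (Poly_Mapping.single p c) = c * h p"
  by (simp add: linear_ext_def)

lemma linear_ext_add_fun: "linear_ext (\<lambda>p. h p + h' p) u = linear_ext h u + linear_ext h' u"
  by (simp add: linear_ext_def algebra_simps sum.distrib)

lemma linear_ext_cong:
  "(\<And>p. p \<in> Poly_Mapping.keys u \<Longrightarrow> h p = h' p) \<Longrightarrow> linear_ext h u = linear_ext h' u"
  by (simp add: linear_ext_def)

text \<open>Only one order of a noncommuting pair carries a factor: b_i a_i and a_i b_{i+1} have
  twist 1, the opposite orders twist 0. Variables of different levels do not interact.\<close>

definition twist :: "expo \<Rightarrow> expo \<Rightarrow> nat" where
  "twist u v = linear_ext (\<lambda>(k, i, s). if s then Poly_Mapping.lookup v (k, i, False)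
     else Poly_Mapping.lookup v (k, Suc i, True)) u"

lemma twist_add_left: "twist (u + u') v = twist u v + twist u' v"
  by (simp add: twist_def linear_ext_add)

lemma twist_add_right: "twist u (v + v') = twist u v + twist u v'"
  unfolding twist_def linear_ext_add_fun[symmetric]
  by (rule linear_ext_cong) (auto simp: lookup_add)

lemma twist_0 [simp]: "twist 0 v = 0" "twist u 0 = 0"
  by (simp_all add: twist_def linear_ext_def split_beta)

lemma twist_single:
  "twist (Poly_Mapping.single (k, i, s) c) v =
     c * (if s then Poly_Mapping.lookup v (k, i, False) else Poly_Mapping.lookup v (k, Suc i, True))"
  by (simp add: twist_def)

text \<open>The monomial with exponent \<open>u\<close>, realised as a weighted shift on functions
  of exponents. Since \<open>twist\<close> is biadditive, composing two shifts costs the factor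
  \<open>q ^ twist u v\<close>; the relations of the quantum torus thus hold inside a ring whose
  associativity is that of composition.\<close>

lift_definition tw :: "'k::field \<Rightarrow> expo \<Rightarrow> (expo, 'k) operator"
  is "\<lambda>q u g x. q ^ twist x u * g (x + u)"
  by (simp add: fun_eq_iff algebra_simps)

lemma app_tw: "app (tw q u) g x = q ^ twist x u * g (x + u)" by (simp add: tw.rep_eq)

lemma tw_0 [simp]: "tw q 0 = 1"
  by (rule app_inject[THEN iffD1]) (simp add: fun_eq_iff app_tw app_one)

lemma tw_mult: "tw q u * tw q v = scal (q ^ twist u v) * tw q (u + v)"
  by (rule app_inject[THEN iffD1])
    (simp add: fun_eq_iff app_mult app_tw app_scal twist_add_left twist_add_right power_add
      algebra_simps)

lemma tw_scal: "tw q u * (scal c * F) = scal c * (tw q u * F)"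
  by (rule scal_left_commute)

text \<open>The monomial with exponent \<open>v\<close>, applied to the indicator function of
  \<open>u\<close>, has the value 1 at 0 if \<open>u = v\<close> and the value 0 otherwise, so
  evaluation at 0 extracts a coefficient.\<close>

definition coef :: "(expo, 'k::field) operator \<Rightarrow> expo \<Rightarrow> 'k" where
  "coef F u = app F (\<lambda>x. if x = u then 1 else 0) 0"

lemma coef_add: "coef (F + G) u = coef F u + coef G u" by (simp add: coef_def app_add)
lemma coef_0 [simp]: "coef 0 u = 0" by (simp add: coef_def app_zero)
lemma coef_sum: "coef (\<Sum>i\<in>A. F i) u = (\<Sum>i\<in>A. coef (F i) u)" by (simp add: coef_def app_sum)
lemma coef_scal: "coef (scal c * F) u = c * coef F u" by (simp add: coef_def app_mult app_scal)
lemma coef_tw: "coef (tw q u) v = (if u = v then 1 else 0)" by (simp add: coef_def app_tw)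

definition supp :: "(expo, 'k::field) operator \<Rightarrow> expo set" where
  "supp F = {u. coef F u \<noteq> 0}"

text \<open>The bound on the levels is there for commutation: the variables of level
  \<open>k\<close> commute with all of \<open>torus_alg q k\<close>, which separates the factors of
  a network.\<close>

inductive_set torus_alg :: "'k::field \<Rightarrow> nat \<Rightarrow> (expo, 'k) operator set" for q k where
  zero: "0 \<in> torus_alg q k"
| step: "F \<in> torus_alg q k \<Longrightarrow> (\<And>p. p \<in> Poly_Mapping.keys u \<Longrightarrow> fst p < k) \<Longrightarrow>
    scal c * tw q u + F \<in> torus_alg q k"

lemma torus_alg_monom:
  "(\<And>p. p \<in> Poly_Mapping.keys u \<Longrightarrow> fst p < k) \<Longrightarrow> scal c * tw q u \<in> torus_alg q k"
  using torus_alg.step[OF torus_alg.zero, of u k c q] by simp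

lemma torus_alg_tw:
  "(\<And>p. p \<in> Poly_Mapping.keys u \<Longrightarrow> fst p < k) \<Longrightarrow> tw q u \<in> torus_alg q k"
  using torus_alg_monom[of u k 1 q] by simp

lemma torus_alg_one: "1 \<in> torus_alg q k"
  using torus_alg_tw[of 0] by simp

lemma torus_alg_add: "F \<in> torus_alg q k \<Longrightarrow> G \<in> torus_alg q k \<Longrightarrow> F + G \<in> torus_alg q k"
  by (induction rule: torus_alg.induct) (auto simp: add.assoc intro: torus_alg.step)

lemma torus_alg_scal: "F \<in> torus_alg q k \<Longrightarrow> scal c * F \<in> torus_alg q k"
proof (induction rule: torus_alg.induct)
  case (step F u d)
  then show ?case using torus_alg.step[of "scal c * F" q k u "c * d"]
    by (simp add: distrib_left)
qed (simp add: torus_alg.zero)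

lemma torus_alg_sum: "(\<And>i. i \<in> A \<Longrightarrow> F i \<in> torus_alg q k) \<Longrightarrow> (\<Sum>i\<in>A. F i) \<in> torus_alg q k"
  by (induction A rule: infinite_finite_induct) (auto intro: torus_alg.zero torus_alg_add)

lemma torus_alg_mult:
  assumes "F \<in> torus_alg q k" "G \<in> torus_alg q k"
  shows "F * G \<in> torus_alg q k"
  using assms(1)
proof (induction rule: torus_alg.induct)
  case (step F u c)
  have "scal c * tw q u * G \<in> torus_alg q k"
    using assms(2)
  proof (induction rule: torus_alg.induct)
    case (step G v d)
    have "scal c * tw q u * (scal d * tw q v) = scal (c * d * q ^ twist u v) * tw q (u + v)"
      by (simp add: mult.assoc tw_scal tw_mult mult.left_commute)
    moreover have "scal (c * d * q ^ twist u v) * tw q (u + v) \<in> torus_alg q k"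
      using step(2) \<open>\<And>p. p \<in> Poly_Mapping.keys u \<Longrightarrow> fst p < k\<close> Poly_Mapping.keys_add[of u v]
      by (intro torus_alg_monom) blast
    ultimately show ?case using step.IH by (simp add: distrib_left torus_alg_add)
  qed (simp add: torus_alg.zero)
  then show ?case using step by (simp add: distrib_right torus_alg_add)
qed (simp add: torus_alg.zero)

lemma torus_alg_prod_list:
  "(\<And>x. x \<in> set xs \<Longrightarrow> f x \<in> torus_alg q k) \<Longrightarrow> (\<Prod>x\<leftarrow>xs. f x) \<in> torus_alg q k"
  by (induction xs) (auto intro: torus_alg_one torus_alg_mult)

lemma torus_alg_mono: "F \<in> torus_alg q k \<Longrightarrow> k \<le> k' \<Longrightarrow> F \<in> torus_alg q k'"
proof (induction rule: torus_alg.induct)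
  case (step F u c)
  then show ?case by (intro torus_alg.step) force+
qed (simp add: torus_alg.zero)

lemma torus_alg_expand:
  assumes "F \<in> torus_alg q k"
  shows "finite (supp F) \<and> (\<forall>u\<in>supp F. \<forall>p\<in>Poly_Mapping.keys u. fst p < k) \<and>
    (\<Sum>u\<in>supp F. scal (coef F u) * tw q u) = F"
  using assms
proof (induction rule: torus_alg.induct)
  case (step F u c)
  let ?G = "scal c * tw q u + F"
  have sub: "supp ?G \<subseteq> insert u (supp F)"
    by (auto simp: supp_def coef_add coef_scal coef_tw split: if_splits)
  note IH = conjunct1[OF step.IH] conjunct1[OF conjunct2[OF step.IH]] conjunct2[OF conjunct2[OF step.IH]]
  have fin: "finite (insert u (supp F))" using IH(1) by simp
  have split: "scal (coef ?G v) * tw q v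
      = scal (if u = v then c else 0) * tw q v + scal (coef F v) * tw q v" for v
    by (cases "u = v") (simp_all add: coef_add coef_scal coef_tw scal_add distrib_right)
  have "(\<Sum>v\<in>supp ?G. scal (coef ?G v) * tw q v)
      = (\<Sum>v\<in>insert u (supp F). scal (coef ?G v) * tw q v)"
    using sub fin by (intro sum.mono_neutral_left) (auto simp: supp_def)
  also have "\<dots> = (\<Sum>v\<in>insert u (supp F). scal (if u = v then c else 0) * tw q v)
      + (\<Sum>v\<in>insert u (supp F). scal (coef F v) * tw q v)"
    by (simp only: split sum.distrib)
  also have "\<dots> = ?G"
  proof -
    have "(\<Sum>v\<in>insert u (supp F). scal (coef F v) * tw q v)
        = (\<Sum>v\<in>supp F. scal (coef F v) * tw q v)"
      using fin by (intro sum.mono_neutral_right) (auto simp: supp_def)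
    moreover have "(\<Sum>v\<in>insert u (supp F). scal (if u = v then c else 0) * tw q v)
        = (\<Sum>v\<in>insert u (supp F). if v = u then scal c * tw q u else 0)"
      by (rule sum.cong) auto
    moreover have "\<dots> = scal c * tw q u"
      using fin by (subst sum.delta) simp_all
    ultimately show ?thesis by (simp only: IH(3))
  qed
  finally have "(\<Sum>v\<in>supp ?G. scal (coef ?G v) * tw q v) = ?G" .
  moreover have "finite (supp ?G)" using sub fin by (rule finite_subset)
  moreover have "\<forall>u\<in>supp ?G. \<forall>p\<in>Poly_Mapping.keys u. fst p < k"
    using sub step.hyps(2) IH(2) by blast
  ultimately show ?case by (intro conjI)
qed (simp add: supp_def)

lemmas finite_supp = torus_alg_expand[THEN conjunct1]
lemmas torus_alg_eq = torus_alg_expand[THEN conjunct2, THEN conjunct2]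

lemma supp_empty: "F \<in> torus_alg q k \<Longrightarrow> supp F = {} \<Longrightarrow> F = 0"
  by (drule torus_alg_eq) simp

lemma supp_add: "supp (F + G) \<subseteq> supp F \<union> supp G"
  by (auto simp: supp_def coef_add)

lemma supp_sum: "supp (\<Sum>i\<in>A. F i) \<subseteq> (\<Union>i\<in>A. supp (F i))"
proof
  fix u assume "u \<in> supp (\<Sum>i\<in>A. F i)"
  then have "(\<Sum>i\<in>A. coef (F i) u) \<noteq> 0" by (simp add: supp_def coef_sum)
  then obtain i where "i \<in> A" "coef (F i) u \<noteq> 0" by (rule sum.not_neutral_contains_not_neutral)
  then show "u \<in> (\<Union>i\<in>A. supp (F i))" by (auto simp: supp_def)
qed

lemma coef_mult:
  assumes "F \<in> torus_alg q k" "G \<in> torus_alg q k"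
  shows "coef (F * G) w = (\<Sum>u\<in>supp F. \<Sum>v\<in>supp G.
    if u + v = w then coef F u * coef G v * q ^ twist u v else 0)"
proof -
  have "F * G = (\<Sum>u\<in>supp F. scal (coef F u) * tw q u) * (\<Sum>v\<in>supp G. scal (coef G v) * tw q v)"
    using assms by (simp add: torus_alg_eq)
  also have "\<dots> = (\<Sum>u\<in>supp F. \<Sum>v\<in>supp G. scal (coef F u * coef G v * q ^ twist u v) * tw q (u + v))"
    by (simp add: sum_product mult.assoc tw_scal tw_mult)
  finally show ?thesis
    by (simp add: coef_sum coef_scal coef_tw if_distrib cong: if_cong)
qed

lemma supp_mult:
  assumes "F \<in> torus_alg q k" "G \<in> torus_alg q k" "w \<in> supp (F * G)"
  shows "\<exists>u\<in>supp F. \<exists>v\<in>supp G. w = u + v"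
proof (rule ccontr)
  assume "\<not> ?thesis"
  then have "coef (F * G) w = 0"
    unfolding coef_mult[OF assms(1,2)] by (intro sum.neutral ballI) auto
  then show False using assms(3) by (simp add: supp_def)
qed

lemma coef_mult_unique:
  assumes F: "F \<in> torus_alg q k" and G: "G \<in> torus_alg q k" and uv: "u \<in> supp F" "v \<in> supp G"
    and unique: "\<And>u' v'. u' \<in> supp F \<Longrightarrow> v' \<in> supp G \<Longrightarrow> u' + v' = u + v \<Longrightarrow> u' = u"
  shows "coef (F * G) (u + v) = coef F u * coef G v * q ^ twist u v"
proof -
  have "coef (F * G) (u + v) = (\<Sum>u'\<in>supp F. if u' = u then coef F u * coef G v * q ^ twist u v else 0)"
    unfolding coef_mult[OF F G]
  proof (rule sum.cong[OF refl])
    fix u' assume u': "u' \<in> supp F"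
    show "(\<Sum>v'\<in>supp G. if u' + v' = u + v then coef F u' * coef G v' * q ^ twist u' v' else 0)
        = (if u' = u then coef F u * coef G v * q ^ twist u v else 0)"
    proof (cases "u' = u")
      case True
      then show ?thesis using uv finite_supp[OF G] by (simp cong: if_cong)
    next
      case False
      then have "\<not> u' + v' = u + v" if "v' \<in> supp G" for v' using unique[OF u' that] by blast
      then show ?thesis using False by simp
    qed
  qed
  then show ?thesis using uv finite_supp[OF F] by simp
qed

text \<open>Exponents are linearly ordered through the lexicographic order on triples, and this
  order is compatible with addition. The sum of the two largest exponents therefore arises in one
  way only, with a nonzero coefficient.\<close>

lemma torus_alg_domain:
  assumes F: "F \<in> torus_alg q k" and G: "G \<in> torus_alg q k" and q: "q \<noteq> 0" and FG: "F * G = 0"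
  shows "F = 0 \<or> G = 0"
proof (rule ccontr)
  assume "\<not> ?thesis"
  then have "F \<noteq> 0" "G \<noteq> 0" by auto
  then have ne: "supp F \<noteq> {}" "supp G \<noteq> {}"
    using supp_empty F G by blast+
  define u v where "u = Max (supp F)" and "v = Max (supp G)"
  have uv: "u \<in> supp F" "v \<in> supp G"
    using ne finite_supp[OF F] finite_supp[OF G] by (auto simp: u_def v_def)
  have "u' = u" if "u' \<in> supp F" "v' \<in> supp G" "u' + v' = u + v" for u' v'
  proof -
    have "u' \<le> u" "v' \<le> v"
      using that finite_supp[OF F] finite_supp[OF G] by (auto simp: u_def v_def)
    then show ?thesis
      using that(3) by (metis add_less_le_mono order_less_irrefl order_le_less)
  qed
  from coef_mult_unique[OF F G uv this] uv q FG show False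
    by (simp add: supp_def)
qed

section \<open>Leading exponents\<close>

text \<open>\<open>W\<close> is a numerical weight under which different exponents may tie, so
  uniqueness of the maximum is part of the notion.\<close>

definition has_lead :: "(expo \<Rightarrow> nat) \<Rightarrow> (expo, 'k::field) operator \<Rightarrow> expo \<Rightarrow> bool" where
  "has_lead W F u \<longleftrightarrow> u \<in> supp F \<and> (\<forall>v\<in>supp F. v = u \<or> W v < W u)"

lemma has_lead_mult:
  assumes F: "F \<in> torus_alg q k" and G: "G \<in> torus_alg q k" and q: "q \<noteq> 0"
    and W: "\<And>u v. W (u + v) = W u + W v"
    and lead: "has_lead W F u" "has_lead W G v"
  shows "has_lead W (F * G) (u + v)"
proof -
  have uv: "u \<in> supp F" "v \<in> supp G" using lead by (auto simp: has_lead_def)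
  have le: "W u' \<le> W u" "W v' \<le> W v" if "u' \<in> supp F" "v' \<in> supp G" for u' v'
    using lead that by (auto simp: has_lead_def less_imp_le)
  have eq: "u' = u" if "u' \<in> supp F" "v' \<in> supp G" "W (u' + v') \<ge> W (u + v)" for u' v'
    using le[OF that(1,2)] that lead by (auto simp: has_lead_def W)
  have eq': "v' = v" if "u' \<in> supp F" "v' \<in> supp G" "W (u' + v') \<ge> W (u + v)" for u' v'
    using le[OF that(1,2)] that lead by (auto simp: has_lead_def W)
  have "coef (F * G) (u + v) = coef F u * coef G v * q ^ twist u v"
    by (rule coef_mult_unique[OF F G uv]) (rule eq, auto)
  then have "u + v \<in> supp (F * G)" using uv q by (auto simp: supp_def)
  moreover have "w = u + v \<or> W w < W (u + v)" if "w \<in> supp (F * G)" for w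
    using supp_mult[OF F G that] eq eq' by (metis linorder_not_le)
  ultimately show ?thesis by (simp add: has_lead_def)
qed

lemma has_lead_scal_tw: "c \<noteq> 0 \<Longrightarrow> has_lead W (scal c * tw q u) u"
  by (auto simp: has_lead_def supp_def coef_scal coef_tw split: if_splits)

lemma has_lead_add:
  assumes "has_lead W F u" "\<And>v. v \<in> supp G \<Longrightarrow> W v < W u"
  shows "has_lead W (F + G) u"
proof -
  have "u \<notin> supp G" using assms(2) by blast
  then have "coef G u = 0" by (simp add: supp_def)
  then have "u \<in> supp (F + G)" using assms(1) by (simp add: has_lead_def supp_def coef_add)
  moreover have "v = u \<or> W v < W u" if "v \<in> supp (F + G)" for v
    using supp_add[of F G] that assms by (auto simp: has_lead_def)
  ultimately show ?thesis by (simp add: has_lead_def)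
qed

lemma has_lead_prod_list:
  assumes "q \<noteq> 0" and W: "\<And>u v. W (u + v) = W u + W v"
    and "\<And>x. x \<in> set xs \<Longrightarrow> f x \<in> torus_alg q k \<and> has_lead W (f x) (e x)"
  shows "has_lead W (\<Prod>x\<leftarrow>xs. f x) (\<Sum>x\<leftarrow>xs. e x)"
  using assms(3)
proof (induction xs)
  case Nil
  show ?case using has_lead_scal_tw[of 1 W q 0] by simp
next
  case (Cons x xs)
  then show ?case
    using has_lead_mult[OF _ _ assms(1) W, of "f x" k "\<Prod>x\<leftarrow>xs. f x" "e x" "\<Sum>x\<leftarrow>xs. e x"]
    by (auto intro: torus_alg_prod_list)
qed

text \<open>Only a numerical weight is compared, so several exponents may be maximal at once; the
  combination is nonzero at each of them because the leading exponents are distinct.\<close>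

lemma independent_leads:
  assumes fin: "finite A" and lead: "\<And>i. i \<in> A \<Longrightarrow> has_lead W (F i) (e i)" and inj: "inj_on e A"
    and zero: "(\<Sum>i\<in>A. scal (c i) * F i) = 0" and i: "i \<in> A"
  shows "c i = 0"
proof (rule ccontr)
  assume ci: "c i \<noteq> 0"
  define B where "B = {i\<in>A. c i \<noteq> 0}"
  have B: "finite B" "B \<noteq> {}" using fin i ci by (auto simp: B_def)
  define m where "m = Max ((\<lambda>i. W (e i)) ` B)"
  have "m \<in> (\<lambda>i. W (e i)) ` B" using B by (auto simp: m_def)
  then obtain j where j: "j \<in> B" "W (e j) = m" by auto
  have "coef (F i') (e j) = 0" if i': "i' \<in> B" "i' \<noteq> j" for i'
  proof -
    have "W (e i') \<le> W (e j)" using B i' j by (auto simp: m_def)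
    moreover have "e i' \<noteq> e j" using inj i' j by (auto simp: B_def inj_on_def)
    ultimately show ?thesis using lead[of i'] i' by (auto simp: has_lead_def B_def supp_def)
  qed
  then have *: "c i' * coef (F i') (e j) = (if i' = j then c j * coef (F j) (e j) else 0)"
    if "i' \<in> A" for i'
    using that by (cases "c i' = 0") (auto simp: B_def)
  have "coef (\<Sum>i\<in>A. scal (c i) * F i) (e j) = (\<Sum>i'\<in>A. c i' * coef (F i') (e j))"
    by (simp add: coef_sum coef_scal)
  also have "\<dots> = (\<Sum>i'\<in>A. if i' = j then c j * coef (F j) (e j) else 0)"
    by (rule sum.cong[OF refl]) (rule *)
  also have "\<dots> = c j * coef (F j) (e j)"
    using fin j by (simp add: B_def)
  also have "\<dots> \<noteq> 0" using j lead[of j] by (auto simp: B_def has_lead_def supp_def)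
  finally show False using zero by simp
qed

section \<open>Quantum matrices with operator entries\<close>

type_synonym 'k op_matrix = "nat \<Rightarrow> nat \<Rightarrow> (expo, 'k) operator"

text \<open>The four families of defining relations in R-matrix form, which is visibly stable under
  transposition and under products of matrices with mutually commuting entries.\<close>

definition quantum_matrix :: "'k::field \<Rightarrow> 'k op_matrix \<Rightarrow> bool" where
  "quantum_matrix q M \<longleftrightarrow> (\<forall>i l j m.
     scal (if i = l then q else 1) * (M i j * M l m)
       + scal (if l < i then q - inverse q else 0) * (M l j * M i m)
     = scal (if j = m then q else 1) * (M l m * M i j)
       + scal (if j < m then q - inverse q else 0) * (M l j * M i m))"

lemma quantum_matrixD:
  "quantum_matrix q M \<Longrightarrow>
     scal (if i = l then q else 1) * (M i j * M l m)
       + scal (if l < i then q - inverse q else 0) * (M l j * M i m)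
     = scal (if j = m then q else 1) * (M l m * M i j)
       + scal (if j < m then q - inverse q else 0) * (M l j * M i m)"
  unfolding quantum_matrix_def by blast

lemma quantum_matrix_transpose: "quantum_matrix q M \<Longrightarrow> quantum_matrix q (\<lambda>i j. M j i)"
  unfolding quantum_matrix_def
proof (intro allI)
  fix i l j m :: nat
  assume *: "\<forall>i l j m. scal (if i = l then q else 1) * (M i j * M l m)
       + scal (if l < i then q - inverse q else 0) * (M l j * M i m)
     = scal (if j = m then q else 1) * (M l m * M i j)
       + scal (if j < m then q - inverse q else 0) * (M l j * M i m)"
  \<comment> \<open>The instance with rows m, j and columns l, i is this equation with its sides
    exchanged.\<close>
  show "scal (if i = l then q else 1) * (M j i * M m l)
       + scal (if l < i then q - inverse q else 0) * (M j l * M m i)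
     = scal (if j = m then q else 1) * (M m l * M j i)
       + scal (if j < m then q - inverse q else 0) * (M j l * M m i)"
    using *[rule_format, of m j l i] by (simp add: eq_commute)
qed

lemma row_relation:
  assumes M: "quantum_matrix q M" and q: "q \<noteq> 0" and jm: "j < m"
  shows "M i j * M i m = scal q * (M i m * M i j)"
  using quantum_matrixD[OF M, of i i m j] jm by simp

lemma column_relation:
  assumes M: "quantum_matrix q M" and q: "q \<noteq> 0" and il: "i < l"
  shows "M i j * M l j = scal q * (M l j * M i j)"
  using quantum_matrixD[OF M, of i l j j] il by simp

lemma antidiagonal_relation:
  assumes M: "quantum_matrix q M" and "i < l" "m < j"
  shows "M i j * M l m = M l m * M i j"
  using quantum_matrixD[OF M, of i l j m] assms by simp

lemma diagonal_relation:
  assumes M: "quantum_matrix q M" and "i < l" "j < m"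
  shows "M i j * M l m - M l m * M i j = scal (q - inverse q) * (M i m * M l j)"
  using quantum_matrixD[OF M, of i l j m] antidiagonal_relation[OF M, of i l j m] assms
  by simp

section \<open>Products of commuting quantum matrices\<close>

definition mat_prod :: "nat \<Rightarrow> 'k::field op_matrix \<Rightarrow> 'k op_matrix \<Rightarrow> 'k op_matrix" where
  "mat_prod n A B i j = (\<Sum>p\<in>{1..n}. A i p * B p j)"

text \<open>The relation for \<open>Y\<close> trades the coefficients depending on the rows i, l for
  coefficients depending on the summation indices s, p. After s and p are exchanged in one of the
  two sums, the relation for \<open>Z\<close> trades these for coefficients depending on the columns
  j, m.\<close>

lemma quantum_matrix_mat_prod:
  assumes Y: "quantum_matrix q Y" and Z: "quantum_matrix q Z"
    and comm: "\<And>i j l m. Y i j * Z l m = Z l m * Y i j"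
  shows "quantum_matrix q (mat_prod n Y Z)"
  unfolding quantum_matrix_def
proof (intro allI)
  fix i l j m :: nat
  let ?X = "mat_prod n Y Z" and ?S = "{1..n}"
  have swap: "(\<Sum>s\<in>?S. \<Sum>p\<in>?S. f s p) = (\<Sum>s\<in>?S. \<Sum>p\<in>?S. f p s)" for f :: "nat \<Rightarrow> nat \<Rightarrow> (expo, 'a) operator"
    by (rule sum.swap)
  have mult: "?X a b * ?X c d = (\<Sum>s\<in>?S. \<Sum>p\<in>?S. (Y a s * Y c p) * (Z s b * Z p d))" for a b c d
  proof -
    have "(Y a s * Z s b) * (Y c p * Z p d) = (Y a s * Y c p) * (Z s b * Z p d)" for s p
      by (metis comm mult.assoc)
    then show ?thesis by (simp add: mat_prod_def sum_product)
  qed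
  have scal_sum: "scal c * (\<Sum>s\<in>?S. \<Sum>p\<in>?S. f s p) = (\<Sum>s\<in>?S. \<Sum>p\<in>?S. scal c * f s p)" for c and f :: "nat \<Rightarrow> nat \<Rightarrow> (expo, 'a) operator"
    by (simp add: sum_distrib_left)
  define c1 where "c1 = (if i = l then q else 1)"
  define c2 where "c2 = (if l < i then q - inverse q else 0)"
  define c3 where "c3 = (if j = m then q else 1)"
  define c4 where "c4 = (if j < m then q - inverse q else 0)"
  have "scal c1 * (?X i j * ?X l m) + scal c2 * (?X l j * ?X i m)
      = (\<Sum>s\<in>?S. \<Sum>p\<in>?S. (scal c1 * (Y i s * Y l p) + scal c2 * (Y l s * Y i p)) * (Z s j * Z p m))"
    by (simp only: mult scal_sum sum.distrib distrib_right mult.assoc)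
  also have "\<dots> = (\<Sum>s\<in>?S. \<Sum>p\<in>?S. (scal (if s = p then q else 1) * (Y l p * Y i s)
       + scal (if s < p then q - inverse q else 0) * (Y l s * Y i p)) * (Z s j * Z p m))"
    unfolding c1_def c2_def by (subst quantum_matrixD[OF Y]) (rule refl)
  also have "\<dots> = (\<Sum>s\<in>?S. \<Sum>p\<in>?S. scal (if s = p then q else 1) * ((Y l p * Y i s) * (Z s j * Z p m)))
      + (\<Sum>s\<in>?S. \<Sum>p\<in>?S. scal (if s < p then q - inverse q else 0) * ((Y l s * Y i p) * (Z s j * Z p m)))"
    by (simp only: sum.distrib distrib_right mult.assoc)
  also have "(\<Sum>s\<in>?S. \<Sum>p\<in>?S. scal (if s < p then q - inverse q else 0) * ((Y l s * Y i p) * (Z s j * Z p m)))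
      = (\<Sum>s\<in>?S. \<Sum>p\<in>?S. scal (if p < s then q - inverse q else 0) * ((Y l p * Y i s) * (Z p j * Z s m)))"
    by (rule swap)
  also have "(\<Sum>s\<in>?S. \<Sum>p\<in>?S. scal (if s = p then q else 1) * ((Y l p * Y i s) * (Z s j * Z p m))) + \<dots>
      = (\<Sum>s\<in>?S. \<Sum>p\<in>?S. (Y l p * Y i s) * (scal (if s = p then q else 1) * (Z s j * Z p m)
          + scal (if p < s then q - inverse q else 0) * (Z p j * Z s m)))"
    by (simp only: sum.distrib[symmetric] distrib_left scal_left_commute)
  also have "\<dots> = (\<Sum>s\<in>?S. \<Sum>p\<in>?S. (Y l p * Y i s) * (scal c3 * (Z p m * Z s j) + scal c4 * (Z p j * Z s m)))"
    unfolding c3_def c4_def by (subst quantum_matrixD[OF Z]) (rule refl)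
  also have "\<dots> = (\<Sum>s\<in>?S. \<Sum>p\<in>?S. scal c3 * ((Y l p * Y i s) * (Z p m * Z s j)))
      + (\<Sum>s\<in>?S. \<Sum>p\<in>?S. scal c4 * ((Y l p * Y i s) * (Z p j * Z s m)))"
    by (simp only: sum.distrib[symmetric] distrib_left scal_left_commute)
  also have "(\<Sum>s\<in>?S. \<Sum>p\<in>?S. scal c3 * ((Y l p * Y i s) * (Z p m * Z s j)))
      = (\<Sum>s\<in>?S. \<Sum>p\<in>?S. scal c3 * ((Y l s * Y i p) * (Z s m * Z p j)))"
    by (rule swap)
  also have "(\<Sum>s\<in>?S. \<Sum>p\<in>?S. scal c4 * ((Y l p * Y i s) * (Z p j * Z s m)))
      = (\<Sum>s\<in>?S. \<Sum>p\<in>?S. scal c4 * ((Y l s * Y i p) * (Z s j * Z p m)))"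
    by (rule swap)
  finally show "scal c1 * (?X i j * ?X l m) + scal c2 * (?X l j * ?X i m)
      = scal c3 * (?X l m * ?X i j) + scal c4 * (?X l j * ?X i m)"
    by (simp only: mult scal_sum)
qed

section \<open>Bidiagonal quantum matrices\<close>

definition gen_var :: "nat \<Rightarrow> nat \<Rightarrow> bool \<Rightarrow> expo" where
  "gen_var k i s = Poly_Mapping.single (k, i, s) 1"

lemma lookup_gen_var: "Poly_Mapping.lookup (gen_var k i s) p = (if p = (k, i, s) then 1 else 0)"
  by (auto simp: gen_var_def lookup_single when_def)

lemma keys_gen_var [simp]: "Poly_Mapping.keys (gen_var k i s) = {(k, i, s)}"
  by (simp add: gen_var_def)

definition bidiagonal :: "'k::field \<Rightarrow> nat \<Rightarrow> 'k op_matrix" where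
  "bidiagonal q k i j = (if j = i then tw q (gen_var k i False)
     else if j = Suc i then tw q (gen_var k j True) else 0)"

lemma tw_same_level:
  "tw q (gen_var k i s) * tw q (gen_var k j s') =
     scal (if s \<and> \<not> s' \<and> i = j \<or> \<not> s \<and> s' \<and> j = Suc i then q else 1) *
     tw q (gen_var k i s + gen_var k j s')"
  by (auto simp: tw_mult gen_var_def twist_single lookup_single when_def)

lemma quantum_matrix_bidiagonal:
  assumes q: "q \<noteq> 0"
  shows "quantum_matrix q (bidiagonal q k)"
  unfolding quantum_matrix_def
proof (intro allI)
  fix i l j m :: nat
  consider "j = i" "m = l" | "j = i" "m = Suc l" | "j = Suc i" "m = l" | "j = Suc i" "m = Suc l"
    | "j \<noteq> i" "j \<noteq> Suc i" | "m \<noteq> l" "m \<noteq> Suc l" by blast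
  then show "scal (if i = l then q else 1) * (bidiagonal q k i j * bidiagonal q k l m)
       + scal (if l < i then q - inverse q else 0) * (bidiagonal q k l j * bidiagonal q k i m)
     = scal (if j = m then q else 1) * (bidiagonal q k l m * bidiagonal q k i j)
       + scal (if j < m then q - inverse q else 0) * (bidiagonal q k l j * bidiagonal q k i m)"
  proof cases
    case 1
    then show ?thesis by (auto simp: bidiagonal_def tw_same_level add.commute)
  next
    case 2
    \<comment> \<open>If the two entries share a row or a column, one side consists of the product
      with coefficient \<open>q * q\<close>, the other of the same monomial and the correction term;
      \<open>q * q = 1 + (q - inverse q) * q\<close> balances them.\<close>
    have id: "scal (q * q) * T = T + scal ((q - inverse q) * q) * T" for T :: "(expo, 'a) operator"
    proof -
      have "q * q = 1 + (q - inverse q) * q" using q by (simp add: algebra_simps)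
      then show ?thesis by (simp only: scal_add distrib_right scal_1 mult_1_left)
    qed
    consider "l = i" | "i = Suc l" | "l \<noteq> i" "i \<noteq> Suc l" by blast
    then show ?thesis
    proof cases
      case 1
      then show ?thesis using 2 id by (simp add: bidiagonal_def tw_same_level add.commute)
    next
      case _: 2
      then show ?thesis using 2 id by (simp add: bidiagonal_def tw_same_level add.commute)
    next
      case 3
      then show ?thesis using 2 by (auto simp: bidiagonal_def tw_same_level add.commute)
    qed
  next
    case 3
    consider "l = i" | "l = Suc i" | "l \<noteq> i" "l \<noteq> Suc i" by blast
    then show ?thesis
      using 3 by cases (auto simp: bidiagonal_def tw_same_level add.commute)
  next
    case 4
    then show ?thesis by (auto simp: bidiagonal_def tw_same_level add.commute)
  next
    case 5
    then show ?thesis by (auto simp: bidiagonal_def)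
  next
    case 6
    then show ?thesis by (auto simp: bidiagonal_def)
  qed
qed

text \<open>The graph of a strictly increasing injection between sets of indices: the equivalence
  also forces the relation to be single-valued and injective. Such 0/1 matrices satisfy the quantum
  relations and serve to truncate a network.\<close>

definition increasing_rel :: "(nat \<times> nat) set \<Rightarrow> bool" where
  "increasing_rel S \<longleftrightarrow> (\<forall>(i, j)\<in>S. \<forall>(l, m)\<in>S. i < l \<longleftrightarrow> j < m)"

lemma increasing_relD: "increasing_rel S \<Longrightarrow> (i, j) \<in> S \<Longrightarrow> (l, m) \<in> S \<Longrightarrow> i < l \<longleftrightarrow> j < m"
  unfolding increasing_rel_def by blast

lemma increasing_rel_eq:
  "increasing_rel S \<Longrightarrow> (i, j) \<in> S \<Longrightarrow> (l, m) \<in> S \<Longrightarrow> i = l \<longleftrightarrow> j = m"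
  using increasing_relD[of S i j l m] increasing_relD[of S l m i j] by (metis linorder_neq_iff)

definition rel_matrix :: "(nat \<times> nat) set \<Rightarrow> 'k::field op_matrix" where
  "rel_matrix S i j = (if (i, j) \<in> S then 1 else 0)"

lemma quantum_matrix_rel:
  assumes S: "increasing_rel S"
  shows "quantum_matrix q (rel_matrix S)"
  unfolding quantum_matrix_def
proof (intro allI)
  fix i l j m :: nat
  have "scal (if i = l then q else 1) * (rel_matrix S i j * rel_matrix S l m)
      = scal (if j = m then q else 1) * (rel_matrix S l m * rel_matrix S i j)"
    using increasing_rel_eq[OF S, of i j l m] by (simp add: rel_matrix_def)
  moreover have "scal (if l < i then q - inverse q else 0) * (rel_matrix S l j * rel_matrix S i m)
      = scal (if j < m then q - inverse q else 0) * (rel_matrix S l j * rel_matrix S i m)"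
    using increasing_relD[OF S, of l j i m] by (simp add: rel_matrix_def)
  ultimately show "scal (if i = l then q else 1) * (rel_matrix S i j * rel_matrix S l m)
       + scal (if l < i then q - inverse q else 0) * (rel_matrix S l j * rel_matrix S i m)
     = scal (if j = m then q else 1) * (rel_matrix S l m * rel_matrix S i j)
       + scal (if j < m then q - inverse q else 0) * (rel_matrix S l j * rel_matrix S i m)"
    by simp
qed

section \<open>Planar networks\<close>

datatype stage = Up | Down | Rel "(nat \<times> nat) set"

fun stage_matrix :: "'k::field \<Rightarrow> nat \<Rightarrow> stage \<Rightarrow> 'k op_matrix" where
  "stage_matrix q k Up = bidiagonal q k"
| "stage_matrix q k Down = (\<lambda>i j. bidiagonal q k j i)"
| "stage_matrix q k (Rel S) = rel_matrix S"

text \<open>The level of a factor is the number of factors behind it. Hence all factors use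
  different variables, and the first one uses those of the highest level, which the weight below
  makes dominant.\<close>

fun network :: "nat \<Rightarrow> 'k::field \<Rightarrow> stage list \<Rightarrow> 'k op_matrix" where
  "network n q [] = rel_matrix Id"
| "network n q (st # sts) = mat_prod n (stage_matrix q (length sts) st) (network n q sts)"

lemma bidiagonal_in_torus_alg: "bidiagonal q k i j \<in> torus_alg q (Suc k)"
  by (auto simp: bidiagonal_def torus_alg.zero intro: torus_alg_tw)

lemma rel_matrix_in_torus_alg: "rel_matrix S i j \<in> torus_alg q k"
  by (simp add: rel_matrix_def torus_alg.zero torus_alg_one)

lemma stage_in_torus_alg: "stage_matrix q k st i j \<in> torus_alg q (Suc k)"
  by (cases st) (simp_all add: bidiagonal_in_torus_alg rel_matrix_in_torus_alg)

lemma network_in_torus_alg: "network n q sts i j \<in> torus_alg q (length sts)"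
proof (induction sts arbitrary: i j)
  case (Cons st sts)
  then show ?case
    by (auto simp: mat_prod_def intro!: torus_alg_sum torus_alg_mult stage_in_torus_alg
        intro: torus_alg_mono[OF _ le_SucI[OF order_refl]])
qed (simp add: rel_matrix_in_torus_alg)

lemma tw_comm_lower_level:
  assumes "F \<in> torus_alg q k"
  shows "tw q (gen_var k i s) * F = F * tw q (gen_var k i s)"
  using assms
proof (induction rule: torus_alg.induct)
  case (step F u c)
  let ?v = "gen_var k i s"
  have not: "(k, j, s') \<notin> Poly_Mapping.keys u" for j s' using step.hyps(2)[of "(k, j, s')"] by auto
  then have "twist ?v u = 0"
    by (simp add: gen_var_def twist_single in_keys_iff)
  moreover have "twist u ?v = 0"
    unfolding twist_def linear_ext_def using not
    by (intro sum.neutral ballI) (auto simp: lookup_gen_var split: if_splits)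
  ultimately have "tw q ?v * tw q u = tw q u * tw q ?v" by (simp add: tw_mult add.commute)
  then have "tw q ?v * (scal c * tw q u) = scal c * tw q u * tw q ?v"
    by (simp add: tw_scal mult.assoc)
  then show ?case using step.IH by (simp only: distrib_left distrib_right)
qed simp

lemma stage_comm:
  assumes "F \<in> torus_alg q k"
  shows "stage_matrix q k st i j * F = F * stage_matrix q k st i j"
  by (cases st) (auto simp: bidiagonal_def rel_matrix_def tw_comm_lower_level[OF assms])

lemma quantum_matrix_network:
  assumes "q \<noteq> 0" "\<And>S. Rel S \<in> set sts \<Longrightarrow> increasing_rel S"
  shows "quantum_matrix q (network n q sts)"
  using assms(2)
proof (induction sts)
  case Nil
  show ?case by (auto simp: increasing_rel_def intro!: quantum_matrix_rel)
next
  case (Cons st sts)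
  have "quantum_matrix q (stage_matrix q (length sts) st)"
    using Cons.prems quantum_matrix_bidiagonal[OF assms(1)]
    by (cases st) (auto intro: quantum_matrix_rel quantum_matrix_transpose)
  then show ?case using Cons
    by (auto intro!: quantum_matrix_mat_prod stage_comm network_in_torus_alg)
qed

section \<open>Minors of networks\<close>

text \<open>Rows and columns are lists rather than sets, because expanding a product along its first
  factor produces row lists that may be unsorted or have repetitions.\<close>

definition op_minor :: "'k::field \<Rightarrow> 'k op_matrix \<Rightarrow> nat list \<Rightarrow> nat list \<Rightarrow> (expo, 'k) operator" where
  "op_minor q M xs ys = (\<Sum>\<sigma> | \<sigma> permutes {..<length ys}.
     scal ((- q) ^ perm_length (length ys) \<sigma>) * (\<Prod>r\<leftarrow>[0..<length ys]. M (xs ! r) (ys ! \<sigma> r)))"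

lemma op_minor_in_torus_alg:
  "(\<And>i j. M i j \<in> torus_alg q k) \<Longrightarrow> op_minor q M xs ys \<in> torus_alg q k"
  unfolding op_minor_def by (intro torus_alg_sum torus_alg_scal torus_alg_prod_list)

text \<open>Exchanging the positions \<open>r\<close> and \<open>Suc r\<close> carries the
  inversions of \<sigma> to inversions of the new permutation, and the former ascent becomes one
  more.\<close>

lemma perm_length_adjacent:
  assumes r: "Suc r < s" and less: "\<sigma> r < \<sigma> (Suc r)"
  shows "perm_length s (\<sigma> \<circ> Transposition.transpose r (Suc r)) = Suc (perm_length s \<sigma>)"
proof -
  let ?t = "Transposition.transpose r (Suc r)"
  let ?Inv = "\<lambda>\<sigma>. {(a, b). a < b \<and> b < s \<and> \<sigma> a > (\<sigma> b :: nat)}"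
  have fin: "finite (?Inv \<tau>)" for \<tau> by (rule finite_subset[of _ "{..<s} \<times> {..<s}"]) auto
  have inj: "inj_on (map_prod ?t ?t) A" for A
    by (rule inj_on_inverseI[of _ "map_prod ?t ?t"]) auto
  have mono: "?t a < ?t b" if "a < b" "(a, b) \<noteq> (r, Suc r)" for a b
    using that by (auto simp: Transposition.transpose_def)
  have lt: "?t a < s" if "a < s" for a using that r by (auto simp: Transposition.transpose_def)
  have inv: "?t (?t a) = a" for a by simp
  have "?Inv (\<sigma> \<circ> ?t) = insert (r, Suc r) (map_prod ?t ?t ` ?Inv \<sigma>)"
  proof (intro equalityI subsetI)
    fix x assume "x \<in> ?Inv (\<sigma> \<circ> ?t)"
    then obtain a b where x: "x = (a, b)" "a < b" "b < s" "\<sigma> (?t a) > \<sigma> (?t b)" by auto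
    show "x \<in> insert (r, Suc r) (map_prod ?t ?t ` ?Inv \<sigma>)"
    proof (cases "x = (r, Suc r)")
      case False
      then have "(?t a, ?t b) \<in> ?Inv \<sigma>" using x mono[of a b] lt[of b] by auto
      then have "map_prod ?t ?t (?t a, ?t b) \<in> map_prod ?t ?t ` ?Inv \<sigma>" by (rule imageI)
      then show ?thesis using x by simp
    qed simp
  next
    fix x assume "x \<in> insert (r, Suc r) (map_prod ?t ?t ` ?Inv \<sigma>)"
    then consider "x = (r, Suc r)" | a b where "x = (?t a, ?t b)" "a < b" "b < s" "\<sigma> a > \<sigma> b"
      by auto
    then show "x \<in> ?Inv (\<sigma> \<circ> ?t)"
    proof cases
      case 1
      then show ?thesis using r less by simp
    next
      case 2
      have "(a, b) \<noteq> (r, Suc r)" using 2 less by auto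
      then show ?thesis using 2 mono[of a b] lt[of b] by simp
    qed
  qed
  moreover have "(r, Suc r) \<notin> map_prod ?t ?t ` ?Inv \<sigma>"
  proof
    assume "(r, Suc r) \<in> map_prod ?t ?t ` ?Inv \<sigma>"
    then obtain a b where "?t a = r" "?t b = Suc r" "a < b" by (auto dest: sym)
    then show False by (auto simp: Transposition.transpose_def split: if_splits)
  qed
  ultimately show ?thesis
    unfolding perm_length_def using fin by (simp add: card_image[OF inj])
qed

text \<open>Permutations are paired by exchanging the positions \<open>r\<close> and
  \<open>Suc r\<close>. In the term with an ascent there the row relation brings out a factor
  \<open>q\<close>; the partner, longer by one, carries the extra factor \<open>- q\<close>, and the
  two cancel.\<close>

lemma op_minor_equal_rows:
  assumes M: "quantum_matrix q M" and q: "q \<noteq> 0" and ys: "sorted_wrt (<) ys"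
    and r: "Suc r < length ys" and eq: "xs ! r = xs ! Suc r"
  shows "op_minor q M xs ys = 0"
proof -
  let ?s = "length ys" and ?t = "Transposition.transpose r (Suc r)"
  let ?P = "{\<sigma>. \<sigma> permutes {..<?s}}"
  define T where "T \<sigma> = scal ((- q) ^ perm_length ?s \<sigma>) * (\<Prod>r\<leftarrow>[0..<?s]. M (xs ! r) (ys ! \<sigma> r))" for \<sigma>
  have t: "?t permutes {..<?s}" using r by (intro permutes_swap_id) auto
  have fin: "finite ?P" by (rule finite_permutations) simp
  have split: "[0..<?s] = [0..<r] @ [r, Suc r] @ [Suc (Suc r)..<?s]"
  proof -
    have "[0..<?s] = [0..<r] @ [r..<?s]" using r upt_add_eq_append[of 0 r "?s - r"] by simp
    moreover have "[r..<?s] = r # Suc r # [Suc (Suc r)..<?s]" using r by (simp add: upt_rec)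
    ultimately show ?thesis by simp
  qed
  have cancel: "T \<sigma> + T (\<sigma> \<circ> ?t) = 0" if \<sigma>: "\<sigma> permutes {..<?s}" "\<sigma> r < \<sigma> (Suc r)" for \<sigma>
  proof -
    define A where "A = (\<Prod>r\<leftarrow>[0..<r]. M (xs ! r) (ys ! \<sigma> r))"
    define B where "B = (\<Prod>r\<leftarrow>[Suc (Suc r)..<?s]. M (xs ! r) (ys ! \<sigma> r))"
    define x a b where "x = xs ! r" and "a = ys ! \<sigma> r" and "b = ys ! \<sigma> (Suc r)"
    have "\<sigma> (Suc r) < ?s" using permutes_in_image[OF \<sigma>(1), of "Suc r"] r by simp
    then have ab: "a < b" using ys \<sigma>(2) by (auto simp: a_def b_def sorted_wrt_iff_nth_less)
    have maps: "map (\<lambda>p. M (xs ! p) (ys ! \<sigma> (?t p))) [0..<r] = map (\<lambda>p. M (xs ! p) (ys ! \<sigma> p)) [0..<r]"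
      "map (\<lambda>p. M (xs ! p) (ys ! \<sigma> (?t p))) [Suc (Suc r)..<?s]
        = map (\<lambda>p. M (xs ! p) (ys ! \<sigma> p)) [Suc (Suc r)..<?s]"
      by (auto simp: Transposition.transpose_def)
    have 2: "T (\<sigma> \<circ> ?t) = scal ((- q) ^ Suc (perm_length ?s \<sigma>)) * (A * ((M x b * M x a) * B))"
      unfolding T_def perm_length_adjacent[where \<sigma>=\<sigma>, OF r \<sigma>(2)] split
      by (simp add: A_def B_def x_def a_def b_def eq[symmetric] mult.assoc maps del: power_Suc)
    have 1: "T \<sigma> = scal ((- q) ^ perm_length ?s \<sigma>) * (A * ((M x a * M x b) * B))"
      unfolding T_def split by (simp add: A_def B_def x_def a_def b_def eq[symmetric] mult.assoc)
    show ?thesis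
      unfolding 1 2 row_relation[OF M q ab] mult.assoc scal_left_commute[of A] scal_scal power_Suc
      by (simp add: scal_minus mult.commute)
  qed
  have "op_minor q M xs ys = (\<Sum>\<sigma>\<in>?P. T \<sigma>)" by (simp add: op_minor_def T_def)
  also have "\<dots> = (\<Sum>\<sigma>\<in>{\<sigma>\<in>?P. \<sigma> r < \<sigma> (Suc r)}. T \<sigma>) + (\<Sum>\<sigma>\<in>{\<sigma>\<in>?P. \<not> \<sigma> r < \<sigma> (Suc r)}. T \<sigma>)"
    using fin by (subst sum.union_disjoint[symmetric]) (auto intro: sum.cong)
  also have "(\<Sum>\<sigma>\<in>{\<sigma>\<in>?P. \<not> \<sigma> r < \<sigma> (Suc r)}. T \<sigma>) = (\<Sum>\<sigma>\<in>{\<sigma>\<in>?P. \<sigma> r < \<sigma> (Suc r)}. T (\<sigma> \<circ> ?t))"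
  proof (rule sum.reindex_bij_witness[of _ "\<lambda>\<sigma>. \<sigma> \<circ> ?t" "\<lambda>\<sigma>. \<sigma> \<circ> ?t"])
    fix \<sigma> assume *: "\<sigma> \<in> {\<sigma>\<in>?P. \<not> \<sigma> r < \<sigma> (Suc r)}"
    have "\<sigma> r \<noteq> \<sigma> (Suc r)" using * by (auto dest: permutes_inj simp: inj_eq)
    then show "\<sigma> \<circ> ?t \<in> {\<sigma>\<in>?P. \<sigma> r < \<sigma> (Suc r)}"
      using * permutes_compose[OF t] by auto
  next
    fix \<sigma> assume *: "\<sigma> \<in> {\<sigma>\<in>?P. \<sigma> r < \<sigma> (Suc r)}"
    then show "\<sigma> \<circ> ?t \<in> {\<sigma>\<in>?P. \<not> \<sigma> r < \<sigma> (Suc r)}"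
      using permutes_compose[OF t] by auto
  qed (auto simp: comp_assoc)
  also have "(\<Sum>\<sigma>\<in>{\<sigma>\<in>?P. \<sigma> r < \<sigma> (Suc r)}. T \<sigma>) + \<dots> = 0"
    unfolding sum.distrib[symmetric] by (intro sum.neutral ballI cancel) auto
  finally show ?thesis .
qed

lemma prod_list_sum_expand:
  fixes A B :: "nat \<Rightarrow> nat \<Rightarrow> (expo, 'k::field) operator"
  assumes comm: "\<And>r p r' p'. A r p * B r' p' = B r' p' * A r p" and fin: "finite S"
  shows "(\<Prod>r\<leftarrow>[0..<s]. \<Sum>p\<in>S. A r p * B r p) =
    (\<Sum>zs | length zs = s \<and> set zs \<subseteq> S. (\<Prod>r\<leftarrow>[0..<s]. A r (zs ! r)) * (\<Prod>r\<leftarrow>[0..<s]. B r (zs ! r)))"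
proof (induction s)
  case 0
  have "{zs. length zs = 0 \<and> set zs \<subseteq> S} = {[]}" by auto
  then show ?case by simp
next
  case (Suc s)
  let ?L = "\<lambda>s. {zs. length zs = s \<and> set zs \<subseteq> S}"
  let ?a = "\<lambda>s zs. (\<Prod>r\<leftarrow>[0..<s]. A r (zs ! r))" and ?b = "\<lambda>s zs. (\<Prod>r\<leftarrow>[0..<s]. B r (zs ! r))"
  have finL: "finite (?L s)" using finite_lists_length_eq[OF fin, of s] by (simp add: conj_commute)
  have comm': "?b s zs * A r p = A r p * ?b s zs" for zs r p
  proof -
    have "A r p * (\<Prod>r'\<leftarrow>rs. B r' (zs ! r')) = (\<Prod>r'\<leftarrow>rs. B r' (zs ! r')) * A r p" for rs
    proof (induction rs)
      case (Cons x rs)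
      have "A r p * (B x (zs ! x) * (\<Prod>r'\<leftarrow>rs. B r' (zs ! r')))
          = B x (zs ! x) * (A r p * (\<Prod>r'\<leftarrow>rs. B r' (zs ! r')))"
        by (simp only: mult.assoc[symmetric] comm)
      then show ?case by (simp only: list.map prod_list.Cons Cons.IH mult.assoc)
    qed simp
    then show ?thesis by simp
  qed
  have eq: "?a s (zs @ [p]) = ?a s zs" "?b s (zs @ [p]) = ?b s zs" if "length zs = s" for zs p
    using that by (auto intro!: arg_cong[of _ _ prod_list] simp: nth_append)
  have "(\<Prod>r\<leftarrow>[0..<Suc s]. \<Sum>p\<in>S. A r p * B r p)
      = (\<Sum>zs\<in>?L s. ?a s zs * ?b s zs) * (\<Sum>p\<in>S. A s p * B s p)"
    using Suc.IH by simp
  also have "\<dots> = (\<Sum>(zs, p)\<in>?L s \<times> S. (?a s zs * ?b s zs) * (A s p * B s p))"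
    using finL fin by (simp add: sum_product sum.cartesian_product)
  also have "\<dots> = (\<Sum>(zs, p)\<in>?L s \<times> S. ?a (Suc s) (zs @ [p]) * ?b (Suc s) (zs @ [p]))"
  proof (rule sum.cong[OF refl], clarify)
    fix zs :: "nat list" and p assume len: "s = length zs"
    have "?b s zs * (A s p * B s p) = A s p * (?b s zs * B s p)"
      by (simp only: mult.assoc[symmetric] comm')
    then have "(?a s zs * ?b s zs) * (A s p * B s p) = (?a s zs * A s p) * (?b s zs * B s p)"
      by (simp only: mult.assoc)
    then show "(?a (length zs) zs * ?b (length zs) zs) * (A (length zs) p * B (length zs) p)
      = ?a (Suc (length zs)) (zs @ [p]) * ?b (Suc (length zs)) (zs @ [p])"
      using len eq[of zs p] by (simp add: nth_append)
  qed
  also have "\<dots> = (\<Sum>zs\<in>?L (Suc s). ?a (Suc s) zs * ?b (Suc s) zs)"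
  proof -
    have "?L (Suc s) = (\<lambda>(zs, p). zs @ [p]) ` (?L s \<times> S)"
    proof (intro equalityI subsetI)
      fix zs assume zs: "zs \<in> ?L (Suc s)"
      then obtain zs' p where "zs = zs' @ [p]" by (cases zs rule: rev_cases) auto
      then show "zs \<in> (\<lambda>(zs, p). zs @ [p]) ` (?L s \<times> S)"
        using zs by (intro image_eqI[of _ _ "(zs', p)"]) auto
    qed auto
    moreover have "inj_on (\<lambda>(zs, p). zs @ [p]) (?L s \<times> S)" by (auto simp: inj_on_def)
    ultimately show ?thesis by (simp add: sum.reindex comp_def case_prod_unfold)
  qed
  finally show ?case .
qed

text \<open>A one-sided form of the Cauchy-Binet formula: the rows of \<open>A\<close> are
  multiplied out without being collected into minors, so \<open>zs\<close> ranges over all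
  words.\<close>

lemma op_minor_mat_prod:
  assumes "\<And>i j l m. A i j * B l m = B l m * A i j"
  shows "op_minor q (mat_prod n A B) xs ys =
    (\<Sum>zs | length zs = length ys \<and> set zs \<subseteq> {1..n}.
      (\<Prod>r\<leftarrow>[0..<length ys]. A (xs ! r) (zs ! r)) * op_minor q B zs ys)"
proof -
  let ?L = "{zs. length zs = length ys \<and> set zs \<subseteq> {1..n}}"
  let ?a = "\<lambda>zs. \<Prod>r\<leftarrow>[0..<length ys]. A (xs ! r) (zs ! r)"
  have "op_minor q (mat_prod n A B) xs ys = (\<Sum>\<sigma> | \<sigma> permutes {..<length ys}. \<Sum>zs\<in>?L.
      scal ((- q) ^ perm_length (length ys) \<sigma>) * (?a zs * (\<Prod>r\<leftarrow>[0..<length ys]. B (zs ! r) (ys ! \<sigma> r))))"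
    unfolding op_minor_def mat_prod_def sum_distrib_left[symmetric]
  proof (rule sum.cong[OF refl])
    fix \<sigma> :: "nat \<Rightarrow> nat"
    show "scal ((- q) ^ perm_length (length ys) \<sigma>)
        * (\<Prod>r\<leftarrow>[0..<length ys]. \<Sum>p = 1..n. A (xs ! r) p * B p (ys ! \<sigma> r)) =
      scal ((- q) ^ perm_length (length ys) \<sigma>) * (\<Sum>zs\<in>?L. ?a zs * (\<Prod>r\<leftarrow>[0..<length ys]. B (zs ! r) (ys ! \<sigma> r)))"
      by (subst prod_list_sum_expand[where A = "\<lambda>r p. A (xs ! r) p" and B = "\<lambda>r p. B p (ys ! \<sigma> r)"])
        (simp_all add: assms)
  qed
  also have "\<dots> = (\<Sum>zs\<in>?L. \<Sum>\<sigma> | \<sigma> permutes {..<length ys}.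
      ?a zs * (scal ((- q) ^ perm_length (length ys) \<sigma>) * (\<Prod>r\<leftarrow>[0..<length ys]. B (zs ! r) (ys ! \<sigma> r))))"
    by (subst sum.swap) (simp only: scal_left_commute)
  finally show ?thesis by (simp add: op_minor_def sum_distrib_left)
qed

section \<open>Leading exponents of network minors\<close>

text \<open>Only steps that change the position count. A family has at most \<open>n\<close> paths,
  so with base \<open>Suc n\<close> one such step on a level outweighs all steps on the levels
  below.\<close>

definition net_weight :: "nat \<Rightarrow> expo \<Rightarrow> nat" where
  "net_weight n = linear_ext (\<lambda>(k, i, s). if s then Suc n ^ k else 0)"

lemma net_weight_add: "net_weight n (u + v) = net_weight n u + net_weight n v"
  by (simp add: net_weight_def linear_ext_add)

lemma net_weight_0 [simp]: "net_weight n 0 = 0" by (simp add: net_weight_def)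

lemma net_weight_gen_var: "net_weight n (gen_var k i s) = (if s then Suc n ^ k else 0)"
  by (simp add: net_weight_def gen_var_def)

lemma net_weight_sum: "net_weight n (\<Sum>i\<in>A. u i) = (\<Sum>i\<in>A. net_weight n (u i))"
  by (induction A rule: infinite_finite_induct) (simp_all add: net_weight_add)

lemma supp_0 [simp]: "supp 0 = {}" by (simp add: supp_def)

lemma coef_1: "coef 1 u = (if u = 0 then 1 else 0)" by (simp add: coef_def app_one)

lemma supp_1 [simp]: "supp 1 = {0}" by (auto simp: supp_def coef_1 split: if_splits)

lemma supp_tw: "supp (tw q u) = {u}" by (auto simp: supp_def coef_tw split: if_splits)

lemma supp_scal: "supp (scal c * F) \<subseteq> supp F" by (auto simp: supp_def coef_scal)

lemma net_weight_stage: "u \<in> supp (stage_matrix q k st i j) \<Longrightarrow> net_weight n u \<le> Suc n ^ k"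
  by (cases st) (auto simp: bidiagonal_def rel_matrix_def supp_tw net_weight_gen_var split: if_splits)

lemma net_weight_prod_list:
  assumes "\<And>x. x \<in> set xs \<Longrightarrow> f x \<in> torus_alg q k"
    and "\<And>x u. x \<in> set xs \<Longrightarrow> u \<in> supp (f x) \<Longrightarrow> net_weight n u \<le> b"
    and "u \<in> supp (\<Prod>x\<leftarrow>xs. f x)"
  shows "net_weight n u \<le> length xs * b"
  using assms
proof (induction xs arbitrary: u)
  case (Cons x xs)
  have "f x \<in> torus_alg q k" "(\<Prod>x\<leftarrow>xs. f x) \<in> torus_alg q k"
    using Cons.prems(1) by (auto intro: torus_alg_prod_list)
  moreover have "u \<in> supp (f x * (\<Prod>x\<leftarrow>xs. f x))" using Cons.prems(3) by simp
  ultimately obtain v w where v: "v \<in> supp (f x)" and w: "w \<in> supp (\<Prod>x\<leftarrow>xs. f x)" and u: "u = v + w"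
    using supp_mult by metis
  have "net_weight n v \<le> b" using Cons.prems(2)[OF _ v] by simp
  moreover have "net_weight n w \<le> length xs * b"
    by (rule Cons.IH[OF _ _ w]) (use Cons.prems(1,2) in auto)
  ultimately show ?case by (simp add: u net_weight_add)
qed simp

definition net_minor :: "nat \<Rightarrow> 'k::field \<Rightarrow> stage list \<Rightarrow> nat list \<Rightarrow> nat list \<Rightarrow> (expo, 'k) operator" where
  "net_minor n q sts = op_minor q (network n q sts)"

lemma net_minor_in_torus_alg: "net_minor n q sts xs ys \<in> torus_alg q (length sts)"
  unfolding net_minor_def by (intro op_minor_in_torus_alg network_in_torus_alg)

lemma stage_prod_in_torus_alg:
  "(\<Prod>r\<leftarrow>rs. stage_matrix q k st (xs ! r) (zs ! r)) \<in> torus_alg q (Suc k)"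
  by (intro torus_alg_prod_list stage_in_torus_alg)

lemma net_minor_Cons:
  "net_minor n q (st # sts) xs ys = (\<Sum>zs | length zs = length ys \<and> set zs \<subseteq> {1..n}.
     (\<Prod>r\<leftarrow>[0..<length ys]. stage_matrix q (length sts) st (xs ! r) (zs ! r)) * net_minor n q sts zs ys)"
  unfolding net_minor_def network.simps
  by (rule op_minor_mat_prod) (rule stage_comm[OF network_in_torus_alg])

lemma net_weight_net_minor:
  assumes "length ys \<le> n" "u \<in> supp (net_minor n q sts xs ys)"
  shows "net_weight n u < Suc n ^ length sts"
  using assms(2)
proof (induction sts arbitrary: u xs)
  case Nil
  have "coef (\<Prod>r\<leftarrow>rs. rel_matrix Id (xs ! r) (ys ! \<sigma> r) :: (expo, 'a) operator) u = 0"
    if "u \<noteq> 0" for rs \<sigma>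
    using that
  proof (induction rs)
    case Nil
    then show ?case by (simp add: coef_1)
  qed (simp add: rel_matrix_def)
  then have "coef (net_minor n q [] xs ys) u = 0" if "u \<noteq> 0"
    using that by (simp add: net_minor_def op_minor_def coef_sum coef_scal)
  then have "u = 0" using Nil by (auto simp: supp_def)
  then show ?case by simp
next
  case (Cons st sts)
  let ?P = "\<lambda>zs. \<Prod>r\<leftarrow>[0..<length ys]. stage_matrix q (length sts) st (xs ! r) (zs ! r)"
  obtain zs where zs: "u \<in> supp (?P zs * net_minor n q sts zs ys)"
    using Cons.prems supp_sum unfolding net_minor_Cons by blast
  have "net_minor n q sts zs ys \<in> torus_alg q (Suc (length sts))"
    by (rule torus_alg_mono[OF net_minor_in_torus_alg]) simp
  from supp_mult[OF stage_prod_in_torus_alg this zs]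
  obtain v w where v: "v \<in> supp (?P zs)" and w: "w \<in> supp (net_minor n q sts zs ys)" and u: "u = v + w"
    by blast
  have "net_weight n v \<le> length ys * Suc n ^ length sts"
    using net_weight_prod_list[of "[0..<length ys]" "\<lambda>r. stage_matrix q (length sts) st (xs ! r) (zs ! r)"
        q "Suc (length sts)" n "Suc n ^ length sts" v] v
    by (auto simp: stage_in_torus_alg net_weight_stage)
  also have "\<dots> \<le> n * Suc n ^ length sts" using assms(1) by simp
  finally have "net_weight n v \<le> n * Suc n ^ length sts" .
  then show ?case using Cons.IH[OF w] by (simp add: u net_weight_add)
qed

section \<open>Families of disjoint paths\<close>

definition valid_index :: "nat \<Rightarrow> nat list \<Rightarrow> bool" where
  "valid_index n xs \<longleftrightarrow> sorted_wrt (<) xs \<and> set xs \<subseteq> {1..n}"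

lemma valid_index_less: "valid_index n xs \<Longrightarrow> r < r' \<Longrightarrow> r' < length xs \<Longrightarrow> xs ! r < xs ! r'"
  by (auto simp: valid_index_def sorted_wrt_iff_nth_less)

lemma valid_index_range: "valid_index n xs \<Longrightarrow> r < length xs \<Longrightarrow> 1 \<le> xs ! r \<and> xs ! r \<le> n"
  unfolding valid_index_def by (meson atLeastAtMost_iff nth_mem subset_iff)

lemma valid_indexI:
  "(\<And>r. Suc r < length xs \<Longrightarrow> xs ! r < xs ! Suc r) \<Longrightarrow>
   (\<And>r. r < length xs \<Longrightarrow> 1 \<le> xs ! r \<and> xs ! r \<le> n) \<Longrightarrow> valid_index n xs"
  unfolding valid_index_def by (auto simp: sorted_wrt_iff_nth_Suc_transp in_set_conv_nth)

lemma valid_index_length: "valid_index n xs \<Longrightarrow> length xs \<le> n"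
  using card_mono[of "{1..n}" "set xs"]
  by (auto simp: valid_index_def distinct_card strict_sorted_iff)

fun move :: "stage \<Rightarrow> nat \<Rightarrow> nat \<Rightarrow> bool" where
  "move Up x z \<longleftrightarrow> z = x \<or> z = Suc x"
| "move Down x z \<longleftrightarrow> z = x \<or> x = Suc z"
| "move (Rel S) x z \<longleftrightarrow> (x, z) \<in> S"

fun ahead :: "stage \<Rightarrow> nat \<Rightarrow> nat \<Rightarrow> bool" where
  "ahead Up x c \<longleftrightarrow> x \<le> c"
| "ahead Down x c \<longleftrightarrow> c \<le> x"
| "ahead (Rel S) x c \<longleftrightarrow> False"

text \<open>The position after \<open>j\<close> steps of a path that starts at \<open>x\<close> and
  moves at every step until it meets \<open>c\<close>.\<close>

fun pos :: "stage \<Rightarrow> nat \<Rightarrow> nat \<Rightarrow> nat \<Rightarrow> nat" where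
  "pos Up c x j = min (x + j) c"
| "pos Down c x j = max (x - j) c"
| "pos (Rel S) c x j = x"

text \<open>\<open>bidiagonal\<close> keeps the entry between i and i + 1 under the index i + 1, and
  a descending stage is its transpose; in both directions the variable of a move therefore belongs
  to the larger position.\<close>

definition move_expo :: "nat \<Rightarrow> nat \<Rightarrow> nat \<Rightarrow> expo" where
  "move_expo k x z = (if z = x then gen_var k x False else gen_var k (max x z) True)"

lemma stage_matrix_zero: "\<not> move st x z \<Longrightarrow> stage_matrix q k st x z = 0"
  by (cases st) (auto simp: bidiagonal_def rel_matrix_def)

lemma stage_matrix_move:
  "st = Up \<or> st = Down \<Longrightarrow> move st x z \<Longrightarrow> stage_matrix q k st x z = tw q (move_expo k x z)"
  by (auto simp: bidiagonal_def move_expo_def max_def)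

definition moves :: "nat \<Rightarrow> stage \<Rightarrow> nat list \<Rightarrow> nat list set" where
  "moves n st xs = {zs. length zs = length xs \<and> valid_index n zs \<and>
     (\<forall>r<length xs. move st (xs ! r) (zs ! r))}"

lemma prod_list_eq_0:
  fixes f :: "'b \<Rightarrow> ('e, 'k::field) operator"
  shows "x \<in> set xs \<Longrightarrow> f x = 0 \<Longrightarrow> (\<Prod>x\<leftarrow>xs. f x) = 0"
  by (induction xs) auto

lemma finite_index_lists: "finite {zs. length zs = s \<and> set zs \<subseteq> {1..n::nat}}"
  using finite_lists_length_eq[of "{1..n}" s] by (simp add: conj_commute)

lemma finite_moves: "finite (moves n st xs)"
  by (rule finite_subset[OF _ finite_index_lists[of "length xs" n]])
    (auto simp: moves_def valid_index_def)

lemma valid_index_nonadjacent: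
  assumes "length zs = s" "set zs \<subseteq> {1..n}" "\<not> valid_index n zs"
    "\<And>r. Suc r < s \<Longrightarrow> zs ! r \<le> zs ! Suc r"
  shows "\<exists>r. Suc r < s \<and> zs ! r = zs ! Suc r"
proof (rule ccontr)
  assume "\<not> ?thesis"
  then have "zs ! r < zs ! Suc r" if "Suc r < s" for r using assms(4) that by (metis order_le_less)
  then have "valid_index n zs" using assms(1,2) by (intro valid_indexI) (auto dest: nth_mem)
  then show False using assms(3) by simp
qed

text \<open>In the Cauchy-Binet expansion along a bidiagonal factor only weakly increasing index lists
  occur, and those with a repetition contribute a minor with two equal rows.\<close>

lemma net_minor_step:
  assumes q: "q \<noteq> 0" and st: "st = Up \<or> st = Down" and rel: "\<And>S. Rel S \<in> set sts \<Longrightarrow> increasing_rel S"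
    and xs: "valid_index n xs" and ys: "valid_index n ys" and len: "length xs = length ys"
  shows "net_minor n q (st # sts) xs ys = (\<Sum>zs\<in>moves n st xs.
     (\<Prod>r\<leftarrow>[0..<length ys]. stage_matrix q (length sts) st (xs ! r) (zs ! r)) * net_minor n q sts zs ys)"
  unfolding net_minor_Cons
proof (rule sum.mono_neutral_right[OF finite_index_lists])
  show "moves n st xs \<subseteq> {zs. length zs = length ys \<and> set zs \<subseteq> {1..n}}"
    using len by (auto simp: moves_def valid_index_def)
  show "\<forall>zs\<in>{zs. length zs = length ys \<and> set zs \<subseteq> {1..n}} - moves n st xs.
    (\<Prod>r\<leftarrow>[0..<length ys]. stage_matrix q (length sts) st (xs ! r) (zs ! r)) * net_minor n q sts zs ys = 0"
  proof
    fix zs assume zs: "zs \<in> {zs. length zs = length ys \<and> set zs \<subseteq> {1..n}} - moves n st xs"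
    show "(\<Prod>r\<leftarrow>[0..<length ys]. stage_matrix q (length sts) st (xs ! r) (zs ! r)) * net_minor n q sts zs ys = 0"
    proof (cases "\<forall>r<length xs. move st (xs ! r) (zs ! r)")
      case False
      then obtain r where "r < length ys" "\<not> move st (xs ! r) (zs ! r)" using len by auto
      then have "(\<Prod>r\<leftarrow>[0..<length ys]. stage_matrix q (length sts) st (xs ! r) (zs ! r)) = 0"
        by (intro prod_list_eq_0[of r]) (auto simp: stage_matrix_zero)
      then show ?thesis by simp
    next
      case True
      then have "\<not> valid_index n zs" using zs len by (auto simp: moves_def)
      moreover have "zs ! r \<le> zs ! Suc r" if "Suc r < length ys" for r
      proof -
        have "xs ! r < xs ! Suc r" using valid_index_less[OF xs, of r "Suc r"] that len by simp
        moreover have "move st (xs ! r) (zs ! r)" "move st (xs ! Suc r) (zs ! Suc r)"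
          using True that len by auto
        ultimately show ?thesis using st by auto
      qed
      ultimately obtain r where r: "Suc r < length ys" "zs ! r = zs ! Suc r"
        using zs valid_index_nonadjacent[of zs "length ys" n] by auto
      have "net_minor n q sts zs ys = 0"
        unfolding net_minor_def
        by (rule op_minor_equal_rows[OF quantum_matrix_network[OF q rel] q _ r])
          (use ys in \<open>simp_all add: valid_index_def\<close>)
      then show ?thesis by simp
    qed
  qed
qed

definition moves_expo :: "nat \<Rightarrow> nat list \<Rightarrow> nat list \<Rightarrow> expo" where
  "moves_expo k xs zs = (\<Sum>r<length xs. move_expo k (xs ! r) (zs ! r))"

lemma stage_prod_monomial:
  assumes q: "q \<noteq> 0" and st: "st = Up \<or> st = Down"
    and mv: "\<And>r. r < s \<Longrightarrow> move st (xs ! r) (zs ! r)"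
  shows "\<exists>c. c \<noteq> 0 \<and> (\<Prod>r\<leftarrow>[0..<s]. stage_matrix q k st (xs ! r) (zs ! r)) =
    scal c * tw q (\<Sum>r<s. move_expo k (xs ! r) (zs ! r))"
  using mv
proof (induction s)
  case 0
  show ?case by (rule exI[of _ 1]) simp
next
  case (Suc s)
  from Suc.IH[OF Suc.prems[OF less_SucI]]
  obtain c where c: "c \<noteq> 0" "(\<Prod>r\<leftarrow>[0..<s]. stage_matrix q k st (xs ! r) (zs ! r)) =
    scal c * tw q (\<Sum>r<s. move_expo k (xs ! r) (zs ! r))" by blast
  let ?u = "\<Sum>r<s. move_expo k (xs ! r) (zs ! r)" and ?v = "move_expo k (xs ! s) (zs ! s)"
  have "stage_matrix q k st (xs ! s) (zs ! s) = tw q ?v"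
    using Suc.prems[of s] st by (intro stage_matrix_move) auto
  then have "(\<Prod>r\<leftarrow>[0..<Suc s]. stage_matrix q k st (xs ! r) (zs ! r)) = scal c * (tw q ?u * tw q ?v)"
    using c by (simp add: mult.assoc)
  also have "\<dots> = scal (c * q ^ twist ?u ?v) * tw q (\<Sum>r<Suc s. move_expo k (xs ! r) (zs ! r))"
    by (simp add: tw_mult)
  finally show ?case using c(1) q by (intro exI[of _ "c * q ^ twist ?u ?v"]) simp
qed

lemma net_weight_moves_expo:
  "net_weight n (moves_expo k xs zs) = card {r. r < length xs \<and> zs ! r \<noteq> xs ! r} * Suc n ^ k"
proof -
  have "net_weight n (moves_expo k xs zs) = (\<Sum>r<length xs. if zs ! r \<noteq> xs ! r then Suc n ^ k else 0)"
    unfolding moves_expo_def net_weight_sum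
    by (rule sum.cong) (auto simp: move_expo_def net_weight_gen_var)
  also have "\<dots> = (\<Sum>r\<in>{r. r < length xs \<and> zs ! r \<noteq> xs ! r}. Suc n ^ k)"
    by (simp add: sum.If_cases Int_def lessThan_def conj_commute)
  finally show ?thesis by simp
qed

definition toward :: "stage \<Rightarrow> nat list \<Rightarrow> nat list \<Rightarrow> nat list" where
  "toward st cs xs = map (\<lambda>r. pos st (cs ! r) (xs ! r) 1) [0..<length xs]"

lemma pos_0: "ahead st x c \<Longrightarrow> pos st c x 0 = x"
  by (cases st) auto

lemma pos_Suc: "ahead st x c \<Longrightarrow> pos st c (pos st c x 1) j = pos st c x (Suc j)"
  by (cases st) auto

lemma ahead_pos: "ahead st x c \<Longrightarrow> ahead st (pos st c x j) c"
  by (cases st) auto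

text \<open>The greedy paths stay disjoint because the minimum, or the maximum, of two strictly
  increasing sequences is strictly increasing.\<close>

lemma toward_in_moves:
  assumes st: "st = Up \<or> st = Down" and xs: "valid_index n xs" and cs: "valid_index n cs"
    and len: "length cs = length xs" and ahead: "\<And>r. r < length xs \<Longrightarrow> ahead st (xs ! r) (cs ! r)"
  shows "toward st cs xs \<in> moves n st xs"
proof -
  have "valid_index n (toward st cs xs)"
  proof (rule valid_indexI)
    fix r assume "Suc r < length (toward st cs xs)"
    then have r: "Suc r < length xs" by (simp add: toward_def)
    have "xs ! r < xs ! Suc r" "cs ! r < cs ! Suc r"
      using valid_index_less[OF xs, of r "Suc r"] valid_index_less[OF cs, of r "Suc r"] r len by auto
    then show "toward st cs xs ! r < toward st cs xs ! Suc r"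
      using st r valid_index_range[OF xs, of r] valid_index_range[OF cs, of r] len
      by (auto simp: toward_def)
  next
    fix r assume "r < length (toward st cs xs)"
    then have r: "r < length xs" by (simp add: toward_def)
    show "1 \<le> toward st cs xs ! r \<and> toward st cs xs ! r \<le> n"
      using st r valid_index_range[OF xs, of r] valid_index_range[OF cs, of r] len
      by (auto simp: toward_def)
  qed
  moreover have "move st (xs ! r) (toward st cs xs ! r)" if "r < length xs" for r
    using st ahead[OF that] that by (auto simp: toward_def)
  ultimately show ?thesis by (simp add: moves_def toward_def)
qed

text \<open>A phase consists of \<open>p\<close> equal stages on the levels \<open>k\<close> to
  \<open>k + p - 1\<close>, the first step being on the highest; this gives step \<open>j\<close>
  the level \<open>k + (p - 1 - j)\<close>.\<close>

definition phase_expo :: "stage \<Rightarrow> nat \<Rightarrow> nat \<Rightarrow> nat list \<Rightarrow> nat list \<Rightarrow> expo" where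
  "phase_expo st k p xs cs = (\<Sum>j<p. \<Sum>r<length xs.
     move_expo (k + (p - 1 - j)) (pos st (cs ! r) (xs ! r) j) (pos st (cs ! r) (xs ! r) (Suc j)))"

lemma phase_expo_Suc:
  assumes "\<And>r. r < length xs \<Longrightarrow> ahead st (xs ! r) (cs ! r)"
  shows "phase_expo st k (Suc p) xs cs =
    moves_expo (k + p) xs (toward st cs xs) + phase_expo st k p (toward st cs xs) cs"
proof -
  have "phase_expo st k (Suc p) xs cs
      = (\<Sum>r<length xs. move_expo (k + p) (pos st (cs ! r) (xs ! r) 0) (pos st (cs ! r) (xs ! r) 1))
      + (\<Sum>j<p. \<Sum>r<length xs. move_expo (k + (p - 1 - j)) (pos st (cs ! r) (xs ! r) (Suc j))
          (pos st (cs ! r) (xs ! r) (Suc (Suc j))))"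
    unfolding phase_expo_def by (subst sum.lessThan_Suc_shift) simp
  also have "(\<Sum>r<length xs. move_expo (k + p) (pos st (cs ! r) (xs ! r) 0) (pos st (cs ! r) (xs ! r) 1))
      = moves_expo (k + p) xs (toward st cs xs)"
    unfolding moves_expo_def toward_def using assms by (intro sum.cong) (auto simp: pos_0)
  also have "(\<Sum>j<p. \<Sum>r<length xs. move_expo (k + (p - 1 - j)) (pos st (cs ! r) (xs ! r) (Suc j))
          (pos st (cs ! r) (xs ! r) (Suc (Suc j)))) = phase_expo st k p (toward st cs xs) cs"
    unfolding phase_expo_def using assms
    by (intro sum.cong) (auto simp: toward_def pos_Suc simp flip: One_nat_def)
  finally show ?thesis .
qed

lemma ahead_trans: "ahead st x y \<Longrightarrow> ahead st y z \<Longrightarrow> ahead st x z"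
  by (cases st) auto

context
  fixes n :: nat and q :: "'k::field" and st :: stage and rest :: "stage list" and ys :: "nat list"
  assumes q: "q \<noteq> 0" and st: "st = Up \<or> st = Down"
    and rel: "\<And>S. Rel S \<in> set rest \<Longrightarrow> increasing_rel S"
    and ys: "valid_index n ys"
begin

lemma rel_phase: "Rel S \<in> set (replicate p st @ rest) \<Longrightarrow> increasing_rel S"
  using rel st by auto

lemma phase_nonzero:
  assumes "valid_index n xs" "length xs = length ys" "net_minor n q (replicate p st @ rest) xs ys \<noteq> 0"
  shows "\<exists>zs. valid_index n zs \<and> length zs = length ys \<and> net_minor n q rest zs ys \<noteq> 0 \<and>
    (\<forall>r<length ys. ahead st (xs ! r) (zs ! r))"
  using assms
proof (induction p arbitrary: xs)
  case 0
  then show ?case using st by (intro exI[of _ xs]) auto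
next
  case (Suc p)
  have "(\<Sum>zs\<in>moves n st xs. (\<Prod>r\<leftarrow>[0..<length ys].
      stage_matrix q (length (replicate p st @ rest)) st (xs ! r) (zs ! r)) *
      net_minor n q (replicate p st @ rest) zs ys) \<noteq> 0"
    using net_minor_step[OF q st rel_phase Suc.prems(1) ys Suc.prems(2), where sts = "replicate p st @ rest"]
      Suc.prems(3) by simp
  then obtain ws where ws: "ws \<in> moves n st xs" and "(\<Prod>r\<leftarrow>[0..<length ys].
      stage_matrix q (length (replicate p st @ rest)) st (xs ! r) (ws ! r)) *
      net_minor n q (replicate p st @ rest) ws ys \<noteq> 0"
    by (rule sum.not_neutral_contains_not_neutral)
  then have nz: "net_minor n q (replicate p st @ rest) ws ys \<noteq> 0" by auto
  have "valid_index n ws" "length ws = length ys" using ws Suc.prems by (auto simp: moves_def)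
  from Suc.IH[OF this nz] obtain zs where zs: "valid_index n zs" "length zs = length ys"
    "net_minor n q rest zs ys \<noteq> 0" "\<forall>r<length ys. ahead st (ws ! r) (zs ! r)" by blast
  have "ahead st (xs ! r) (zs ! r)" if "r < length ys" for r
  proof -
    have "move st (xs ! r) (ws ! r)" using ws Suc.prems that by (auto simp: moves_def)
    then have "ahead st (xs ! r) (ws ! r)" using st by auto
    then show ?thesis using zs(4) that ahead_trans by blast
  qed
  then show ?case using zs by blast
qed

text \<open>The levels are weighted so that the first factor dominates; there the greedy family, in which
  every path that can still move does so, is the unique maximum.\<close>

lemma phase_lead:
  assumes lead: "has_lead (net_weight n) (net_minor n q rest cs ys) e"
    and cs: "valid_index n cs" and len: "length cs = length ys"
    and zero: "\<And>zs r. valid_index n zs \<Longrightarrow> length zs = length ys \<Longrightarrow> net_minor n q rest zs ys \<noteq> 0 \<Longrightarrow>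
      r < length ys \<Longrightarrow> ahead st (zs ! r) (cs ! r)"
    and "valid_index n xs" "length xs = length ys"
    and "\<And>r. r < length ys \<Longrightarrow> ahead st (xs ! r) (cs ! r) \<and> pos st (cs ! r) (xs ! r) p = cs ! r"
  shows "has_lead (net_weight n) (net_minor n q (replicate p st @ rest) xs ys)
    (phase_expo st (length rest) p xs cs + e)"
  using assms(5-)
proof (induction p arbitrary: xs)
  case 0
  then have "xs = cs" using pos_0 len by (intro nth_equalityI) metis+
  then show ?case using lead by (simp add: phase_expo_def)
next
  case (Suc p)
  let ?sts = "replicate p st @ rest" and ?zs = "toward st cs xs" and ?W = "net_weight n"
  let ?k = "length rest + p" and ?M = "moves n st xs"
  let ?P = "\<lambda>zs. \<Prod>r\<leftarrow>[0..<length ys]. stage_matrix q (length ?sts) st (xs ! r) (zs ! r)"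
  have k: "length ?sts = ?k" by simp
  have ahead: "ahead st (xs ! r) (cs ! r)" if "r < length xs" for r using Suc.prems that by auto
  have zs: "?zs \<in> ?M" using toward_in_moves[OF st Suc.prems(1) cs _ ahead] Suc.prems len by auto
  have alg: "?P zs \<in> torus_alg q (Suc ?k)" "net_minor n q ?sts zs ys \<in> torus_alg q (Suc ?k)" for zs
    unfolding k by (rule stage_prod_in_torus_alg) (rule torus_alg_mono[OF net_minor_in_torus_alg], simp)
  have mono: "\<exists>c. c \<noteq> 0 \<and> ?P zs = scal c * tw q (moves_expo ?k xs zs)" if "zs \<in> ?M" for zs
    using stage_prod_monomial[OF q st, of "length ys" xs zs ?k] that Suc.prems(2)
    unfolding k by (auto simp: moves_def moves_expo_def)
  have "has_lead ?W (net_minor n q ?sts ?zs ys) (phase_expo st (length rest) p ?zs cs + e)"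
  proof (rule Suc.IH)
    show "valid_index n ?zs" "length ?zs = length ys" using zs Suc.prems by (auto simp: moves_def)
    show "ahead st (?zs ! r) (cs ! r) \<and> pos st (cs ! r) (?zs ! r) p = cs ! r" if "r < length ys" for r
      using Suc.prems(3)[OF that] that Suc.prems(2)
      by (auto simp: toward_def ahead_pos pos_Suc simp flip: One_nat_def)
  qed
  moreover obtain c where c: "c \<noteq> 0" "?P ?zs = scal c * tw q (moves_expo ?k xs ?zs)"
    using mono[OF zs] by blast
  ultimately have main: "has_lead ?W (?P ?zs * net_minor n q ?sts ?zs ys)
      (moves_expo ?k xs ?zs + (phase_expo st (length rest) p ?zs cs + e))"
    using has_lead_mult[OF alg(1)[of ?zs] alg(2)[of ?zs] q, where W = ?W] has_lead_scal_tw[OF c(1)]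
    by (simp add: net_weight_add)
  let ?F = "\<Sum>zs\<in>?M - {?zs}. ?P zs * net_minor n q ?sts zs ys"
  have other: "?W v < ?W (moves_expo ?k xs ?zs + (phase_expo st (length rest) p ?zs cs + e))"
    if vF: "v \<in> supp ?F" for v
  proof -
    obtain z where z: "z \<in> ?M" "z \<noteq> ?zs" and v: "v \<in> supp (?P z * net_minor n q ?sts z ys)"
      using subsetD[OF supp_sum vF] by (elim UN_E) (rule that, auto)
    obtain d where d: "?P z = scal d * tw q (moves_expo ?k xs z)" using mono[OF z(1)] by blast
    obtain u w where u: "u \<in> supp (?P z)" and w: "w \<in> supp (net_minor n q ?sts z ys)" and v': "v = u + w"
      using supp_mult[OF alg v] by blast
    have u': "u = moves_expo ?k xs z" using u supp_scal[of d "tw q (moves_expo ?k xs z)"]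
      unfolding d by (auto simp: supp_tw)
    have W: "?W w < Suc n ^ ?k"
      using net_weight_net_minor[OF valid_index_length[OF ys] w] by (simp add: add.commute)
    have "net_minor n q ?sts z ys \<noteq> 0" using w by auto
    then have az: "ahead st (z ! r) (cs ! r)" if "r < length ys" for r
    proof -
      have "valid_index n z" "length z = length ys" using z Suc.prems by (auto simp: moves_def)
      from phase_nonzero[OF this \<open>net_minor n q ?sts z ys \<noteq> 0\<close>] show ?thesis
        using zero that ahead_trans by blast
    qed
    have mz: "move st (xs ! r) (z ! r)" if "r < length ys" for r
      using z that Suc.prems by (auto simp: moves_def)
    have lz: "length z = length ys" using z Suc.prems by (auto simp: moves_def)
    let ?A = "\<lambda>zs. {r. r < length xs \<and> zs ! r \<noteq> xs ! r}"
    have nth: "?zs ! r = pos st (cs ! r) (xs ! r) 1" if "r < length xs" for r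
      using that by (simp add: toward_def)
    \<comment> \<open>By \<open>az\<close> a path may not pass its target, so whenever it moves it
      makes the greedy step. A competing family can differ from the greedy one only by paths that
      stay.\<close>
    have eq: "z ! r = ?zs ! r" if "r < length xs" "z ! r \<noteq> xs ! r" for r
      using st az[of r] mz[of r] ahead[of r] that Suc.prems(2) nth[of r] by auto
    then have "?A z \<subseteq> ?A ?zs" by auto
    moreover have "?A z \<noteq> ?A ?zs"
    proof
      assume *: "?A z = ?A ?zs"
      have "z = ?zs"
      proof (rule nth_equalityI)
        show "length z = length ?zs" using lz Suc.prems by (simp add: toward_def)
        fix r assume "r < length z"
        then have r: "r < length xs" using lz Suc.prems(2) by simp
        have "r \<in> ?A z \<longleftrightarrow> r \<in> ?A ?zs" by (simp only: *)
        then show "z ! r = ?zs ! r" using eq[OF r] r by (cases "z ! r = xs ! r") simp_all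
      qed
      then show False using z by simp
    qed
    ultimately have "card (?A z) < card (?A ?zs)" by (intro psubset_card_mono) auto
    \<comment> \<open>Every missing move costs \<open>Suc n ^ ?k\<close>, and by \<open>W\<close>
      the lower levels cannot make up for it.\<close>
    then have "Suc (card (?A z)) * Suc n ^ ?k \<le> card (?A ?zs) * Suc n ^ ?k"
      by (intro mult_right_mono) auto
    then show ?thesis using W by (simp add: v' u' net_weight_add net_weight_moves_expo)
  qed
  have "net_minor n q (replicate (Suc p) st @ rest) xs ys = ?P ?zs * net_minor n q ?sts ?zs ys + ?F"
    using net_minor_step[OF q st rel_phase Suc.prems(1) ys Suc.prems(2), where sts = ?sts] finite_moves zs
    by (simp add: sum.remove[OF finite_moves zs])
  then show ?case
    using has_lead_add[OF main other] phase_expo_Suc[OF ahead, of "length rest" p]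
    by (simp add: add.assoc)
qed

end

section \<open>Minors at the end of a network and through relation stages\<close>

lemma sorted_lists_eq:
  "sorted_wrt (<) xs \<Longrightarrow> sorted_wrt (<) ys \<Longrightarrow> set xs = set ys \<Longrightarrow> xs = (ys :: nat list)"
  using strict_sorted_equal by blast

lemma net_minor_Nil_nonzero:
  assumes xs: "valid_index n xs" and ys: "valid_index n ys" and len: "length xs = length ys"
    and nz: "net_minor n q [] xs ys \<noteq> 0"
  shows "xs = ys"
proof -
  obtain \<sigma> where \<sigma>: "\<sigma> permutes {..<length ys}"
    and nz': "(\<Prod>r\<leftarrow>[0..<length ys]. rel_matrix Id (xs ! r) (ys ! \<sigma> r)) \<noteq> (0 :: (expo, 'a) operator)"
  proof -
    have "(\<Sum>\<sigma> | \<sigma> permutes {..<length ys}. scal ((- q) ^ perm_length (length ys) \<sigma>) *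
        (\<Prod>r\<leftarrow>[0..<length ys]. rel_matrix Id (xs ! r) (ys ! \<sigma> r))) \<noteq> 0"
      using nz by (simp add: net_minor_def op_minor_def)
    then obtain \<sigma> where "\<sigma> \<in> {\<sigma>. \<sigma> permutes {..<length ys}}"
      "scal ((- q) ^ perm_length (length ys) \<sigma>) *
        (\<Prod>r\<leftarrow>[0..<length ys]. rel_matrix Id (xs ! r) (ys ! \<sigma> r)) \<noteq> 0"
      by (rule sum.not_neutral_contains_not_neutral)
    then show ?thesis using that by auto
  qed
  have eq: "xs ! r = ys ! \<sigma> r" if "r < length ys" for r
  proof (rule ccontr)
    assume "xs ! r \<noteq> ys ! \<sigma> r"
    then have "(\<Prod>r\<leftarrow>[0..<length ys]. rel_matrix Id (xs ! r) (ys ! \<sigma> r)) = (0 :: (expo, 'a) operator)"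
      using that by (intro prod_list_eq_0[of r]) (auto simp: rel_matrix_def)
    then show False using nz' by simp
  qed
  have "set xs = (\<lambda>r. xs ! r) ` {..<length ys}" using len by (auto simp: set_conv_nth)
  also have "\<dots> = (\<lambda>r. ys ! \<sigma> r) ` {..<length ys}" using eq by (intro image_cong) auto
  also have "\<dots> = (\<lambda>r. ys ! r) ` {..<length ys}"
    using permutes_image[OF \<sigma>] by (metis image_image)
  also have "\<dots> = set ys" by (auto simp: set_conv_nth)
  finally show ?thesis using xs ys by (intro sorted_lists_eq) (auto simp: valid_index_def)
qed

lemma perm_length_id: "perm_length s id = 0"
  unfolding perm_length_def by (subst card_eq_0_iff) auto

lemma net_minor_Nil_self:
  assumes ys: "valid_index n ys"
  shows "net_minor n q [] ys ys = 1"
proof -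
  let ?s = "length ys"
  let ?P = "{\<sigma>. \<sigma> permutes {..<?s}}"
  let ?T = "\<lambda>\<sigma>. scal ((- q) ^ perm_length ?s \<sigma>) *
    (\<Prod>r\<leftarrow>[0..<?s]. rel_matrix Id (ys ! r) (ys ! \<sigma> r)) :: (expo, 'a) operator"
  have "?T \<sigma> = 0" if \<sigma>: "\<sigma> permutes {..<?s}" "\<sigma> \<noteq> id" for \<sigma>
  proof -
    obtain r where r: "\<sigma> r \<noteq> r" using \<sigma>(2) by (auto simp: fun_eq_iff)
    then have rs: "r < ?s" using \<sigma>(1) by (metis lessThan_iff permutes_not_in)
    then have "\<sigma> r < ?s" using permutes_in_image[OF \<sigma>(1)] by simp
    then have "ys ! \<sigma> r \<noteq> ys ! r"
      using r rs ys by (auto simp: valid_index_def strict_sorted_iff nth_eq_iff_index_eq)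
    then have "(\<Prod>r\<leftarrow>[0..<?s]. rel_matrix Id (ys ! r) (ys ! \<sigma> r)) = (0 :: (expo, 'a) operator)"
      using rs by (intro prod_list_eq_0[of r]) (auto simp: rel_matrix_def)
    then show ?thesis by simp
  qed
  then have "(\<Sum>\<sigma>\<in>?P. ?T \<sigma>) = (\<Sum>\<sigma>\<in>{id}. ?T \<sigma>)"
    by (intro sum.mono_neutral_right) (auto simp: finite_permutations permutes_id)
  moreover have "(\<Prod>r\<leftarrow>rs. rel_matrix Id (ys ! r) (ys ! r)) = (1 :: (expo, 'a) operator)" for rs
    by (induction rs) (auto simp: rel_matrix_def)
  ultimately show ?thesis by (simp add: net_minor_def op_minor_def perm_length_id)
qed

text \<open>An increasing relation leaves a path no choice, so of all intermediate lists only
  \<open>zs\<close> contributes.\<close>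

lemma net_minor_Rel:
  assumes S: "increasing_rel S" and zs: "length zs = length ys" "set zs \<subseteq> {1..n}"
    and rel: "\<And>r. r < length ys \<Longrightarrow> (xs ! r, zs ! r) \<in> S"
  shows "net_minor n q (Rel S # sts) xs ys = net_minor n q sts zs ys"
proof -
  let ?T = "\<lambda>zs. (\<Prod>r\<leftarrow>[0..<length ys]. stage_matrix q (length sts) (Rel S) (xs ! r) (zs ! r)) * net_minor n q sts zs ys"
  have "?T zs' = 0" if zs': "length zs' = length ys" "zs' \<noteq> zs" for zs'
  proof -
    obtain r where r: "r < length ys" "zs' ! r \<noteq> zs ! r"
      using zs' zs(1) by (auto simp: list_eq_iff_nth_eq)
    then have "(xs ! r, zs' ! r) \<notin> S" using increasing_rel_eq[OF S _ rel, of "xs ! r" "zs' ! r" r] by auto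
    then have "(\<Prod>r\<leftarrow>[0..<length ys]. stage_matrix q (length sts) (Rel S) (xs ! r) (zs' ! r)) = 0"
      using r by (intro prod_list_eq_0[of r]) (auto simp: rel_matrix_def)
    then show ?thesis by simp
  qed
  then have "(\<Sum>zs | length zs = length ys \<and> set zs \<subseteq> {1..n}. ?T zs) = (\<Sum>zs\<in>{zs}. ?T zs)"
    by (intro sum.mono_neutral_right finite_index_lists) (use zs in auto)
  moreover have "(\<Prod>r\<leftarrow>rs. rel_matrix S (xs ! r) (zs ! r)) = (1 :: (expo, 'a) operator)"
    if "set rs \<subseteq> {..<length ys}" for rs
    using that by (induction rs) (auto simp: rel_matrix_def rel)
  from this[of "[0..<length ys]"]
  have "(\<Prod>r\<leftarrow>[0..<length ys]. rel_matrix S (xs ! r) (zs ! r)) = (1 :: (expo, 'a) operator)"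
    by (simp add: atLeast0LessThan)
  ultimately show ?thesis by (simp add: net_minor_Cons)
qed

lemma net_minor_Rel_nonzero:
  assumes "increasing_rel S" and nz: "net_minor n q (Rel S # sts) xs ys \<noteq> 0"
    and xs: "valid_index n xs" "length xs = length ys"
  obtains zs where "valid_index n zs" "length zs = length ys"
    "\<And>r. r < length ys \<Longrightarrow> (xs ! r, zs ! r) \<in> S" "net_minor n q sts zs ys \<noteq> 0"
proof -
  obtain zs where zs: "length zs = length ys" "set zs \<subseteq> {1..n}"
    and nz: "(\<Prod>r\<leftarrow>[0..<length ys]. rel_matrix S (xs ! r) (zs ! r)) * net_minor n q sts zs ys \<noteq> 0"
  proof -
    obtain zs where "zs \<in> {zs. length zs = length ys \<and> set zs \<subseteq> {1..n}}"
      "(\<Prod>r\<leftarrow>[0..<length ys]. rel_matrix S (xs ! r) (zs ! r)) * net_minor n q sts zs ys \<noteq> 0"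
      using nz unfolding net_minor_Cons stage_matrix.simps by (rule sum.not_neutral_contains_not_neutral)
    then show ?thesis using that by blast
  qed
  have S: "(xs ! r, zs ! r) \<in> S" if "r < length ys" for r
  proof (rule ccontr)
    assume "(xs ! r, zs ! r) \<notin> S"
    then have "(\<Prod>r\<leftarrow>[0..<length ys]. rel_matrix S (xs ! r) (zs ! r)) = (0 :: (expo, 'a) operator)"
      using that by (intro prod_list_eq_0[of r]) (auto simp: rel_matrix_def)
    then show False using nz by simp
  qed
  have "valid_index n zs"
  proof (rule valid_indexI)
    fix r assume r: "Suc r < length zs"
    then have "xs ! r < xs ! Suc r" using valid_index_less[OF xs(1)] xs(2) zs(1) by simp
    then show "zs ! r < zs ! Suc r" using increasing_relD[OF assms(1) S S, of r "Suc r"] r zs(1) by simp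
  next
    fix r assume "r < length zs"
    then have "zs ! r \<in> {1..n}" using zs(2) nth_mem by blast
    then show "1 \<le> zs ! r \<and> zs ! r \<le> n" by simp
  qed
  moreover have "net_minor n q sts zs ys \<noteq> 0" using nz by auto
  ultimately show ?thesis using zs(1) S that by blast
qed

section \<open>Reading the end points of paths off an exponent\<close>

lemma lookup_sum_expo: "Poly_Mapping.lookup (\<Sum>i\<in>A. f i) p = (\<Sum>i\<in>A. Poly_Mapping.lookup (f i) p)"
  by (induction A rule: infinite_finite_induct) (simp_all add: lookup_add)

lemma lookup_move_expo:
  "Poly_Mapping.lookup (move_expo k x z) (k', i, b) =
     (if k' = k \<and> (if b then z \<noteq> x \<and> i = max x z else z = x \<and> i = x) then 1 else 0)"
  by (auto simp: move_expo_def lookup_gen_var)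

lemma lookup_phase_expo_other:
  "k' < k \<or> k + p \<le> k' \<Longrightarrow> Poly_Mapping.lookup (phase_expo st k p xs cs) (k', i, b) = 0"
  unfolding phase_expo_def lookup_sum_expo by (intro sum.neutral ballI) (auto simp: lookup_move_expo)

lemma lookup_phase_expo:
  assumes "j < p"
  shows "Poly_Mapping.lookup (phase_expo st k p xs cs) (k + (p - 1 - j), i, b) =
    card {r. r < length xs \<and> (let x = pos st (cs ! r) (xs ! r) j; z = pos st (cs ! r) (xs ! r) (Suc j)
      in if b then z \<noteq> x \<and> i = max x z else z = x \<and> i = x)}"
proof -
  let ?k = "k + (p - 1 - j)"
  let ?m = "\<lambda>j r. move_expo (k + (p - 1 - j)) (pos st (cs ! r) (xs ! r) j) (pos st (cs ! r) (xs ! r) (Suc j))"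
  have "Poly_Mapping.lookup (phase_expo st k p xs cs) (?k, i, b)
      = (\<Sum>j'<p. \<Sum>r<length xs. Poly_Mapping.lookup (?m j' r) (?k, i, b))"
    by (simp add: phase_expo_def lookup_sum_expo)
  also have "\<dots> = (\<Sum>j'\<in>{j}. \<Sum>r<length xs. Poly_Mapping.lookup (?m j' r) (?k, i, b))"
    using assms by (intro sum.mono_neutral_right) (auto intro!: sum.neutral simp: lookup_move_expo)
  also have "\<dots> = (\<Sum>r<length xs. if (let x = pos st (cs ! r) (xs ! r) j; z = pos st (cs ! r) (xs ! r) (Suc j)
      in if b then z \<noteq> x \<and> i = max x z else z = x \<and> i = x) then 1 else 0)"
    by (simp add: lookup_move_expo Let_def)
  finally show ?thesis by (simp add: sum.If_cases Int_def lessThan_def)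
qed

lemma card_at_most_one:
  "(\<And>r. P r \<Longrightarrow> r = r0) \<Longrightarrow> card {r. r < (s::nat) \<and> P r} = (if r0 < s \<and> P r0 then 1 else 0)"
proof -
  assume *: "\<And>r. P r \<Longrightarrow> r = r0"
  have "{r. r < s \<and> P r} = (if r0 < s \<and> P r0 then {r0} else {})" using * by auto
  then show ?thesis by simp
qed

text \<open>A path stays only at its own target, and different paths have different targets. The
  variable for staying at \<open>f r0\<close> therefore tells whether path \<open>r0\<close> has
  arrived within \<open>j\<close> steps.\<close>

lemma lookup_down_stay:
  assumes "j < n" and inj: "inj f" and len: "length xs = s"
  shows "Poly_Mapping.lookup (phase_expo Down k n xs (map f [0..<s])) (k + (n - 1 - j), f r0, False) =
    (if r0 < s \<and> xs ! r0 \<le> f r0 + j then 1 else 0)"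
proof -
  have "{r. r < length xs \<and> (let x = pos Down (map f [0..<s] ! r) (xs ! r) j;
      z = pos Down (map f [0..<s] ! r) (xs ! r) (Suc j)
      in if False then z \<noteq> x \<and> f r0 = max x z else z = x \<and> f r0 = x)}
    = {r. r < s \<and> (r = r0 \<and> xs ! r \<le> f r + j)}"
    (is "?A = ?B")
  proof (intro equalityI subsetI)
    fix r assume "r \<in> ?A"
    then have r: "r < s" "max (xs ! r - Suc j) (f r) = max (xs ! r - j) (f r)" "f r0 = max (xs ! r - j) (f r)"
      using len by (auto simp: Let_def)
    then have m: "max (xs ! r - j) (f r) = f r" by (auto simp: max_def split: if_splits)
    then have "f r0 = f r" using r(3) by simp
    then have "r = r0" using inj by (simp add: inj_eq)
    moreover have "xs ! r \<le> f r + j" using m by (auto simp: max_def split: if_splits)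
    ultimately show "r \<in> ?B" using r(1) by simp
  next
    fix r assume "r \<in> ?B"
    then have r: "r < s" "r = r0" "xs ! r0 - j \<le> f r0" "xs ! r0 - Suc j \<le> f r0" by auto
    then show "r \<in> ?A" using len by (simp add: Let_def max_absorb2)
  qed
  moreover have "card ?B = (if r0 < s \<and> r0 = r0 \<and> xs ! r0 \<le> f r0 + j then 1 else 0)"
    by (rule card_at_most_one) simp
  ultimately show ?thesis by (simp only: lookup_phase_expo[OF assms(1)] refl simp_thms)
qed

text \<open>At step \<open>j\<close> every path still under way is exactly \<open>j\<close> above
  its starting point, so the variable of the move out of \<open>g r0 + j\<close> is available to
  path \<open>r0\<close> alone.\<close>

lemma lookup_up_move:
  assumes "j < n" and inj: "inj g" and len: "length ys = s"
  shows "Poly_Mapping.lookup (phase_expo Up k n (map g [0..<s]) ys) (k + (n - 1 - j), Suc (g r0 + j), True) =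
    (if r0 < s \<and> g r0 + j < ys ! r0 then 1 else 0)"
proof -
  have "{r. r < length (map g [0..<s]) \<and> (let x = pos Up (ys ! r) (map g [0..<s] ! r) j;
      z = pos Up (ys ! r) (map g [0..<s] ! r) (Suc j)
      in if True then z \<noteq> x \<and> Suc (g r0 + j) = max x z else z = x \<and> Suc (g r0 + j) = x)}
    = {r. r < s \<and> (r = r0 \<and> g r + j < ys ! r)}" (is "?A = ?B")
  proof (intro equalityI subsetI)
    fix r assume "r \<in> ?A"
    then have r: "r < s" "min (Suc (g r + j)) (ys ! r) \<noteq> min (g r + j) (ys ! r)"
      "Suc (g r0 + j) = max (min (g r + j) (ys ! r)) (min (Suc (g r + j)) (ys ! r))"
      by (auto simp: Let_def)
    have lt: "g r + j < ys ! r" using r(2) by (cases "g r + j < ys ! r") simp_all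
    then have "g r = g r0" using r(3) by simp
    then have "r = r0" using inj by (simp add: inj_eq)
    then show "r \<in> ?B" using r(1) lt by simp
  next
    fix r assume "r \<in> ?B"
    then have "r < s" "r = r0" "Suc (g r0 + j) \<le> ys ! r0" by auto
    then show "r \<in> ?A" by (simp add: Let_def min_absorb1)
  qed
  moreover have "card ?B = (if r0 < s \<and> r0 = r0 \<and> g r0 + j < ys ! r0 then 1 else 0)"
    by (rule card_at_most_one) simp
  ultimately show ?thesis by (simp only: lookup_phase_expo[OF assms(1)] refl simp_thms)
qed

lemma strict_mono_ge: "(\<And>r. Suc r < s \<Longrightarrow> a r < a (Suc r)) \<Longrightarrow> r < s \<Longrightarrow> r \<le> (a r :: nat)"
proof (induction r)
  case (Suc r)
  then have "r \<le> a r" "a r < a (Suc r)" by auto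
  then show ?case by simp
qed simp

lemma valid_index_upper:
  assumes "valid_index n xs" "r < length xs"
  shows "xs ! r + (length xs - Suc r) \<le> n"
  using assms(2)
proof (induction "length xs - Suc r" arbitrary: r)
  case 0
  then show ?case using valid_index_range[OF assms(1), of r] by simp
next
  case (Suc d)
  then have r: "Suc r < length xs" by simp
  have "xs ! Suc r + (length xs - Suc (Suc r)) \<le> n" using Suc r by (intro Suc.hyps) auto
  moreover have "xs ! r < xs ! Suc r" using valid_index_less[OF assms(1), of r "Suc r"] r by simp
  ultimately show ?case using r by simp
qed

lemma valid_index_map:
  assumes "strict_mono f" "1 \<le> f 0" "\<And>r. r < s \<Longrightarrow> f r \<le> n"
  shows "valid_index n (map f [0..<s])"
proof (rule valid_indexI)
  show "map f [0..<s] ! r < map f [0..<s] ! Suc r" if "Suc r < length (map f [0..<s])" for r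
    using that strict_monoD[OF assms(1), of r "Suc r"] by simp
  show "1 \<le> map f [0..<s] ! r \<and> map f [0..<s] ! r \<le> n" if "r < length (map f [0..<s])" for r
    using that assms(3)[of r] assms(2) strict_mono_mono[OF assms(1)]
    by (simp add: mono_def) (meson le_trans zero_le)
qed

section \<open>The two networks\<close>

text \<open>Path \<open>r\<close> descends from its row index to \<open>f r\<close>, jumps to
  \<open>g r\<close> and climbs to its column index. Paths keep their order, so path
  \<open>r\<close> of any family jumps through a slot of index at least \<open>r\<close>; this is
  the source of the vanishing minors.\<close>

definition net_same :: "nat \<Rightarrow> (nat \<Rightarrow> nat) \<Rightarrow> (nat \<Rightarrow> nat) \<Rightarrow> stage list" where
  "net_same n f g = replicate n Down @ Rel {(f r, g r) | r. True} # replicate n Up"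

text \<open>Now the bound on the columns is counted from the top: in a family of \<open>s\<close>
  paths, path \<open>r\<close> should leave through slot \<open>s - Suc r\<close> of
  \<open>g\<close>. A relation cannot depend on \<open>s\<close>; the middle climb from the
  \<open>s\<close> lowest to the \<open>s\<close> highest positions converts the count from below
  into one from above.\<close>

definition net_opposite :: "nat \<Rightarrow> (nat \<Rightarrow> nat) \<Rightarrow> (nat \<Rightarrow> nat) \<Rightarrow> stage list" where
  "net_opposite n f g = replicate n Down @ Rel {(f r, Suc r) | r. r < n} #
     (replicate n Up @ Rel {(n - r, Suc n - g r) | r. r < n \<and> g r \<le> n} # replicate n Down)"

definition reflect_index :: "nat \<Rightarrow> nat list \<Rightarrow> nat list" where
  "reflect_index n ys = rev (map (\<lambda>y. Suc n - y) ys)"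

lemma reflect_nth: "r < length ys \<Longrightarrow> reflect_index n ys ! r = Suc n - ys ! (length ys - Suc r)"
  by (simp add: reflect_index_def rev_nth)

context
  fixes n :: nat and q :: "'k::field" and f g :: "nat \<Rightarrow> nat"
  assumes q: "q \<noteq> 0" and f: "strict_mono f" "1 \<le> f 0" and g: "strict_mono g" "1 \<le> g 0"
begin

lemma increasing_same: "increasing_rel {(f r, g r) | r. True}"
  using f(1) g(1) by (auto simp: increasing_rel_def strict_mono_less)

lemma increasing_opposite_1: "increasing_rel {(f r, Suc r) | r. r < n}"
  using f(1) by (auto simp: increasing_rel_def strict_mono_less)

lemma increasing_opposite_2: "increasing_rel {(n - r, Suc n - g r) | r. r < n \<and> g r \<le> n}"
proof -
  have "n - r < n - r' \<longleftrightarrow> Suc n - g r < Suc n - g r'" if "r < n" "g r \<le> n" "r' < n" "g r' \<le> n" for r r'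
  proof -
    have "r' < r \<longleftrightarrow> g r' < g r" using g(1) by (simp add: strict_mono_less)
    then show ?thesis using that by linarith
  qed
  then show ?thesis by (auto simp: increasing_rel_def)
qed

lemma rel_same: "Rel S \<in> set (net_same n f g) \<Longrightarrow> increasing_rel S"
  using increasing_same by (auto simp: net_same_def)

lemma rel_opposite: "Rel S \<in> set (net_opposite n f g) \<Longrightarrow> increasing_rel S"
  using increasing_opposite_1 increasing_opposite_2 by (auto simp: net_opposite_def)

lemma final_up:
  assumes ys: "valid_index n ys" and zs: "valid_index n zs" "length zs = length ys"
  shows "net_minor n q (replicate n Up) zs ys \<noteq> 0 \<Longrightarrow> r < length ys \<Longrightarrow> zs ! r \<le> ys ! r"
    and "(\<And>r. r < length ys \<Longrightarrow> zs ! r \<le> ys ! r) \<Longrightarrow>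
      has_lead (net_weight n) (net_minor n q (replicate n Up) zs ys) (phase_expo Up 0 n zs ys)"
proof -
  assume "net_minor n q (replicate n Up) zs ys \<noteq> 0" "r < length ys"
  then show "zs ! r \<le> ys ! r"
    using phase_nonzero[OF q _ _ ys zs, of Up "[]" n] net_minor_Nil_nonzero[OF _ ys] by auto
next
  assume le: "\<And>r. r < length ys \<Longrightarrow> zs ! r \<le> ys ! r"
  have one: "has_lead (net_weight n) (net_minor n q [] ys ys) 0"
    using has_lead_scal_tw[of 1 "net_weight n" q 0] by (simp add: net_minor_Nil_self[OF ys])
  have "has_lead (net_weight n) (net_minor n q (replicate n Up @ []) zs ys) (phase_expo Up (length ([]::stage list)) n zs ys + 0)"
  proof (rule phase_lead[OF q _ _ ys one ys refl _ zs])
    show "ahead Up (zs ! r) (ys ! r) \<and> pos Up (ys ! r) (zs ! r) n = ys ! r" if "r < length ys" for r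
      using le[OF that] valid_index_range[OF ys that] by simp
  qed (use net_minor_Nil_nonzero[OF _ ys] in auto)
  then show "has_lead (net_weight n) (net_minor n q (replicate n Up) zs ys) (phase_expo Up 0 n zs ys)"
    by simp
qed

lemma final_down:
  assumes ys: "valid_index n ys" and zs: "valid_index n zs" "length zs = length ys"
  shows "net_minor n q (replicate n Down) zs ys \<noteq> 0 \<Longrightarrow> r < length ys \<Longrightarrow> ys ! r \<le> zs ! r"
    and "(\<And>r. r < length ys \<Longrightarrow> ys ! r \<le> zs ! r) \<Longrightarrow>
      has_lead (net_weight n) (net_minor n q (replicate n Down) zs ys) (phase_expo Down 0 n zs ys)"
proof -
  assume "net_minor n q (replicate n Down) zs ys \<noteq> 0" "r < length ys"
  then show "ys ! r \<le> zs ! r"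
    using phase_nonzero[OF q _ _ ys zs, of Down "[]" n] net_minor_Nil_nonzero[OF _ ys] by auto
next
  assume le: "\<And>r. r < length ys \<Longrightarrow> ys ! r \<le> zs ! r"
  have one: "has_lead (net_weight n) (net_minor n q [] ys ys) 0"
    using has_lead_scal_tw[of 1 "net_weight n" q 0] by (simp add: net_minor_Nil_self[OF ys])
  have "has_lead (net_weight n) (net_minor n q (replicate n Down @ []) zs ys) (phase_expo Down (length ([]::stage list)) n zs ys + 0)"
  proof (rule phase_lead[OF q _ _ ys one ys refl _ zs])
    show "ahead Down (zs ! r) (ys ! r) \<and> pos Down (ys ! r) (zs ! r) n = ys ! r" if "r < length ys" for r
      using le[OF that] valid_index_range[OF zs(1), of r] that zs(2) by simp
  qed (use net_minor_Nil_nonzero[OF _ ys] in auto)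
  then show "has_lead (net_weight n) (net_minor n q (replicate n Down) zs ys) (phase_expo Down 0 n zs ys)"
    by simp
qed

text \<open>The slots \<open>a r\<close> increase strictly, so the one with index \<open>r\<close>
  is at least \<open>r\<close>.\<close>

lemma strict_index_choice:
  assumes "strict_mono h" and "\<And>r. Suc r < s \<Longrightarrow> h (a r) < h (a (Suc r))" and "r < s"
  shows "h r \<le> h (a r)"
proof -
  have "a r < a (Suc r)" if "Suc r < s" for r using assms(2)[OF that] assms(1) by (simp add: strict_mono_less)
  then have "r \<le> a r" using assms(3) by (rule strict_mono_ge)
  then show ?thesis using assms(1) by (simp add: strict_mono_less_eq)
qed

lemma net_same_zero:
  assumes xs: "valid_index n xs" and ys: "valid_index n ys" and len: "length xs = length ys"
    and nz: "net_minor n q (net_same n f g) xs ys \<noteq> 0" and r: "r < length ys"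
  shows "f r \<le> xs ! r" "g r \<le> ys ! r"
proof -
  let ?S = "{(f r, g r) | r. True}" and ?s = "length ys"
  obtain us where us: "valid_index n us" "length us = ?s"
    "net_minor n q (Rel ?S # replicate n Up) us ys \<noteq> 0" "\<forall>r<?s. us ! r \<le> xs ! r"
    using phase_nonzero[OF q _ _ ys xs len, of Down "Rel ?S # replicate n Up" n] nz increasing_same
    by (auto simp: net_same_def)
  obtain zs where zs: "valid_index n zs" "length zs = ?s"
    "\<And>r. r < ?s \<Longrightarrow> (us ! r, zs ! r) \<in> ?S" "net_minor n q (replicate n Up) zs ys \<noteq> 0"
    using net_minor_Rel_nonzero[OF increasing_same us(3,1,2)] by blast
  have "\<forall>r. \<exists>a. r < ?s \<longrightarrow> us ! r = f a \<and> zs ! r = g a" using zs(3) by blast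
  then obtain a where a: "\<And>r. r < ?s \<Longrightarrow> us ! r = f (a r) \<and> zs ! r = g (a r)" by metis
  have "f r \<le> f (a r)"
  proof (rule strict_index_choice[OF f(1) _ r])
    show "f (a r) < f (a (Suc r))" if "Suc r < ?s" for r
      using valid_index_less[OF us(1), of r "Suc r"] a[of r] a[of "Suc r"] that us(2) by simp
  qed
  then show "f r \<le> xs ! r" using us(4) a r by fastforce
  have "g r \<le> g (a r)"
  proof (rule strict_index_choice[OF g(1) _ r])
    show "g (a r) < g (a (Suc r))" if "Suc r < ?s" for r
      using valid_index_less[OF zs(1), of r "Suc r"] a[of r] a[of "Suc r"] that zs(2) by simp
  qed
  then show "g r \<le> ys ! r" using final_up(1)[OF ys zs(1,2,4) r] a[OF r] by simp
qed

text \<open>\<open>Suc n\<close> stages follow the first descent: the relation and the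
  \<open>n\<close> climbing stages.\<close>

definition same_expo :: "nat list \<Rightarrow> nat list \<Rightarrow> expo" where
  "same_expo xs ys = phase_expo Down (Suc n) n xs (map f [0..<length ys])
     + phase_expo Up 0 n (map g [0..<length ys]) ys"

lemma net_same_lead:
  assumes xs: "valid_index n xs" and ys: "valid_index n ys" and len: "length xs = length ys"
    and fx: "\<And>r. r < length ys \<Longrightarrow> f r \<le> xs ! r" and gy: "\<And>r. r < length ys \<Longrightarrow> g r \<le> ys ! r"
  shows "has_lead (net_weight n) (net_minor n q (net_same n f g) xs ys) (same_expo xs ys)"
proof -
  let ?S = "{(f r, g r) | r. True}" and ?s = "length ys"
  let ?fs = "map f [0..<?s]" and ?gs = "map g [0..<?s]"
  have fs: "valid_index n ?fs"
    using fx valid_index_range[OF xs] len by (intro valid_index_map[OF f]) (metis le_trans)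
  have gs: "valid_index n ?gs"
    using gy valid_index_range[OF ys] by (intro valid_index_map[OF g]) (metis le_trans)
  have "net_minor n q (Rel ?S # replicate n Up) ?fs ys = net_minor n q (replicate n Up) ?gs ys"
    using gs by (intro net_minor_Rel[OF increasing_same]) (auto simp: valid_index_def)
  moreover have "has_lead (net_weight n) (net_minor n q (replicate n Up) ?gs ys) (phase_expo Up 0 n ?gs ys)"
    using gs gy by (intro final_up(2)[OF ys]) auto
  ultimately have lead: "has_lead (net_weight n) (net_minor n q (Rel ?S # replicate n Up) ?fs ys) (phase_expo Up 0 n ?gs ys)"
    by simp
  have "has_lead (net_weight n) (net_minor n q (replicate n Down @ Rel ?S # replicate n Up) xs ys)
    (phase_expo Down (length (Rel ?S # replicate n Up)) n xs ?fs + phase_expo Up 0 n ?gs ys)"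
  proof (rule phase_lead[OF q _ _ ys lead fs _ _ xs len])
    \<comment> \<open>Since slots are used in increasing order, \<open>?fs\<close> is the lowest
      list from which the rest of the network can be entered.\<close>
    fix zs r assume zs: "valid_index n zs" "length zs = ?s" and r: "r < ?s"
      and nz: "net_minor n q (Rel ?S # replicate n Up) zs ys \<noteq> 0"
    obtain ws where ws: "\<And>r. r < ?s \<Longrightarrow> (zs ! r, ws ! r) \<in> ?S"
      using net_minor_Rel_nonzero[OF increasing_same nz zs] by blast
    then have "\<forall>r. \<exists>a. r < ?s \<longrightarrow> zs ! r = f a" by blast
    then obtain a where a: "\<And>r. r < ?s \<Longrightarrow> zs ! r = f (a r)" by metis
    have "f r \<le> f (a r)"
    proof (rule strict_index_choice[OF f(1) _ r])
      show "f (a r) < f (a (Suc r))" if "Suc r < ?s" for r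
        using valid_index_less[OF zs(1), of r "Suc r"] a[of r] a[of "Suc r"] that zs(2) by simp
    qed
    then show "ahead Down (zs ! r) (?fs ! r)" using a r by simp
  next
    show "ahead Down (xs ! r) (?fs ! r) \<and> pos Down (?fs ! r) (xs ! r) n = ?fs ! r" if "r < ?s" for r
      using fx[OF that] valid_index_range[OF xs, of r] that len by simp
  qed (use increasing_same in auto)
  then show ?thesis by (simp add: same_expo_def net_same_def)
qed

lemma lookup_same_expo:
  assumes "j < n" "length xs = length ys"
  shows "Poly_Mapping.lookup (same_expo xs ys) (Suc n + (n - 1 - j), f r, False) =
      (if r < length ys \<and> xs ! r \<le> f r + j then 1 else 0)"
    and "Poly_Mapping.lookup (same_expo xs ys) (n - 1 - j, Suc (g r + j), True) =
      (if r < length ys \<and> g r + j < ys ! r then 1 else 0)"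
proof -
  have inj: "inj f" "inj g" using f g by (auto intro: strict_mono_imp_inj_on)
  show "Poly_Mapping.lookup (same_expo xs ys) (Suc n + (n - 1 - j), f r, False) =
      (if r < length ys \<and> xs ! r \<le> f r + j then 1 else 0)"
    unfolding same_expo_def lookup_add lookup_down_stay[OF assms(1) inj(1) assms(2)]
    by (simp add: lookup_phase_expo_other)
  show "Poly_Mapping.lookup (same_expo xs ys) (n - 1 - j, Suc (g r + j), True) =
      (if r < length ys \<and> g r + j < ys ! r then 1 else 0)"
    using lookup_up_move[OF assms(1) inj(2) refl, where ys = ys and k = 0 and ?r0.0 = r]
      lookup_phase_expo_other[OF disjI1[of "n - Suc j < Suc n"]] assms(1)
    unfolding same_expo_def lookup_add by simp
qed

lemma opposite_choice:
  assumes ws: "valid_index n ws" and wa: "\<And>r. r < length ws \<Longrightarrow> ws ! r = n - a r \<and> a r < n"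
    and r: "r < length ws"
  shows "r \<le> a (length ws - Suc r)"
proof (rule strict_mono_ge[of "length ws" "\<lambda>r. a (length ws - Suc r)", OF _ r])
  fix r assume "Suc r < length ws"
  then have "ws ! (length ws - Suc (Suc r)) < ws ! (length ws - Suc r)"
    by (intro valid_index_less[OF ws]) auto
  then show "a (length ws - Suc r) < a (length ws - Suc (Suc r))"
    using wa[of "length ws - Suc r"] wa[of "length ws - Suc (Suc r)"] \<open>Suc r < length ws\<close> by simp
qed

lemma net_opposite_zero:
  assumes xs: "valid_index n xs" and ys: "valid_index n ys" and len: "length xs = length ys"
    and nz: "net_minor n q (net_opposite n f g) xs ys \<noteq> 0" and r: "r < length ys"
  shows "f r \<le> xs ! r" "g r \<le> reflect_index n ys ! r"
proof -
  let ?S = "{(f r, Suc r) | r. r < n}" and ?S' = "{(n - r, Suc n - g r) | r. r < n \<and> g r \<le> n}"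
  let ?s = "length ys" and ?R2 = "Rel ?S' # replicate n Down"
  let ?R1 = "Rel ?S # replicate n Up @ ?R2"
  obtain us where us: "valid_index n us" "length us = ?s"
    "net_minor n q ?R1 us ys \<noteq> 0" "\<forall>r<?s. us ! r \<le> xs ! r"
    using phase_nonzero[OF q _ _ ys xs len, of Down ?R1 n] nz increasing_opposite_1 increasing_opposite_2
    by (auto simp: net_opposite_def)
  obtain vs where vs: "valid_index n vs" "length vs = ?s"
    "\<And>r. r < ?s \<Longrightarrow> (us ! r, vs ! r) \<in> ?S" "net_minor n q (replicate n Up @ ?R2) vs ys \<noteq> 0"
    using net_minor_Rel_nonzero[OF increasing_opposite_1 us(3,1,2)] by blast
  obtain ws where ws: "valid_index n ws" "length ws = ?s" "net_minor n q ?R2 ws ys \<noteq> 0"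
    using phase_nonzero[OF q _ _ ys vs(1,2), of Up ?R2 n] vs(4) increasing_opposite_2 by auto
  obtain zs where zs: "valid_index n zs" "length zs = ?s"
    "\<And>r. r < ?s \<Longrightarrow> (ws ! r, zs ! r) \<in> ?S'" "net_minor n q (replicate n Down) zs ys \<noteq> 0"
    using net_minor_Rel_nonzero[OF increasing_opposite_2 ws(3,1,2)] by blast
  have "\<forall>r. \<exists>a. r < ?s \<longrightarrow> us ! r = f a" using vs(3) by blast
  then obtain a where a: "\<And>r. r < ?s \<Longrightarrow> us ! r = f (a r)" by metis
  have "f r \<le> f (a r)"
  proof (rule strict_index_choice[OF f(1) _ r])
    show "f (a r) < f (a (Suc r))" if "Suc r < ?s" for r
      using valid_index_less[OF us(1), of r "Suc r"] a[of r] a[of "Suc r"] that us(2) by simp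
  qed
  then show "f r \<le> xs ! r" using us(4) a r by fastforce
  have "\<forall>r. \<exists>b. r < ?s \<longrightarrow> ws ! r = n - b \<and> zs ! r = Suc n - g b \<and> b < n \<and> g b \<le> n" using zs(3) by blast
  then obtain b where b: "\<And>r. r < ?s \<Longrightarrow> ws ! r = n - b r \<and> zs ! r = Suc n - g (b r) \<and> b r < n \<and> g (b r) \<le> n"
    by metis
  let ?r = "?s - Suc r"
  have "r \<le> b ?r" using opposite_choice[OF ws(1), of b r] b ws(2) r by simp
  then have "g r \<le> g (b ?r)" using g(1) by (simp add: strict_mono_less_eq)
  moreover have "ys ! ?r \<le> zs ! ?r" using final_down(1)[OF ys zs(1,2,4), of ?r] r by simp
  moreover have "zs ! ?r = Suc n - g (b ?r)" "g (b ?r) \<le> n" using b[of ?r] r by auto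
  ultimately have "g r \<le> Suc n - ys ! ?r" by linarith
  then show "g r \<le> reflect_index n ys ! r" using r by (simp add: reflect_nth)
qed

text \<open>The offsets \<open>2 * n + 2\<close>, \<open>n + 1\<close> and 0 are the numbers of
  stages behind the three phases.\<close>

definition opposite_expo :: "nat list \<Rightarrow> nat list \<Rightarrow> expo" where
  "opposite_expo xs ys = (let s = length ys in
     phase_expo Down (2 * n + 2) n xs (map f [0..<s])
     + (phase_expo Up (n + 1) n (map Suc [0..<s]) (map (\<lambda>r. Suc n - s + r) [0..<s])
     + phase_expo Down 0 n (map (\<lambda>r. Suc n - g (s - Suc r)) [0..<s]) ys))"

lemma net_opposite_lead:
  assumes xs: "valid_index n xs" and ys: "valid_index n ys" and len: "length xs = length ys"
    and fx: "\<And>r. r < length ys \<Longrightarrow> f r \<le> xs ! r"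
    and gy: "\<And>r. r < length ys \<Longrightarrow> g r \<le> reflect_index n ys ! r"
  shows "has_lead (net_weight n) (net_minor n q (net_opposite n f g) xs ys) (opposite_expo xs ys)"
proof -
  let ?S = "{(f r, Suc r) | r. r < n}" and ?S' = "{(n - r, Suc n - g r) | r. r < n \<and> g r \<le> n}"
  let ?s = "length ys" and ?R2 = "Rel ?S' # replicate n Down"
  let ?R1 = "Rel ?S # replicate n Up @ ?R2"
  let ?fs = "map f [0..<?s]" and ?us = "map Suc [0..<?s]" and ?ts = "map (\<lambda>r. Suc n - ?s + r) [0..<?s]"
    and ?cs = "map (\<lambda>r. Suc n - g (?s - Suc r)) [0..<?s]"
  have sn: "?s \<le> n" using valid_index_length[OF ys] .
  have gn: "ys ! r \<le> Suc n - g (?s - Suc r) \<and> g (?s - Suc r) \<le> n" if "r < ?s" for r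
  proof -
    have "g (?s - Suc r) \<le> Suc n - ys ! r" using gy[of "?s - Suc r"] that by (simp add: reflect_nth)
    then show ?thesis using valid_index_range[OF ys that] by linarith
  qed
  have fs: "valid_index n ?fs"
    using fx valid_index_range[OF xs] len by (intro valid_index_map[OF f]) (metis le_trans)
  have us: "valid_index n ?us" using sn by (intro valid_indexI) auto
  have ts: "valid_index n ?ts" using sn by (intro valid_indexI) auto
  have cs: "valid_index n ?cs"
  proof (rule valid_indexI)
    fix r assume "Suc r < length ?cs"
    then have r: "Suc r < ?s" by simp
    then have "g (?s - Suc (Suc r)) < g (?s - Suc r)" using g(1) by (simp add: strict_mono_less)
    moreover have "g (?s - Suc r) \<le> n" using gn[of r] r by simp
    ultimately show "?cs ! r < ?cs ! Suc r" using r by simp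
  next
    fix r assume "r < length ?cs"
    then have r: "r < ?s" by simp
    have "g 0 \<le> g (?s - Suc r)" using g(1) by (simp add: strict_mono_less_eq)
    then have "1 \<le> Suc n - g (?s - Suc r) \<and> Suc n - g (?s - Suc r) \<le> n" using gn[OF r] g(2) by linarith
    then show "1 \<le> ?cs ! r \<and> ?cs ! r \<le> n" using r by simp
  qed
  have "net_minor n q ?R2 ?ts ys = net_minor n q (replicate n Down) ?cs ys"
  proof (rule net_minor_Rel[OF increasing_opposite_2])
    fix r assume r: "r < ?s"
    have "(n - (?s - Suc r), Suc n - g (?s - Suc r)) \<in> ?S'"
      using gn[OF r] r sn by (intro CollectI exI[of _ "?s - Suc r"]) auto
    moreover have "n - (?s - Suc r) = Suc n - ?s + r" using r sn by simp
    ultimately show "(?ts ! r, ?cs ! r) \<in> ?S'" using r by simp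
  qed (use cs in \<open>auto simp: valid_index_def\<close>)
  moreover have "has_lead (net_weight n) (net_minor n q (replicate n Down) ?cs ys) (phase_expo Down 0 n ?cs ys)"
    using cs gn by (intro final_down(2)[OF ys]) auto
  ultimately have lead2: "has_lead (net_weight n) (net_minor n q ?R2 ?ts ys) (phase_expo Down 0 n ?cs ys)"
    by simp
  have lead2': "has_lead (net_weight n) (net_minor n q (replicate n Up @ ?R2) ?us ys)
    (phase_expo Up (length ?R2) n ?us ?ts + phase_expo Down 0 n ?cs ys)"
  proof (rule phase_lead[OF q _ _ ys lead2 ts _ _ us])
    fix zs r assume zs: "valid_index n zs" "length zs = ?s" and r: "r < ?s"
    \<comment> \<open>The \<open>s\<close> topmost positions dominate every strictly increasing list
      of length \<open>s\<close>.\<close>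
    show "ahead Up (zs ! r) (?ts ! r)" using valid_index_upper[OF zs(1), of r] zs(2) r sn by simp
  next
    show "ahead Up (?us ! r) (?ts ! r) \<and> pos Up (?ts ! r) (?us ! r) n = ?ts ! r" if "r < ?s" for r
      using that sn by simp
  qed (use increasing_opposite_2 in auto)
  moreover have "net_minor n q ?R1 ?fs ys = net_minor n q (replicate n Up @ ?R2) ?us ys"
    using us sn by (intro net_minor_Rel[OF increasing_opposite_1]) (auto simp: valid_index_def)
  ultimately have lead: "has_lead (net_weight n) (net_minor n q ?R1 ?fs ys)
    (phase_expo Up (length ?R2) n ?us ?ts + phase_expo Down 0 n ?cs ys)" by simp
  have "has_lead (net_weight n) (net_minor n q (replicate n Down @ ?R1) xs ys)
    (phase_expo Down (length ?R1) n xs ?fs + (phase_expo Up (length ?R2) n ?us ?ts + phase_expo Down 0 n ?cs ys))"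
  proof (rule phase_lead[OF q _ _ ys lead fs _ _ xs len])
    fix zs r assume zs: "valid_index n zs" "length zs = ?s" and r: "r < ?s"
      and nz: "net_minor n q ?R1 zs ys \<noteq> 0"
    obtain ws where ws: "\<And>r. r < ?s \<Longrightarrow> (zs ! r, ws ! r) \<in> ?S"
      using net_minor_Rel_nonzero[OF increasing_opposite_1 nz zs] by blast
    then have "\<forall>r. \<exists>a. r < ?s \<longrightarrow> zs ! r = f a" by blast
    then obtain a where a: "\<And>r. r < ?s \<Longrightarrow> zs ! r = f (a r)" by metis
    have "f r \<le> f (a r)"
    proof (rule strict_index_choice[OF f(1) _ r])
      show "f (a r) < f (a (Suc r))" if "Suc r < ?s" for r
        using valid_index_less[OF zs(1), of r "Suc r"] a[of r] a[of "Suc r"] that zs(2) by simp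
    qed
    then show "ahead Down (zs ! r) (?fs ! r)" using a r by simp
  next
    show "ahead Down (xs ! r) (?fs ! r) \<and> pos Down (?fs ! r) (xs ! r) n = ?fs ! r" if "r < ?s" for r
      using fx[OF that] valid_index_range[OF xs, of r] that len by simp
  qed (use increasing_opposite_1 increasing_opposite_2 in auto)
  moreover have "length ?R1 = 2 * n + 2" "length ?R2 = n + 1" by simp_all
  ultimately show ?thesis by (simp only: opposite_expo_def net_opposite_def Let_def)
qed

lemma lookup_opposite_expo:
  assumes j: "j < n" and len: "length xs = length ys" and ys: "valid_index n ys"
  shows "Poly_Mapping.lookup (opposite_expo xs ys) (2 * n + 2 + (n - 1 - j), f r, False) =
      (if r < length ys \<and> xs ! r \<le> f r + j then 1 else 0)"
    and "Poly_Mapping.lookup (opposite_expo xs ys) (n - 1 - j, Suc n - g r - j, True) =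
      (if r < length ys \<and> g r + j < reflect_index n ys ! r then 1 else 0)"
proof -
  have inj: "inj f" "inj g" using f g by (auto intro: strict_mono_imp_inj_on)
  show "Poly_Mapping.lookup (opposite_expo xs ys) (2 * n + 2 + (n - 1 - j), f r, False) =
      (if r < length ys \<and> xs ! r \<le> f r + j then 1 else 0)"
    unfolding opposite_expo_def Let_def lookup_add lookup_down_stay[OF j inj(1) len]
    by (simp add: lookup_phase_expo_other)
  let ?s = "length ys" and ?cs = "map (\<lambda>r. Suc n - g (length ys - Suc r)) [0..<length ys]"
  have "{r'. r' < length ?cs \<and> (let x = pos Down (ys ! r') (?cs ! r') j; z = pos Down (ys ! r') (?cs ! r') (Suc j)
      in if True then z \<noteq> x \<and> Suc n - g r - j = max x z else z = x \<and> Suc n - g r - j = x)}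
    = {r'. r' < ?s \<and> (r' = ?s - Suc r \<and> r < ?s \<and> g r + j < Suc n - ys ! (?s - Suc r))}" (is "?A = ?B")
  proof (intro equalityI subsetI)
    fix r' assume "r' \<in> ?A"
    then have r': "r' < ?s" "max (Suc n - g (?s - Suc r') - Suc j) (ys ! r') \<noteq> max (Suc n - g (?s - Suc r') - j) (ys ! r')"
      "Suc n - g r - j = max (max (Suc n - g (?s - Suc r') - j) (ys ! r')) (max (Suc n - g (?s - Suc r') - Suc j) (ys ! r'))"
      by (auto simp: Let_def)
    have lt: "ys ! r' < Suc n - g (?s - Suc r') - j"
      using r'(2) by (cases "ys ! r' < Suc n - g (?s - Suc r') - j") (simp_all add: max_absorb2)
    then have "Suc n - g r - j = Suc n - g (?s - Suc r') - j" using r'(3) by simp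
    \<comment> \<open>By \<open>lt\<close> the common value is positive, so none of these
      subtractions is truncated.\<close>
    then have "g r = g (?s - Suc r')" using lt by simp
    then have r: "r = ?s - Suc r'" using inj by (simp add: inj_eq)
    then have "?s - Suc r = r'" "r < ?s" using r'(1) by auto
    moreover have "g r + j < Suc n - ys ! r'" using lt unfolding r by linarith
    ultimately show "r' \<in> ?B" using r'(1) by simp
  next
    fix r' assume "r' \<in> ?B"
    then have r: "r' = ?s - Suc r" "r < ?s" "g r + j < Suc n - ys ! (?s - Suc r)" by auto
    then have "?s - Suc r' = r" "r' < ?s" by auto
    moreover have "ys ! (?s - Suc r) < Suc n - g r - j" "ys ! (?s - Suc r) \<le> Suc n - g r - Suc j"
      "Suc n - g r - Suc j < Suc n - g r - j"
      using r by auto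
    ultimately show "r' \<in> ?A" using r(1) by (simp add: Let_def max_absorb1)
  qed
  moreover have "card ?B = (if ?s - Suc r < ?s \<and> ?s - Suc r = ?s - Suc r \<and> r < ?s \<and> g r + j < Suc n - ys ! (?s - Suc r) then 1 else 0)"
    by (rule card_at_most_one) simp
  ultimately have "Poly_Mapping.lookup (phase_expo Down 0 n ?cs ys) (0 + (n - 1 - j), Suc n - g r - j, True)
    = (if ?s - Suc r < ?s \<and> r < ?s \<and> g r + j < Suc n - ys ! (?s - Suc r) then 1 else 0)"
    by (simp only: lookup_phase_expo[OF j] refl simp_thms)
  moreover have "Poly_Mapping.lookup (phase_expo st k n xs' cs') (n - Suc j, i, b) = 0"
    if "n \<le> k" for st k xs' cs' i b
    by (rule lookup_phase_expo_other) (use that j in auto)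
  ultimately have "Poly_Mapping.lookup (opposite_expo xs ys) (n - 1 - j, Suc n - g r - j, True) =
      (if ?s - Suc r < ?s \<and> r < ?s \<and> g r + j < Suc n - ys ! (?s - Suc r) then 1 else 0)"
    by (simp add: opposite_expo_def Let_def lookup_add)
  then show "Poly_Mapping.lookup (opposite_expo xs ys) (n - 1 - j, Suc n - g r - j, True) =
      (if r < length ys \<and> g r + j < reflect_index n ys ! r then 1 else 0)"
    by (cases "r < ?s") (simp_all add: reflect_nth)
qed

end

section \<open>Growth diagrams\<close>

text \<open>The skew shape \<open>\<mu> / \<rho>\<close> is a horizontal strip, rows being counted
  from 0.\<close>

definition strip :: "(nat \<Rightarrow> nat) \<Rightarrow> (nat \<Rightarrow> nat) \<Rightarrow> bool" where
  "strip \<rho> \<mu> \<longleftrightarrow> (\<forall>r. \<rho> r \<le> \<mu> r \<and> \<mu> (Suc r) \<le> \<rho> r)"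

type_synonym local_rule = "(nat \<Rightarrow> nat) \<Rightarrow> (nat \<Rightarrow> nat) \<Rightarrow> (nat \<Rightarrow> nat) \<Rightarrow> nat \<Rightarrow> nat \<Rightarrow> nat"

text \<open>A growth diagram in the sense of Fomin: the points of the grid carry shapes, empty on
  the axes, and the cells carry the entries \<open>N\<close>.\<close>

fun growth :: "local_rule \<Rightarrow> (nat \<Rightarrow> nat \<Rightarrow> nat) \<Rightarrow> nat \<Rightarrow> nat \<Rightarrow> nat \<Rightarrow> nat" where
  "growth loc N 0 j = (\<lambda>r. 0)"
| "growth loc N (Suc i) 0 = (\<lambda>r. 0)"
| "growth loc N (Suc i) (Suc j) =
     loc (growth loc N i j) (growth loc N (Suc i) j) (growth loc N i (Suc j)) (N (Suc i) (Suc j))"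

lemma growth_0 [simp]: "growth loc N i 0 = (\<lambda>r. 0)" by (cases i) auto

text \<open>Emptiness of the last row of \<mu> and \<nu> ensures that the fourth shape of the cell
  still fits into \<open>n\<close> rows.\<close>

definition corner :: "nat \<Rightarrow> (nat \<Rightarrow> nat) \<Rightarrow> (nat \<Rightarrow> nat) \<Rightarrow> (nat \<Rightarrow> nat) \<Rightarrow> bool" where
  "corner n \<rho> \<mu> \<nu> \<longleftrightarrow> strip \<rho> \<mu> \<and> strip \<rho> \<nu> \<and> \<mu> (n - 1) = 0 \<and> \<nu> (n - 1) = 0"

text \<open>\<open>loc_inj\<close> lets the boundary shapes determine all entries, and
  \<open>loc_size\<close> makes the size of the final shape the sum of the entries; injectivity of
  the correspondence and preservation of degree rest on these.\<close>

locale growth_rule =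
  fixes n :: nat and loc :: local_rule
  assumes n_pos: "n > 0"
    and loc_strip: "corner n \<rho> \<mu> \<nu> \<Longrightarrow> strip \<mu> (loc \<rho> \<mu> \<nu> m) \<and> strip \<nu> (loc \<rho> \<mu> \<nu> m)"
    and loc_inj: "corner n \<rho> \<mu> \<nu> \<Longrightarrow> corner n \<rho>' \<mu> \<nu> \<Longrightarrow> loc \<rho> \<mu> \<nu> m = loc \<rho>' \<mu> \<nu> m' \<Longrightarrow>
      \<rho> = \<rho>' \<and> m = m'"
    and loc_size: "corner n \<rho> \<mu> \<nu> \<Longrightarrow>
      (\<Sum>r<n. loc \<rho> \<mu> \<nu> m r) + (\<Sum>r<n. \<rho> r) = (\<Sum>r<n. \<mu> r) + (\<Sum>r<n. \<nu> r) + m"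
begin

text \<open>Adding a horizontal strip creates at most one new row, so the shape at
  \<open>(i, j)\<close> has at most \<open>min i j\<close> rows. This provides the empty last row
  that \<open>corner\<close> asks for.\<close>

lemma growth_strip_zero:
  "i \<le> n \<Longrightarrow> j \<le> n \<Longrightarrow>
     (\<forall>r. i \<le> r \<or> j \<le> r \<longrightarrow> growth loc N i j r = 0) \<and>
     (i > 0 \<longrightarrow> strip (growth loc N (i - 1) j) (growth loc N i j)) \<and>
     (j > 0 \<longrightarrow> strip (growth loc N i (j - 1)) (growth loc N i j))"
proof (induction "i + j" arbitrary: i j rule: less_induct)
  case less
  show ?case
  proof (cases "i = 0 \<or> j = 0")
    case True
    then show ?thesis by (cases "i = 0") (auto simp: strip_def)
  next
    case False
    then obtain i' j' where ij: "i = Suc i'" "j = Suc j'" by (metis not0_implies_Suc)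
    let ?\<rho> = "growth loc N i' j'" and ?\<mu> = "growth loc N (Suc i') j'" and ?\<nu> = "growth loc N i' (Suc j')"
    let ?\<kappa> = "growth loc N (Suc i') (Suc j')"
    have "corner n ?\<rho> ?\<mu> ?\<nu>"
      using less.hyps[of "Suc i'" j'] less.hyps[of i' "Suc j'"] less.prems ij by (auto simp: corner_def)
    then have strips: "strip ?\<mu> ?\<kappa>" "strip ?\<nu> ?\<kappa>" using loc_strip by auto
    have "?\<kappa> r = 0" if large: "Suc i' \<le> r \<or> Suc j' \<le> r" for r
    proof -
      obtain r' where r': "r = Suc r'" using large by (cases r) auto
      have "?\<mu> r' = 0 \<or> ?\<nu> r' = 0"
        using less.hyps[of "Suc i'" j'] less.hyps[of i' "Suc j'"] less.prems ij large r' by auto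
      then show ?thesis using strips unfolding strip_def r' by (metis le_zero_eq)
    qed
    then show ?thesis using strips ij by auto
  qed
qed

lemma growth_zero: "i \<le> n \<Longrightarrow> j \<le> n \<Longrightarrow> i \<le> r \<or> j \<le> r \<Longrightarrow> growth loc N i j r = 0"
  using growth_strip_zero[of i j N] by auto

lemma growth_strip_left: "i < n \<Longrightarrow> j \<le> n \<Longrightarrow> strip (growth loc N i j) (growth loc N (Suc i) j)"
  using growth_strip_zero[of "Suc i" j] by simp

lemma growth_strip_right: "i \<le> n \<Longrightarrow> j < n \<Longrightarrow> strip (growth loc N i j) (growth loc N i (Suc j))"
  using growth_strip_zero[of i "Suc j"] by simp

lemma growth_corner:
  "i < n \<Longrightarrow> j < n \<Longrightarrow> corner n (growth loc N i j) (growth loc N (Suc i) j) (growth loc N i (Suc j))"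
proof -
  assume ij: "i < n" "j < n"
  have "growth loc N (Suc i) j (n - 1) = 0" "growth loc N i (Suc j) (n - 1) = 0"
    using ij by (auto intro!: growth_zero)
  then show ?thesis
    using growth_strip_left[of i j N] growth_strip_right[of i j N] ij by (simp add: corner_def)
qed

text \<open>The diagram is filled backwards from its outer boundary: three shapes of a cell
  determine the fourth one and the entry.\<close>

lemma growth_inj:
  assumes rows: "\<And>i. i \<le> n \<Longrightarrow> growth loc N i n = growth loc N' i n"
    and columns: "\<And>j. j \<le> n \<Longrightarrow> growth loc N n j = growth loc N' n j"
    and ij: "i \<in> {1..n}" "j \<in> {1..n}"
  shows "N i j = N' i j"
proof -
  have step: "growth loc N i j = growth loc N' i j \<and> N (Suc i) (Suc j) = N' (Suc i) (Suc j)"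
    if "i < n" "j < n" "growth loc N (Suc i) j = growth loc N' (Suc i) j"
      "growth loc N i (Suc j) = growth loc N' i (Suc j)"
      "growth loc N (Suc i) (Suc j) = growth loc N' (Suc i) (Suc j)" for i j
    using loc_inj[of "growth loc N i j" "growth loc N (Suc i) j" "growth loc N i (Suc j)"
        "growth loc N' i j" "N (Suc i) (Suc j)" "N' (Suc i) (Suc j)"]
      growth_corner[of i j N] growth_corner[of i j N'] that
    by simp
  have all: "i \<le> n \<Longrightarrow> j \<le> n \<Longrightarrow> growth loc N i j = growth loc N' i j" for i j
  proof (induction "(n - i) + (n - j)" arbitrary: i j rule: less_induct)
    case less
    show ?case
    proof (cases "i = n \<or> j = n")
      case True
      then show ?thesis using rows columns less.prems by auto
    next
      case False
      then have "growth loc N (Suc i) j = growth loc N' (Suc i) j"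
        "growth loc N i (Suc j) = growth loc N' i (Suc j)"
        "growth loc N (Suc i) (Suc j) = growth loc N' (Suc i) (Suc j)"
        using less.prems by (intro less.hyps; linarith)+
      then show ?thesis using step[of i j] False less.prems by simp
    qed
  qed
  obtain i' j' where "i = Suc i'" "j = Suc j'" using ij by (metis atLeastAtMost_iff not_one_le_zero not0_implies_Suc)
  then show ?thesis using step[OF _ _ all all all, of i' j'] ij by auto
qed

text \<open>By \<open>loc_size\<close> the sizes satisfy inclusion-exclusion around every cell, as
  rectangular sums of the entries do.\<close>

lemma growth_size:
  "i \<le> n \<Longrightarrow> j \<le> n \<Longrightarrow> (\<Sum>r<n. growth loc N i j r) = (\<Sum>a\<in>{1..i}. \<Sum>b\<in>{1..j}. N a b)"
proof (induction i arbitrary: j)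
  case (Suc i)
  from Suc.prems(2) show ?case
  proof (induction j)
    case (Suc j)
    have "(\<Sum>r<n. growth loc N (Suc i) (Suc j) r) + (\<Sum>r<n. growth loc N i j r)
        = (\<Sum>r<n. growth loc N (Suc i) j r) + (\<Sum>r<n. growth loc N i (Suc j) r) + N (Suc i) (Suc j)"
      using loc_size[OF growth_corner, of i j] Suc.prems \<open>Suc i \<le> n\<close> by simp
    moreover have "(\<Sum>r<n. growth loc N i (Suc j) r) = (\<Sum>a\<in>{1..i}. \<Sum>b\<in>{1..j}. N a b) + (\<Sum>a\<in>{1..i}. N a (Suc j))"
      using Suc.prems \<open>Suc i \<le> n\<close> by (simp add: \<open>\<And>j. i \<le> n \<Longrightarrow> j \<le> n \<Longrightarrow> _ j\<close> sum.distrib)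
    ultimately show ?case
      using Suc \<open>Suc i \<le> n\<close> \<open>\<And>j. i \<le> n \<Longrightarrow> j \<le> n \<Longrightarrow> _ j\<close>[of j] by (simp add: sum.distrib)
  qed simp
qed simp

end

lemma strip_antimono: "strip \<rho> \<mu> \<Longrightarrow> r \<le> r' \<Longrightarrow> \<mu> r' \<le> \<mu> r"
  by (rule lift_Suc_antimono_le[of \<mu>]) (auto simp: strip_def intro: le_trans)

subsection \<open>The rule for antidiagonal chains\<close>

text \<open>Row 0 is last passage percolation with the given entries. The overlap
  \<open>min (\<mu> r) (\<nu> r) - \<rho> r\<close> of the two strips in row \<open>r\<close> acts
  as the entry for row \<open>Suc r\<close>.\<close>

fun rsk_rule :: local_rule where
  "rsk_rule \<rho> \<mu> \<nu> m 0 = max (\<mu> 0) (\<nu> 0) + m"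
| "rsk_rule \<rho> \<mu> \<nu> m (Suc r) = max (\<mu> (Suc r)) (\<nu> (Suc r)) + (min (\<mu> r) (\<nu> r) - \<rho> r)"

lemma growth_rule_rsk:
  assumes "n > 0"
  shows "growth_rule n rsk_rule"
proof
  show "n > 0" by fact
next
  fix \<rho> \<mu> \<nu> :: "nat \<Rightarrow> nat" and m
  assume s: "corner n \<rho> \<mu> \<nu>"
  have b: "\<rho> r \<le> \<mu> r" "\<mu> (Suc r) \<le> \<rho> r" "\<rho> r \<le> \<nu> r" "\<nu> (Suc r) \<le> \<rho> r" for r
    using s by (auto simp: strip_def corner_def)
  have "\<mu> r \<le> rsk_rule \<rho> \<mu> \<nu> m r \<and> \<nu> r \<le> rsk_rule \<rho> \<mu> \<nu> m r" for r
    by (cases r) auto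
  moreover have "rsk_rule \<rho> \<mu> \<nu> m (Suc r) \<le> \<mu> r \<and> rsk_rule \<rho> \<mu> \<nu> m (Suc r) \<le> \<nu> r" for r
    using b[of r] by auto
  ultimately show "strip \<mu> (rsk_rule \<rho> \<mu> \<nu> m) \<and> strip \<nu> (rsk_rule \<rho> \<mu> \<nu> m)" by (simp add: strip_def)
  \<comment> \<open>Each row telescopes by max + min = sum; \<open>min (\<mu> k) (\<nu> k)\<close>
    is what row \<open>k\<close> has yet to pass on, and it is 0 in the last row.\<close>
  have sum: "(\<Sum>r<Suc k. rsk_rule \<rho> \<mu> \<nu> m r) + (\<Sum>r<k. \<rho> r) + min (\<mu> k) (\<nu> k)
      = (\<Sum>r<Suc k. \<mu> r) + (\<Sum>r<Suc k. \<nu> r) + m" for k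
  proof (induction k)
    case (Suc k)
    have "rsk_rule \<rho> \<mu> \<nu> m (Suc k) + \<rho> k + min (\<mu> (Suc k)) (\<nu> (Suc k))
        = \<mu> (Suc k) + \<nu> (Suc k) + min (\<mu> k) (\<nu> k)" using b[of k] by auto
    then show ?case using Suc by simp
  qed simp
  obtain k where k: "n = Suc k" using assms by (cases n) auto
  then have "\<mu> k = 0" "\<rho> k = 0" using s b(1)[of k] by (auto simp: corner_def)
  then show "(\<Sum>r<n. rsk_rule \<rho> \<mu> \<nu> m r) + (\<Sum>r<n. \<rho> r) = (\<Sum>r<n. \<mu> r) + (\<Sum>r<n. \<nu> r) + m"
    using sum[of k] by (simp add: k)
next
  fix \<rho> \<mu> \<nu> \<rho>' :: "nat \<Rightarrow> nat" and m m'
  assume s: "corner n \<rho> \<mu> \<nu>" "corner n \<rho>' \<mu> \<nu>" and eq: "rsk_rule \<rho> \<mu> \<nu> m = rsk_rule \<rho>' \<mu> \<nu> m'"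
  \<comment> \<open>Row \<open>Suc r\<close> reveals
    \<open>min (\<mu> r) (\<nu> r) - \<rho> r\<close>, and \<open>\<rho> r\<close> is at most this
    minimum, so the subtraction loses nothing.\<close>
  have "\<rho> r = \<rho>' r" for r
    using fun_cong[OF eq, of "Suc r"] s by (auto simp: strip_def corner_def)
      (metis (no_types, lifting) diff_diff_cancel min.bounded_iff)
  moreover have "m = m'" using fun_cong[OF eq, of 0] by simp
  ultimately show "\<rho> = \<rho>' \<and> m = m'" by auto
qed

text \<open>\<open>s\<close> counts steps, so the chain has \<open>Suc s\<close> points; this fits
  the numbering of rows from 0.\<close>

definition antichain_in :: "(nat \<Rightarrow> nat \<Rightarrow> nat) \<Rightarrow> nat \<Rightarrow> nat \<Rightarrow> nat \<Rightarrow> bool" where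
  "antichain_in N s i j \<longleftrightarrow> (\<exists>a b.
     (\<forall>k\<le>s. 1 \<le> a k \<and> a k \<le> i \<and> 1 \<le> b k \<and> b k \<le> j \<and> N (a k) (b k) > (0::nat)) \<and>
     (\<forall>k<s. a k < a (Suc k) \<and> b (Suc k) < b k))"

text \<open>Row by row the rule is last passage percolation, and a chain among the overlaps of one row
  lifts to a longer chain of the row above.\<close>

locale percolation =
  fixes G N :: "nat \<Rightarrow> nat \<Rightarrow> nat"
  assumes G_0: "G 0 j = 0" "G i 0 = 0"
    and G_Suc: "G (Suc i) (Suc j) = max (G (Suc i) j) (G i (Suc j)) + N (Suc i) (Suc j)"
begin

lemma G_mono: "i \<le> i' \<Longrightarrow> j \<le> j' \<Longrightarrow> G i j \<le> G i' j'"
proof -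
  have r: "G i j \<le> G (Suc i) j" for i j by (cases j) (simp_all add: G_0 G_Suc)
  have c: "G i j \<le> G i (Suc j)" for i j by (cases i) (simp_all add: G_0 G_Suc)
  assume "i \<le> i'" "j \<le> j'"
  then show ?thesis
    using lift_Suc_mono_le[of "\<lambda>i. G i j", OF r] lift_Suc_mono_le[of "\<lambda>j. G i' j", OF c] le_trans by blast
qed

text \<open>An optimal path to \<open>(i, j)\<close> enters the empty rectangle across one of two
  sides and gains nothing afterwards. By monotonicity the corners \<open>(i0, j)\<close> and
  \<open>(i, j0)\<close> dominate these sides.\<close>

lemma G_empty_rectangle:
  assumes "\<And>x y. i0 < x \<Longrightarrow> x \<le> i \<Longrightarrow> j0 < y \<Longrightarrow> y \<le> j \<Longrightarrow> N x y = 0" "i0 \<le> i" "j0 \<le> j"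
  shows "G i j \<le> max (G i0 j) (G i j0)"
  using assms
proof (induction "i + j" arbitrary: i j rule: less_induct)
  case less
  show ?case
  proof (cases "i = i0 \<or> j = j0")
    case False
    then obtain i' j' where ij: "i = Suc i'" "j = Suc j'" "i0 \<le> i'" "j0 \<le> j'"
      using less.prems(2,3) by (metis le_SucE not0_implies_Suc le_zero_eq)
    have "G i' j \<le> max (G i0 j) (G i' j0)" using ij less.prems by (intro less.hyps) auto
    moreover have "G i j' \<le> max (G i0 j') (G i j0)" using ij less.prems by (intro less.hyps) auto
    moreover have "G i' j0 \<le> G i j0" "G i0 j' \<le> G i0 j" using ij by (auto intro: G_mono)
    moreover have "G i j = max (G i j') (G i' j)" using ij less.prems(1)[of i j] by (simp add: G_Suc)
    ultimately show ?thesis by linarith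
  qed auto
qed

lemma G_positive: "G i j > 0 \<Longrightarrow> antichain_in N 0 i j"
proof -
  assume pos: "G i j > 0"
  have "\<exists>x y. 0 < x \<and> x \<le> i \<and> 0 < y \<and> y \<le> j \<and> N x y > 0"
  proof (rule ccontr)
    assume "\<not> ?thesis"
    then have "N x y = 0" if "0 < x" "x \<le> i" "0 < y" "y \<le> j" for x y using that by auto
    then have "G i j \<le> max (G 0 j) (G i 0)" by (intro G_empty_rectangle) auto
    then show False using pos by (simp add: G_0)
  qed
  then obtain x y where "0 < x" "x \<le> i" "0 < y" "y \<le> j" "N x y > 0" by blast
  then show ?thesis unfolding antichain_in_def by (intro exI[of _ "\<lambda>_. x"] exI[of _ "\<lambda>_. y"]) auto
qed

text \<open>At each point of the chain \<open>G\<close> jumps in both directions out of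
  \<open>(a k - 1, b k - 1)\<close>. The points cut out \<open>s + 2\<close> rectangles, running
  from top left to bottom right in turn, and each contains a nonzero entry, since an empty one
  contradicts the jumps next to it.\<close>

lemma antichain_lift:
  assumes "antichain_in N' s i j"
    and N': "\<And>i j. N' (Suc i) (Suc j) = min (G (Suc i) j) (G i (Suc j)) - G i j"
  shows "antichain_in N (Suc s) i j"
proof -
  from assms(1) obtain a b where
    bd: "\<And>k. k \<le> s \<Longrightarrow> 1 \<le> a k \<and> a k \<le> i \<and> 1 \<le> b k \<and> b k \<le> j \<and> N' (a k) (b k) > 0"
    and ch: "\<And>k. k < s \<Longrightarrow> a k < a (Suc k) \<and> b (Suc k) < b k"
    unfolding antichain_in_def by blast
  have jump: "G (a k) (b k - 1) > G (a k - 1) (b k - 1)" "G (a k - 1) (b k) > G (a k - 1) (b k - 1)"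
    if "k \<le> s" for k
  proof -
    have "Suc (a k - 1) = a k" "Suc (b k - 1) = b k" using bd[OF that] by simp_all
    then have "N' (a k) (b k) = min (G (a k) (b k - 1)) (G (a k - 1) (b k)) - G (a k - 1) (b k - 1)"
      using N'[of "a k - 1" "b k - 1"] by simp
    moreover have "N' (a k) (b k) > 0" using bd[OF that] by simp
    ultimately have "G (a k - 1) (b k - 1) < min (G (a k) (b k - 1)) (G (a k - 1) (b k))" by linarith
    then show "G (a k) (b k - 1) > G (a k - 1) (b k - 1)" "G (a k - 1) (b k) > G (a k - 1) (b k - 1)"
      by simp_all
  qed
  \<comment> \<open>Rectangle \<open>k\<close> lies between the points \<open>k - 1\<close> and
    \<open>k\<close>. The first one is part of the column \<open>b 0\<close>, the last one part of
    the row \<open>a s\<close>.\<close>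
  define lo hi where "lo k = (if k = 0 then 0 else a (k - 1) - 1)" and "hi k = (if k \<le> s then a k - 1 else a s)" for k
  define lo' hi' where "lo' k = (if k \<le> s then b k - 1 else 0)" and "hi' k = (if k = 0 then b 0 else b (k - 1) - 1)" for k
  have ex: "\<exists>x y. lo k < x \<and> x \<le> hi k \<and> lo' k < y \<and> y \<le> hi' k \<and> N x y > 0" if k: "k \<le> Suc s" for k
  proof (rule ccontr)
    assume "\<not> ?thesis"
    then have none: "\<And>x y. lo k < x \<Longrightarrow> x \<le> hi k \<Longrightarrow> lo' k < y \<Longrightarrow> y \<le> hi' k \<Longrightarrow> N x y = 0"
      by (metis gr0I)
    consider "k = 0" | "k = Suc s" | k' where "k = Suc k'" "k' < s" using k by (cases k) (auto simp: le_less)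
    then show False
    proof cases
      case 1
      then show False
      proof -
        have "G (a 0 - 1) (b 0) \<le> max (G 0 (b 0)) (G (a 0 - 1) (b 0 - 1))"
          by (rule G_empty_rectangle, rule none) (simp_all add: 1 lo_def hi_def lo'_def hi'_def)
        then show False using jump(2)[of 0] by (simp add: G_0)
      qed
    next
      case 2
      then show False
      proof -
        have "G (a s) (b s - 1) \<le> max (G (a s - 1) (b s - 1)) (G (a s) 0)"
          by (rule G_empty_rectangle, rule none) (simp_all add: 2 lo_def hi_def lo'_def hi'_def)
        then show False using jump(1)[of s] by (simp add: G_0)
      qed
    next
      case 3
      define A B A' B' where "A = a k' - 1" and "B = b k' - 1" and "A' = a (Suc k') - 1" and "B' = b (Suc k') - 1"
      have lt: "A < A'" "B' < B" "a k' = Suc A" "b (Suc k') = Suc B'"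
        using ch[of k'] bd[of k'] bd[of "Suc k'"] 3 by (auto simp: A_def A'_def B_def B'_def)
      have none': "N x y = 0" if "A < x" "x \<le> A'" "B' < y" "y \<le> B" for x y
        by (rule none) (use that 3 in \<open>simp_all add: lo_def hi_def lo'_def hi'_def A_def B_def A'_def B'_def\<close>)
      have j1: "G (Suc A) B > G A B" using jump(1)[of k', folded A_def B_def] 3(2) by (simp only: lt(3) less_imp_le)
      have j2: "G A' (Suc B') > G A' B'" using jump(2)[of "Suc k'", folded A'_def B'_def] 3(2) by (simp only: lt(4) Suc_leI)
      \<comment> \<open>If the rectangle is empty, the first jump yields
        \<open>G A B < G A' B'\<close> and the second one the reverse inequality.\<close>
      have "G (Suc A) B \<le> max (G A B) (G (Suc A) B')" using lt none' by (intro G_empty_rectangle) auto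
      moreover have "G A' (Suc B') \<le> max (G A (Suc B')) (G A' B')" using lt none' by (intro G_empty_rectangle) auto
      moreover have "G A (Suc B') \<le> G A B" "G (Suc A) B' \<le> G A' B'" using lt by (auto intro: G_mono)
      ultimately show False using j1 j2 by linarith
    qed
  qed
  then obtain x y where xy: "\<And>k. k \<le> Suc s \<Longrightarrow> lo k < x k \<and> x k \<le> hi k \<and> lo' k < y k \<and> y k \<le> hi' k \<and> N (x k) (y k) > 0"
    by metis
  have "1 \<le> x k \<and> x k \<le> i \<and> 1 \<le> y k \<and> y k \<le> j \<and> N (x k) (y k) > 0" if "k \<le> Suc s" for k
  proof -
    have "hi k \<le> i" using bd[of k] bd[of s] by (auto simp: hi_def)
    moreover have "hi' k \<le> j"
    proof (cases k)
      case 0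
      then show ?thesis using bd[of 0] by (simp add: hi'_def)
    next
      case (Suc k')
      then have "b k' \<le> j" using bd[of k'] that by simp
      then show ?thesis using Suc by (simp add: hi'_def)
    qed
    ultimately show ?thesis using xy[OF that] by linarith
  qed
  moreover have "x k < x (Suc k) \<and> y (Suc k) < y k" if "k < Suc s" for k
  proof -
    have "hi k \<le> lo (Suc k)" "hi' (Suc k) \<le> lo' k" using that by (auto simp: hi_def lo_def hi'_def lo'_def)
    then show ?thesis using xy[of k] xy[of "Suc k"] that by linarith
  qed
  ultimately show ?thesis unfolding antichain_in_def by blast
qed

end

lemma rsk_chain:
  assumes n: "n > 0" and "i \<le> n" "j \<le> n" and pos: "growth rsk_rule N i j r > 0"
  shows "antichain_in N r i j"
proof -
  \<comment> \<open>The weights that drive row \<open>r\<close>: the entries for row 0, the overlaps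
    of the row before it otherwise.\<close>
  define M where "M r = (case r of 0 \<Rightarrow> N | Suc r' \<Rightarrow> (\<lambda>i j. min (growth rsk_rule N i (j - 1) r')
    (growth rsk_rule N (i - 1) j r') - growth rsk_rule N (i - 1) (j - 1) r'))" for r
  have perc: "percolation (\<lambda>i j. growth rsk_rule N i j r) (M r)" for r
    by unfold_locales (cases r; simp add: M_def)+
  have "antichain_in (M (r - d)) d i j" if "d \<le> r" for d
    using that
  proof (induction d)
    case 0
    then show ?case using percolation.G_positive[OF perc pos] by simp
  next
    case (Suc d)
    then have "r - d = Suc (r - Suc d)" by simp
    then have "antichain_in (M (Suc (r - Suc d))) d i j" using Suc by simp
    then show ?case by (rule percolation.antichain_lift[OF perc]) (simp add: M_def)
  qed
  from this[of r] show ?thesis by (simp add: M_def)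
qed

subsection \<open>The rule for diagonal chains\<close>

text \<open>Rows are processed from the bottom, so the value at \<open>n - r\<close> is the amount
  arriving in row \<open>r\<close>: it is \<open>\<mu> r + \<nu> r - \<rho> r\<close> plus the
  excess over \<open>\<rho> r\<close> of the amount one row further down.\<close>

fun burge_carry :: "nat \<Rightarrow> (nat \<Rightarrow> nat) \<Rightarrow> (nat \<Rightarrow> nat) \<Rightarrow> (nat \<Rightarrow> nat) \<Rightarrow> nat \<Rightarrow> nat \<Rightarrow> nat" where
  "burge_carry n \<rho> \<mu> \<nu> m 0 = m"
| "burge_carry n \<rho> \<mu> \<nu> m (Suc k) = (let r = n - Suc k in
     \<mu> r + \<nu> r + max (burge_carry n \<rho> \<mu> \<nu> m k) (\<rho> r) - 2 * \<rho> r)"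

text \<open>The entry \<open>m\<close> is inserted in the bottom row and whatever does not fit below \<open>\<rho>\<close> is pushed
  upwards, together with the overlap of \<open>\<mu>/\<rho>\<close> and \<open>\<nu>/\<rho>\<close>.\<close>

definition burge_rule :: "nat \<Rightarrow> local_rule" where
  "burge_rule n \<rho> \<mu> \<nu> m r = (case r of 0 \<Rightarrow> burge_carry n \<rho> \<mu> \<nu> m n
     | Suc r' \<Rightarrow> if r' < n then min (burge_carry n \<rho> \<mu> \<nu> m (n - r)) (\<rho> r') else 0)"

lemma burge_carry_row:
  "r < n \<Longrightarrow> burge_carry n \<rho> \<mu> \<nu> m (n - r) =
     \<mu> r + \<nu> r + max (burge_carry n \<rho> \<mu> \<nu> m (n - Suc r)) (\<rho> r) - 2 * \<rho> r"
  by (simp add: Suc_diff_Suc[symmetric] Let_def del: diff_Suc_Suc)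

text \<open>Over the integers, \<open>max y x - 2 * x\<close> is at least \<open>- min y x\<close>
  exactly when \<open>x \<le> y\<close>. Knowing both values thus decides the case, and in each case
  they determine \<open>x\<close> and \<open>y\<close>.\<close>

lemma max_min_cancel:
  fixes x y x' y' M V :: nat
  assumes "min y x = min y' x'" "M + V + max y x - 2 * x = M + V + max y' x' - 2 * x'"
    "x \<le> M" "x \<le> V" "x' \<le> M" "x' \<le> V"
  shows "x = x' \<and> y = y'"
proof -
  have "max y x + 2 * x' = max y' x' + 2 * x"
  proof -
    define a b where "a = max y x" and "b = max y' x'"
    have "M + V + a - 2 * x = M + V + b - 2 * x'" using assms(2) by (simp only: a_def b_def)
    then have "a + 2 * x' = b + 2 * x" using assms(3-) by linarith
    then show ?thesis by (simp only: a_def b_def)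
  qed
  then show ?thesis
    using assms(1)
    by (cases "x \<le> y"; cases "x' \<le> y'")
      (auto simp: max_absorb1 max_absorb2 min_absorb1 min_absorb2 not_le less_imp_le)
qed

lemma growth_rule_burge:
  assumes "n > 0"
  shows "growth_rule n (burge_rule n)"
proof
  show "n > 0" by fact
next
  fix \<rho> \<mu> \<nu> :: "nat \<Rightarrow> nat" and m
  assume s: "corner n \<rho> \<mu> \<nu>"
  have b: "\<rho> r \<le> \<mu> r" "\<mu> (Suc r) \<le> \<rho> r" "\<rho> r \<le> \<nu> r" "\<nu> (Suc r) \<le> \<rho> r" for r
    using s by (auto simp: strip_def corner_def)
  have z: "\<mu> r = 0" "\<nu> r = 0" "\<rho> r = 0" if "n - 1 \<le> r" for r
    using strip_antimono[of \<rho> \<mu> "n - 1" r] strip_antimono[of \<rho> \<nu> "n - 1" r] b(1)[of r] s that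
    by (auto simp: corner_def)
  let ?T = "\<lambda>r. burge_carry n \<rho> \<mu> \<nu> m (n - r)" and ?L = "burge_rule n \<rho> \<mu> \<nu> m"
  have T: "?T r = \<mu> r + \<nu> r + max (?T (Suc r)) (\<rho> r) - 2 * \<rho> r" if "r < n" for r
    using that by (rule burge_carry_row)
  have L: "?L 0 = ?T 0" "r < n \<Longrightarrow> ?L (Suc r) = min (?T (Suc r)) (\<rho> r)" for r
    by (simp_all add: burge_rule_def)
  have ge: "\<mu> r \<le> ?T r \<and> \<nu> r \<le> ?T r" if "r < n" for r
    using T[OF that] b(1,3)[of r] by linarith
  have "\<mu> r \<le> ?L r \<and> \<nu> r \<le> ?L r" for r
  proof (cases r)
    case 0
    then show ?thesis using ge[of 0] assms L by simp
  next
    case (Suc r')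
    then show ?thesis using ge[of r] L(2)[of r'] b(2,4)[of r'] z[of r] by (cases "r < n") auto
  qed
  moreover have "?L (Suc r) \<le> \<mu> r \<and> ?L (Suc r) \<le> \<nu> r" for r
    using b(1,3)[of r] by (auto simp: burge_rule_def)
  ultimately show "strip \<mu> ?L \<and> strip \<nu> ?L" by (simp add: strip_def)
  \<comment> \<open>Row by row this is max + min = sum for the carry from below and
    \<open>\<rho> k\<close>.\<close>
  have "?T 0 + (\<Sum>r<k. \<rho> r) + (\<Sum>r<k. ?L (Suc r)) = (\<Sum>r<k. \<mu> r) + (\<Sum>r<k. \<nu> r) + ?T k" if "k \<le> n" for k
    using that
  proof (induction k)
    case (Suc k)
    have "?T k + \<rho> k + ?L (Suc k) = \<mu> k + \<nu> k + ?T (Suc k)"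
      using T[of k] L(2)[of k] b(1,3)[of k] Suc.prems by linarith
    then show ?case using Suc by simp
  qed simp
  from this[of n] have "?L 0 + (\<Sum>r<n. ?L (Suc r)) + (\<Sum>r<n. \<rho> r) = (\<Sum>r<n. \<mu> r) + (\<Sum>r<n. \<nu> r) + m"
    by (simp add: L)
  moreover have "?L 0 + (\<Sum>r<n. ?L (Suc r)) = (\<Sum>r<n. ?L r) + ?L n"
    by (metis sum.lessThan_Suc sum.lessThan_Suc_shift)
  moreover have "?L n = 0" using L(2)[of "n - 1"] z[of "n - 1"] assms by simp
  ultimately show "(\<Sum>r<n. ?L r) + (\<Sum>r<n. \<rho> r) = (\<Sum>r<n. \<mu> r) + (\<Sum>r<n. \<nu> r) + m" by simp
next
  fix \<rho> \<mu> \<nu> \<rho>' :: "nat \<Rightarrow> nat" and m m'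
  assume s: "corner n \<rho> \<mu> \<nu>" "corner n \<rho>' \<mu> \<nu>" and eq: "burge_rule n \<rho> \<mu> \<nu> m = burge_rule n \<rho>' \<mu> \<nu> m'"
  let ?T = "\<lambda>r. burge_carry n \<rho> \<mu> \<nu> m (n - r)" and ?T' = "\<lambda>r. burge_carry n \<rho>' \<mu> \<nu> m' (n - r)"
  have b: "\<rho> r \<le> \<mu> r" "\<rho> r \<le> \<nu> r" "\<rho>' r \<le> \<mu> r" "\<rho>' r \<le> \<nu> r" for r
    using s by (auto simp: strip_def corner_def)
  have step: "\<rho> r = \<rho>' r \<and> ?T (Suc r) = ?T' (Suc r)" if "r < n" "?T r = ?T' r" for r
  proof -
    have "min (?T (Suc r)) (\<rho> r) = min (?T' (Suc r)) (\<rho>' r)"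
      using fun_cong[OF eq, of "Suc r"] that by (simp add: burge_rule_def)
    moreover have "\<mu> r + \<nu> r + max (?T (Suc r)) (\<rho> r) - 2 * \<rho> r
        = \<mu> r + \<nu> r + max (?T' (Suc r)) (\<rho>' r) - 2 * \<rho>' r"
      using burge_carry_row[OF that(1), of \<rho> \<mu> \<nu> m] burge_carry_row[OF that(1), of \<rho>' \<mu> \<nu> m'] that(2)
      by (simp only:)
    ultimately show ?thesis using max_min_cancel b[of r] by blast
  qed
  have T: "?T r = ?T' r" if "r \<le> n" for r
    using that
  proof (induction r)
    case 0
    then show ?case using fun_cong[OF eq, of 0] by (simp add: burge_rule_def)
  next
    case (Suc r)
    then show ?case using step[of r] by simp
  qed
  have "\<rho> r = \<rho>' r" for r
  proof (cases "r < n")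
    case True
    then show ?thesis using step[of r] T[of r] by simp
  next
    case False
    then have "\<mu> r = 0" using strip_antimono[of \<rho> \<mu> "n - 1" r] s by (auto simp: corner_def)
    then show ?thesis using b[of r] by simp
  qed
  moreover have "m = m'" using T[of n] by simp
  ultimately show "\<rho> = \<rho>' \<and> m = m'" by auto
qed

definition chain_in :: "(nat \<Rightarrow> nat \<Rightarrow> nat) \<Rightarrow> nat \<Rightarrow> nat \<Rightarrow> nat \<Rightarrow> bool" where
  "chain_in N s i j \<longleftrightarrow> (\<exists>a b.
     (\<forall>k\<le>s. 1 \<le> a k \<and> a k \<le> i \<and> 1 \<le> b k \<and> b k \<le> j \<and> N (a k) (b k) > (0::nat)) \<and>
     (\<forall>k<s. a k < a (Suc k) \<and> b k < b (Suc k)))"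

lemma chain_in_mono: "chain_in N s i j \<Longrightarrow> i \<le> i' \<Longrightarrow> j \<le> j' \<Longrightarrow> chain_in N s i' j'"
proof -
  assume "chain_in N s i j" and le: "i \<le> i'" "j \<le> j'"
  then obtain a b where
    "\<forall>k\<le>s. 1 \<le> a k \<and> a k \<le> i \<and> 1 \<le> b k \<and> b k \<le> j \<and> N (a k) (b k) > 0"
    "\<forall>k<s. a k < a (Suc k) \<and> b k < b (Suc k)"
    unfolding chain_in_def by blast
  then show ?thesis unfolding chain_in_def
    using le by (intro exI[of _ a] exI[of _ b]) (auto intro: le_trans)
qed

lemma burge_carry_constant:
  assumes "\<And>s. r \<le> s \<Longrightarrow> \<mu> s = 0 \<and> \<nu> s = 0 \<and> \<rho> s = 0" "r \<le> n"
  shows "burge_carry n \<rho> \<mu> \<nu> m (n - r) = m"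
  using assms(2,1)
proof (induction rule: inc_induct)
  case (step r)
  then show ?case by (simp add: burge_carry_row)
qed simp

text \<open>If row \<open>r\<close> is absent from \<mu> and \<nu>, the carry arriving there is the
  entry of the cell itself. The row can then be created only if this entry is nonzero and, for
  positive \<open>r\<close>, row \<open>r - 1\<close> of \<rho> is present; a chain for the latter
  is extended by the cell.\<close>

lemma burge_chain:
  assumes n: "n > 0"
  shows "i \<le> n \<Longrightarrow> j \<le> n \<Longrightarrow> growth (burge_rule n) N i j r > 0 \<Longrightarrow> chain_in N r i j"
proof (induction "i + j" arbitrary: i j r rule: less_induct)
  case less
  interpret growth_rule n "burge_rule n" by (rule growth_rule_burge[OF n])
  obtain i' j' where ij: "i = Suc i'" "j = Suc j'"
    using less.prems(3) by (cases i; cases j) auto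
  let ?\<rho> = "growth (burge_rule n) N i' j'" and ?\<mu> = "growth (burge_rule n) N (Suc i') j'"
    and ?\<nu> = "growth (burge_rule n) N i' (Suc j')" and ?m = "N (Suc i') (Suc j')"
  show ?case
  proof (cases "?\<mu> r > 0 \<or> ?\<nu> r > 0")
    case True
    then show ?thesis
      using less.hyps[of "Suc i'" j' r] less.hyps[of i' "Suc j'" r] less.prems ij
        chain_in_mono[of N r "Suc i'" j' i j] chain_in_mono[of N r i' "Suc j'" i j] by auto
  next
    case False
    have c: "corner n ?\<rho> ?\<mu> ?\<nu>" using growth_corner less.prems ij by simp
    have z: "?\<mu> s = 0 \<and> ?\<nu> s = 0 \<and> ?\<rho> s = 0" if "r \<le> s" for s
    proof -
      have "?\<mu> s \<le> ?\<mu> r" "?\<nu> s \<le> ?\<nu> r" "?\<rho> s \<le> ?\<mu> s"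
        using c that strip_antimono by (auto simp: corner_def strip_def)
      then show ?thesis using False by simp
    qed
    have pos: "burge_rule n ?\<rho> ?\<mu> ?\<nu> ?m r > 0" using less.prems(3) ij by simp
    then have rn: "r \<le> n" by (auto simp: burge_rule_def split: nat.splits if_splits)
    have T: "burge_carry n ?\<rho> ?\<mu> ?\<nu> ?m (n - r) = ?m"
      using burge_carry_constant[of r ?\<mu> ?\<nu> ?\<rho> n ?m] z rn by blast
    show ?thesis
    proof (cases r)
      case 0
      then have "?m > 0" using pos T by (simp add: burge_rule_def)
      then show ?thesis unfolding chain_in_def 0
        by (intro exI[of _ "\<lambda>_. Suc i'"] exI[of _ "\<lambda>_. Suc j'"]) (simp add: ij)
    next
      case (Suc r')
      then have m: "?m > 0" and "?\<rho> r' > 0"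
        using pos T by (auto simp: burge_rule_def split: if_splits)
      then have "chain_in N r' i' j'" using less.hyps[of i' j' r'] less.prems ij by simp
      then obtain a b where
        bd: "\<And>k. k \<le> r' \<Longrightarrow> 1 \<le> a k \<and> a k \<le> i' \<and> 1 \<le> b k \<and> b k \<le> j' \<and> N (a k) (b k) > 0"
        and ch: "\<And>k. k < r' \<Longrightarrow> a k < a (Suc k) \<and> b k < b (Suc k)"
        unfolding chain_in_def by blast
      define a' b' where "a' = a(Suc r' := Suc i')" and "b' = b(Suc r' := Suc j')"
      have "1 \<le> a' k \<and> a' k \<le> i \<and> 1 \<le> b' k \<and> b' k \<le> j \<and> N (a' k) (b' k) > 0" if "k \<le> r" for k
        using bd[of k] that m Suc ij by (cases "k = Suc r'") (auto simp: a'_def b'_def)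
      moreover have "a' k < a' (Suc k) \<and> b' k < b' (Suc k)" if "k < r" for k
        using ch[of k] bd[of k] that Suc by (cases "k = r'") (auto simp: a'_def b'_def le_imp_less_Suc)
      ultimately show ?thesis unfolding chain_in_def by blast
    qed
  qed
qed

subsection \<open>Columns of the boundary tableaux\<close>

text \<open>A Gelfand-Tsetlin pattern, that is a semistandard tableau given by the shapes
  \<open>L i\<close> of its entries up to \<open>i\<close>. Its columns become index lists of
  minors.\<close>

locale gt_pattern =
  fixes n :: nat and L :: "nat \<Rightarrow> nat \<Rightarrow> nat"
  assumes L_0: "L 0 r = 0" and L_strip: "i < n \<Longrightarrow> strip (L i) (L (Suc i))" and L_n: "L n n = 0"
begin

lemma L_mono: "i \<le> i' \<Longrightarrow> i' \<le> n \<Longrightarrow> L i r \<le> L i' r"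
proof (induction rule: dec_induct)
  case (step m)
  then show ?case using L_strip[of m] by (auto simp: strip_def intro: le_trans)
qed simp

lemma L_antimono: "r \<le> r' \<Longrightarrow> i \<le> n \<Longrightarrow> L i r' \<le> L i r"
  by (cases i) (auto simp: L_0 Suc_le_eq intro: strip_antimono[OF L_strip])

definition col_size :: "nat \<Rightarrow> nat" where "col_size c = (LEAST r. L n r \<le> c)"

definition col :: "nat \<Rightarrow> nat list" where
  "col c = map (\<lambda>r. LEAST i. L i r > c) [0..<col_size c]"

lemma col_size_iff: "r < col_size c \<longleftrightarrow> c < L n r"
proof
  assume "r < col_size c"
  then show "c < L n r" unfolding col_size_def by (meson not_le not_less_Least)
next
  assume c: "c < L n r"
  have "L n (col_size c) \<le> c" unfolding col_size_def by (rule LeastI[of _ n]) (simp add: L_n)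
  then show "r < col_size c" using c L_antimono[of "col_size c" r n] by (meson le_less_trans le_refl not_le)
qed

lemma length_col [simp]: "length (col c) = col_size c" by (simp add: col_def)

lemma col_le_iff:
  assumes "r < col_size c" "v \<le> n"
  shows "col c ! r \<le> v \<longleftrightarrow> c < L v r"
proof
  have least: "c < L (col c ! r) r" "col c ! r \<le> n"
    using assms(1) LeastI[of "\<lambda>i. c < L i r" n] Least_le[of "\<lambda>i. c < L i r" n]
    by (auto simp: col_size_iff col_def)
  show "c < L v r" if "col c ! r \<le> v" using least L_mono[OF that assms(2), of r] by simp
  show "col c ! r \<le> v" if "c < L v r" using assms(1) that by (auto simp: col_def intro: Least_le)
qed

lemma valid_index_col: "valid_index n (col c)"
proof (rule valid_indexI)
  have "L n n \<le> c" using L_n by simp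
  fix r assume r: "r < length (col c)"
  have "\<not> col c ! r \<le> 0" using col_le_iff[of r c 0] r by (simp add: L_0)
  moreover have "col c ! r \<le> n" using col_le_iff[of r c n] r by (simp add: col_size_iff)
  ultimately show "1 \<le> col c ! r \<and> col c ! r \<le> n" by simp
next
  fix r assume r: "Suc r < length (col c)"
  let ?v = "col c ! Suc r"
  have v: "c < L ?v (Suc r)" "?v \<le> n" using col_le_iff[of "Suc r" c ?v] col_le_iff[of "Suc r" c n] r by (auto simp: col_size_iff)
  then obtain v' where v': "?v = Suc v'" using L_0 by (cases ?v) auto
  then have "c < L v' r" using L_strip[of v'] v by (auto simp: strip_def intro: less_le_trans)
  then have "col c ! r \<le> v'" using col_le_iff[of r c v'] r v v' by simp
  then show "col c ! r < col c ! Suc r" using v' by simp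
qed

text \<open>The leading exponents of minors contain indicators of exactly this kind; their sum over
  all columns returns the pattern.\<close>

lemma count_col:
  assumes "v \<le> n"
  shows "(\<Sum>c<L n 0. if r < col_size c \<and> col c ! r \<le> v then 1 else 0) = L v r"
proof -
  have "L v r \<le> L n 0" using L_mono[of v n r] L_antimono[of 0 r n] assms by simp
  then have "{c\<in>{..<L n 0}. r < col_size c \<and> col c ! r \<le> v} = {..<L v r}"
    using assms L_mono[of v n r] by (auto simp: col_le_iff col_size_iff)
  then show ?thesis by (simp add: sum.If_cases Int_def)
qed

lemma count_col_greater:
  assumes "v \<le> n"
  shows "(\<Sum>c<L n 0. if r < col_size c \<and> v < col c ! r then 1 else 0) + L v r = L n r"
proof -
  have "(\<Sum>c<L n 0. if r < col_size c \<and> v < col c ! r then 1 else (0::nat)) + L v r =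
    (\<Sum>c<L n 0. (if r < col_size c \<and> v < col c ! r then 1 else 0) +
      (if r < col_size c \<and> col c ! r \<le> v then 1 else 0))"
    using count_col[OF assms, of r] by (simp add: sum.distrib)
  also have "\<dots> = (\<Sum>c<L n 0. if r < col_size c \<and> col c ! r \<le> n then 1 else 0)"
    using col_le_iff[of r _ n] by (intro sum.cong) (auto simp: col_size_iff)
  finally show ?thesis using count_col[of n r] by simp
qed

lemma sum_col_size: "(\<Sum>c<L n 0. col_size c) = (\<Sum>r<n. L n r)"
proof -
  have "col_size c \<le> n" for c using valid_index_length[OF valid_index_col[of c]] by simp
  then have "{..<n} \<inter> {r. r < col_size c} = {..<col_size c}" for c by (auto intro: less_le_trans)
  then have "(\<Sum>c<L n 0. col_size c) = (\<Sum>c<L n 0. \<Sum>r<n. if r < col_size c then 1 else 0)"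
    by (simp add: sum.If_cases)
  also have "\<dots> = (\<Sum>r<n. \<Sum>c<L n 0. if r < col_size c then 1 else 0)" by (rule sum.swap)
  also have "\<dots> = (\<Sum>r<n. L n r)"
  proof (rule sum.cong[OF refl])
    fix r
    have "{..<L n 0} \<inter> {c. r < col_size c} = {..<L n r}"
      using L_antimono[of 0 r n] by (auto simp: col_size_iff)
    then show "(\<Sum>c<L n 0. if r < col_size c then 1 else 0) = L n r" by (simp add: sum.If_cases)
  qed
  finally show ?thesis .
qed

end

section \<open>Evaluating noncommutative polynomials at operator matrices\<close>

definition word_op :: "'k::field op_matrix \<Rightarrow> (nat \<times> nat) list \<Rightarrow> (expo, 'k) operator" where
  "word_op M w = (\<Prod>(i, j)\<leftarrow>w. M i j)"

definition eval_op :: "'k::field op_matrix \<Rightarrow> 'k ncpoly \<Rightarrow> (expo, 'k) operator" where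
  "eval_op M f = (\<Sum>w\<in>Poly_Mapping.keys f. scal (Poly_Mapping.lookup f w) * word_op M w)"

lemma eval_op_superset:
  assumes "finite S" "Poly_Mapping.keys f \<subseteq> S"
  shows "eval_op M f = (\<Sum>w\<in>S. scal (Poly_Mapping.lookup f w) * word_op M w)"
  unfolding eval_op_def by (rule sum.mono_neutral_left) (use assms in \<open>auto simp: in_keys_iff\<close>)

lemma eval_op_add: "eval_op M (f + g) = eval_op M f + eval_op M g"
proof -
  let ?S = "Poly_Mapping.keys f \<union> Poly_Mapping.keys g"
  have "Poly_Mapping.keys (f + g) \<subseteq> ?S" by (rule Poly_Mapping.keys_add)
  then show ?thesis
    using eval_op_superset[of ?S "f + g" M] eval_op_superset[of ?S f M] eval_op_superset[of ?S g M]
    by (simp add: lookup_add scal_add distrib_right sum.distrib)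
qed

lemma eval_op_0 [simp]: "eval_op M 0 = 0" by (simp add: eval_op_def)

lemma eval_op_uminus: "eval_op M (- f) = - eval_op M f"
  using eval_op_add[of M f "- f"] by (simp add: eq_neg_iff_add_eq_0 add.commute)

lemma eval_op_diff: "eval_op M (f - g) = eval_op M f - eval_op M g"
  using eval_op_add[of M f "- g"] by (simp add: eval_op_uminus)

lemma eval_op_sum: "eval_op M (\<Sum>i\<in>A. f i) = (\<Sum>i\<in>A. eval_op M (f i))"
  by (induction A rule: infinite_finite_induct) (simp_all add: eval_op_add)

lemma eval_op_single: "eval_op M (Poly_Mapping.single w c) = scal c * word_op M w"
  by (simp add: eval_op_def)

lemma word_op_append: "word_op M (v @ w) = word_op M v * word_op M w"
  by (simp add: word_op_def)

lemma eval_op_mult: "eval_op M (f * g) = eval_op M f * eval_op M g"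
proof -
  let ?s = "\<lambda>f w. Poly_Mapping.single w (Poly_Mapping.lookup f w) :: 'a ncpoly"
  have s: "scal a * word_op M v * (scal b * word_op M w) = scal (a * b) * (word_op M v * word_op M w)" for a b v w
    by (simp only: mult.assoc scal_left_commute[of "word_op M v"] scal_scal)
  have "eval_op M (f * g) = eval_op M
      ((\<Sum>w\<in>Poly_Mapping.keys f. ?s f w) * (\<Sum>w\<in>Poly_Mapping.keys g. ?s g w))"
    using sum_singles[of f] sum_singles[of g] by simp
  also have "\<dots> = (\<Sum>w\<in>Poly_Mapping.keys f. \<Sum>v\<in>Poly_Mapping.keys g.
      eval_op M (?s f w) * eval_op M (?s g v))"
    by (simp add: sum_product eval_op_sum mult_single eval_op_single plus_list_def word_op_append s)
  also have "\<dots> = eval_op M (\<Sum>w\<in>Poly_Mapping.keys f. ?s f w) * eval_op M (\<Sum>w\<in>Poly_Mapping.keys g. ?s g w)"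
    by (simp add: sum_product eval_op_sum)
  finally show ?thesis
    using sum_singles[of f] sum_singles[of g] by simp
qed

lemma eval_op_const: "eval_op M (const c) = scal c"
  by (simp add: const_def eval_op_single word_op_def)

lemma eval_op_1: "eval_op M 1 = 1"
  using eval_op_const[of M 1] by (simp add: const_def zero_list_def flip: single_one)

lemma eval_op_X: "eval_op M (X i j) = M i j"
  by (simp add: X_def eval_op_single word_op_def)

lemma eval_op_prod_list: "eval_op M (\<Prod>r\<leftarrow>rs. f r) = (\<Prod>r\<leftarrow>rs. eval_op M (f r))"
  by (induction rs) (simp_all add: eval_op_1 eval_op_mult)

lemma eval_op_minor:
  assumes "finite I" "finite J" "card I = card J"
  shows "eval_op M (minor_poly q I J) = op_minor q M (sorted_list_of_set I) (sorted_list_of_set J)"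
  using assms by (simp add: minor_poly_def op_minor_def eval_op_sum eval_op_mult eval_op_const
      eval_op_prod_list eval_op_X)

lemma quantum_relations_intros:
  assumes "i \<in> {1..n}" "j \<in> {1..n}" "l \<in> {1..n}" "m \<in> {1..n}"
  shows "i < l \<Longrightarrow> X i j * X l j - const q * X l j * X i j \<in> quantum_relations n q"
    and "j < m \<Longrightarrow> X i j * X i m - const q * X i m * X i j \<in> quantum_relations n q"
    and "i < l \<Longrightarrow> m < j \<Longrightarrow> X i j * X l m - X l m * X i j \<in> quantum_relations n q"
    and "i < l \<Longrightarrow> j < m \<Longrightarrow>
      X i j * X l m - X l m * X i j - const (q - inverse q) * X i m * X l j \<in> quantum_relations n q"
proof -
  show "X i j * X l j - const q * X l j * X i j \<in> quantum_relations n q" if "i < l"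
    unfolding quantum_relations_def
    by (rule UnI1, rule UnI1, rule UnI1, rule CollectI, intro exI conjI, rule refl) (use assms that in simp_all)
  show "X i j * X i m - const q * X i m * X i j \<in> quantum_relations n q" if "j < m"
    unfolding quantum_relations_def
    by (rule UnI1, rule UnI1, rule UnI2, rule CollectI, intro exI conjI, rule refl) (use assms that in simp_all)
  show "X i j * X l m - X l m * X i j \<in> quantum_relations n q" if "i < l" "m < j"
    unfolding quantum_relations_def
    by (rule UnI1, rule UnI2, rule CollectI, intro exI conjI, rule refl) (use assms that in simp_all)
  show "X i j * X l m - X l m * X i j - const (q - inverse q) * X i m * X l j \<in> quantum_relations n q"
    if "i < l" "j < m"
    unfolding quantum_relations_def
    by (rule UnI2, rule CollectI, intro exI conjI, rule refl) (use assms that in simp_all)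
qed

lemma eval_op_relation:
  assumes M: "quantum_matrix q M" and q: "q \<noteq> 0" and r: "r \<in> quantum_relations n q"
  shows "eval_op M r = 0"
proof -
  note ev = eval_op_diff eval_op_mult eval_op_X eval_op_const mult.assoc
  consider i l j where "r = X i j * X l j - const q * X l j * X i j" "i < l"
    | i j m where "r = X i j * X i m - const q * X i m * X i j" "j < m"
    | i j l m where "r = X i j * X l m - X l m * X i j" "i < l" "m < j"
    | i j l m where "r = X i j * X l m - X l m * X i j - const (q - inverse q) * X i m * X l j" "i < l" "j < m"
    using r unfolding quantum_relations_def by blast
  then show ?thesis
  proof cases
    case 1
    then show ?thesis using column_relation[OF M q, of i l j] by (simp add: ev)
  next
    case 2
    then show ?thesis using row_relation[OF M q, of j m i] by (simp add: ev)
  next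
    case 3
    then show ?thesis using antidiagonal_relation[OF M, of i l m j] by (simp add: ev)
  next
    case 4
    then show ?thesis using diagonal_relation[OF M, of i l j m] by (simp add: ev)
  qed
qed

section \<open>Ideals of the free algebra\<close>

lemma free_algebra_minus:
  assumes "f \<in> carrier (free_algebra n :: 'k::field ncpoly ring)"
  shows "\<ominus>\<^bsub>free_algebra n\<^esub> f = - f"
proof -
  interpret ring "free_algebra n :: 'k ncpoly ring" by (rule ring_free_algebra)
  show ?thesis using l_neg[OF assms] by (simp add: eq_neg_iff_add_eq_0)
qed

lemma free_algebra_idealI:
  assumes "K \<subseteq> carrier (free_algebra n :: 'k::field ncpoly ring)" "0 \<in> K"
    and add: "\<And>f g. f \<in> K \<Longrightarrow> g \<in> K \<Longrightarrow> f + g \<in> K" and um: "\<And>f. f \<in> K \<Longrightarrow> - f \<in> K"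
    and l: "\<And>f g. f \<in> K \<Longrightarrow> g \<in> carrier (free_algebra n) \<Longrightarrow> g * f \<in> K"
    and r: "\<And>f g. f \<in> K \<Longrightarrow> g \<in> carrier (free_algebra n) \<Longrightarrow> f * g \<in> K"
  shows "ideal K (free_algebra n :: 'k ncpoly ring)"
proof (rule idealI[OF ring_free_algebra])
  interpret ring "free_algebra n :: 'k ncpoly ring" by (rule ring_free_algebra)
  show "subgroup K (add_monoid (free_algebra n))"
  proof (rule add.subgroupI)
    show "\<ominus>\<^bsub>free_algebra n\<^esub> f \<in> K" if "f \<in> K" for f
      using um[OF that] free_algebra_minus[of f n] assms(1) that by (metis subsetD)
  qed (use assms in auto)
qed (use l r in auto)

lemma ideal_kernel:
  assumes M: "\<And>i j. M i j \<in> torus_alg q k"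
  shows "ideal {f \<in> carrier (free_algebra n). eval_op M f = 0} (free_algebra n)"
proof (rule free_algebra_idealI)
  fix f g :: "'a ncpoly"
  assume f: "f \<in> {f \<in> carrier (free_algebra n). eval_op M f = 0}"
  show "- f \<in> {f \<in> carrier (free_algebra n). eval_op M f = 0}"
    using f by (simp add: eval_op_uminus)
  assume g: "g \<in> carrier (free_algebra n)"
  show "g * f \<in> {f \<in> carrier (free_algebra n). eval_op M f = 0}"
    "f * g \<in> {f \<in> carrier (free_algebra n). eval_op M f = 0}"
    using f g keys_mult_lists[of f _ g] keys_mult_lists[of g _ f] by (auto simp: eval_op_mult)
next
  fix f g :: "'a ncpoly"
  assume fg: "f \<in> {f \<in> carrier (free_algebra n). eval_op M f = 0}" "g \<in> {f \<in> carrier (free_algebra n). eval_op M f = 0}"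
  then have "Poly_Mapping.keys (f + g) \<subseteq> lists ({1..n} \<times> {1..n})"
    using Poly_Mapping.keys_add[of f g] by (simp only: free_algebra_simps mem_Collect_eq) blast
  then show "f + g \<in> {f \<in> carrier (free_algebra n). eval_op M f = 0}"
    using fg by (simp add: eval_op_add)
qed auto

section \<open>Normal forms modulo minors\<close>

text \<open>The weight \<open>\<Sum> i * j\<close> drops in the correction term of every relation, and among the terms of
  a quantum minor the diagonal one is the unique heaviest.\<close>

definition word_weight_ij :: "(nat \<times> nat) list \<Rightarrow> nat" where
  "word_weight_ij w = (\<Sum>(i, j)\<leftarrow>w. i * j)"

lemma word_weight_ij_simps [simp]:
  "word_weight_ij [] = 0" "word_weight_ij (x # w) = fst x * snd x + word_weight_ij w"
  "word_weight_ij (v @ w) = word_weight_ij v + word_weight_ij w"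
  by (simp_all add: word_weight_ij_def split_beta)

lemma word_weight_ij_mset: "mset v = mset w \<Longrightarrow> word_weight_ij v = word_weight_ij w"
  unfolding word_weight_ij_def by (metis mset_map sum_mset_sum_list)

lemma permutes_increasing_id:
  assumes \<sigma>: "\<sigma> permutes {..<s::nat}" and inc: "\<And>r. Suc r < s \<Longrightarrow> \<sigma> r < \<sigma> (Suc r)"
  shows "\<sigma> = id"
proof -
  have ge: "r \<le> \<sigma> r" if "r < s" for r using strict_mono_ge[of s \<sigma> r] inc that by blast
  have "(\<Sum>r<s. \<sigma> r) = (\<Sum>r<s. r)" using sum.permute[OF \<sigma>, of "\<lambda>r. r"] by (simp add: comp_def)
  then have "\<forall>r\<in>{..<s}. \<sigma> r = r"
    using sum_strict_mono_ex1[of "{..<s}" "\<lambda>r. r" \<sigma>] ge by (metis finite_lessThan lessThan_iff nat_less_le order_less_irrefl)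
  then show ?thesis using \<sigma> by (auto simp: fun_eq_iff permutes_def)
qed

text \<open>Exchanging the values at an adjacent descent strictly increases the sum, so the maximum
  over all permutations can only be attained at the identity.\<close>

lemma rearrangement:
  assumes \<sigma>: "\<sigma> permutes {..<s}" "\<sigma> \<noteq> id"
    and x: "\<And>r. Suc r < s \<Longrightarrow> x r < (x (Suc r) :: nat)" and y: "\<And>r r'. r < r' \<Longrightarrow> r' < s \<Longrightarrow> y r < (y r' :: nat)"
  shows "(\<Sum>r<s. x r * y (\<sigma> r)) < (\<Sum>r<s. x r * y r)"
proof -
  define dot where "dot \<sigma> = (\<Sum>r<s. x r * y (\<sigma> r))" for \<sigma>
  let ?P = "{\<sigma>. \<sigma> permutes {..<s}}"
  have fin: "finite ?P" by (rule finite_permutations) simp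
  have improve: "\<exists>\<tau>\<in>?P. dot \<sigma> < dot \<tau>" if "\<sigma> \<in> ?P" "\<sigma> \<noteq> id" for \<sigma>
  proof -
    have \<sigma>: "\<sigma> permutes {..<s}" using that by simp
    obtain r where r: "Suc r < s" "\<not> \<sigma> r < \<sigma> (Suc r)" using permutes_increasing_id[OF \<sigma>] \<open>\<sigma> \<noteq> id\<close> by blast
    have "\<sigma> r \<noteq> \<sigma> (Suc r)" using permutes_inj[OF \<sigma>] by (simp add: inj_eq)
    then have lt: "\<sigma> (Suc r) < \<sigma> r" using r by simp
    have "\<sigma> r < s" using permutes_in_image[OF \<sigma>, of r] r by simp
    then have ylt: "y (\<sigma> (Suc r)) < y (\<sigma> r)" using y lt by blast
    let ?t = "Transposition.transpose r (Suc r)"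
    have t: "?t permutes {..<s}" using r by (intro permutes_swap_id) auto
    have split: "(\<Sum>p<s. f p) = f r + f (Suc r) + (\<Sum>p\<in>{..<s} - {r, Suc r}. f p)" for f :: "nat \<Rightarrow> nat"
    proof -
      have "{..<s} = insert r (insert (Suc r) ({..<s} - {r, Suc r}))" using r by auto
      then have "(\<Sum>p<s. f p) = (\<Sum>p\<in>insert r (insert (Suc r) ({..<s} - {r, Suc r})). f p)" by simp
      then show ?thesis by simp
    qed
    have "(\<Sum>p\<in>{..<s} - {r, Suc r}. x p * y ((\<sigma> \<circ> ?t) p)) = (\<Sum>p\<in>{..<s} - {r, Suc r}. x p * y (\<sigma> p))"
      by (intro sum.cong) auto
    moreover have "x r * y (\<sigma> r) + x (Suc r) * y (\<sigma> (Suc r)) < x r * y (\<sigma> (Suc r)) + x (Suc r) * y (\<sigma> r)"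
    proof -
      obtain d where d: "x (Suc r) = x r + Suc d" using x[OF r(1)] less_iff_Suc_add by auto
      show ?thesis using ylt by (simp add: d algebra_simps mult_less_mono1 add_less_le_mono)
    qed
    ultimately have "dot \<sigma> < dot (\<sigma> \<circ> ?t)"
      unfolding dot_def split[of "\<lambda>r. x r * y (\<sigma> r)"] split[of "\<lambda>r. x r * y ((\<sigma> \<circ> ?t) r)"] by simp
    then show ?thesis using permutes_compose[OF t \<sigma>] by blast
  qed
  obtain \<tau> where \<tau>: "\<tau> \<in> ?P" "\<And>\<sigma>. \<sigma> \<in> ?P \<Longrightarrow> dot \<sigma> \<le> dot \<tau>"
  proof -
    have "Max (dot ` ?P) \<in> dot ` ?P" using fin by (intro Max_in) (auto intro: permutes_id)
    then obtain \<tau> where "\<tau> \<in> ?P" "dot \<tau> = Max (dot ` ?P)" by auto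
    then show ?thesis using that fin by simp
  qed
  have "\<tau> = id" using improve[OF \<tau>(1)] \<tau>(2) by (meson leD)
  moreover obtain \<sigma>' where "\<sigma>' \<in> ?P" "dot \<sigma> < dot \<sigma>'" using improve[of \<sigma>] \<sigma> by auto
  ultimately have "dot \<sigma> < dot id" using \<tau>(2)[of \<sigma>'] by simp
  then show ?thesis by (simp add: dot_def)
qed

section \<open>Words and polynomials of smaller weight\<close>

definition letters :: "nat \<Rightarrow> (nat \<times> nat) set" where "letters n = {1..n} \<times> {1..n}"

definition diagonal_word :: "nat set \<Rightarrow> nat set \<Rightarrow> (nat \<times> nat) list" where
  "diagonal_word I J = zip (sorted_list_of_set I) (sorted_list_of_set J)"

text \<open>The degree is fixed along with the weight, so reduction to normal form does not raise
  it; dimensions are later counted in bounded degree.\<close>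

definition lower_polys :: "nat \<Rightarrow> nat \<Rightarrow> nat \<Rightarrow> 'k::field ncpoly set" where
  "lower_polys n d m = {g. Poly_Mapping.keys g \<subseteq> {w \<in> lists (letters n). length w = d \<and> word_weight_ij w < m}}"

lemma lower_add: "f \<in> lower_polys n d m \<Longrightarrow> g \<in> lower_polys n d m \<Longrightarrow> f + g \<in> lower_polys n d m"
  using Poly_Mapping.keys_add[of f g] unfolding lower_polys_def by blast

lemma lower_0: "0 \<in> lower_polys n d m" by (simp add: lower_polys_def)

lemma lower_single: "w \<in> lists (letters n) \<Longrightarrow> length w = d \<Longrightarrow> word_weight_ij w < m \<Longrightarrow>
    Poly_Mapping.single w c \<in> lower_polys n d m"
  by (auto simp: lower_polys_def)

lemma lower_sum: "(\<And>i. i \<in> A \<Longrightarrow> f i \<in> lower_polys n d m) \<Longrightarrow> (\<Sum>i\<in>A. f i) \<in> lower_polys n d m"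
  by (induction A rule: infinite_finite_induct) (auto intro: lower_0 lower_add)

lemma lower_uminus: "f \<in> lower_polys n d m \<Longrightarrow> - f \<in> lower_polys n d m"
  by (simp add: lower_polys_def)

lemma lower_single_mult:
  assumes "g \<in> lower_polys n d m" "v \<in> lists (letters n)"
  shows "Poly_Mapping.single v c * g \<in> lower_polys n (length v + d) (word_weight_ij v + m)"
    "g * Poly_Mapping.single v c \<in> lower_polys n (d + length v) (m + word_weight_ij v)"
proof -
  show "Poly_Mapping.single v c * g \<in> lower_polys n (length v + d) (word_weight_ij v + m)"
    unfolding lower_polys_def
  proof (rule CollectI, rule subsetI)
    fix w assume "w \<in> Poly_Mapping.keys (Poly_Mapping.single v c * g)"
    then obtain a b where "w = a + b" "a \<in> Poly_Mapping.keys (Poly_Mapping.single v c)" "b \<in> Poly_Mapping.keys g"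
      using Poly_Mapping.keys_mult by blast
    then have "w = v @ b" "b \<in> Poly_Mapping.keys g" by (auto simp: plus_list_def split: if_splits)
    then show "w \<in> {w \<in> lists (letters n). length w = length v + d \<and> word_weight_ij w < word_weight_ij v + m}"
      using assms by (auto simp: lower_polys_def)
  qed
next
  show "g * Poly_Mapping.single v c \<in> lower_polys n (d + length v) (m + word_weight_ij v)"
    unfolding lower_polys_def
  proof (rule CollectI, rule subsetI)
    fix w assume "w \<in> Poly_Mapping.keys (g * Poly_Mapping.single v c)"
    then obtain a b where "w = a + b" "b \<in> Poly_Mapping.keys (Poly_Mapping.single v c)" "a \<in> Poly_Mapping.keys g"
      using Poly_Mapping.keys_mult by blast
    then have "w = a @ v" "a \<in> Poly_Mapping.keys g" by (auto simp: plus_list_def split: if_splits)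
    then show "w \<in> {w \<in> lists (letters n). length w = d + length v \<and> word_weight_ij w < m + word_weight_ij v}"
      using assms by (auto simp: lower_polys_def)
  qed
qed

text \<open>The order of the letters is left to choice: words with the same letters agree up to a
  scalar and lighter terms.\<close>

definition word_rep :: "(nat \<times> nat) multiset \<Rightarrow> (nat \<times> nat) list" where
  "word_rep A = (SOME w. mset w = A)"

lemma mset_word_rep [simp]: "mset (word_rep A) = A"
  unfolding word_rep_def by (rule someI_ex) (rule ex_mset)

lemma minor_poly_sum:
  "minor_poly (q::'k::field) I J = (\<Sum>\<sigma> | \<sigma> permutes {..<card I}. Poly_Mapping.single
     (map (\<lambda>r. (sorted_list_of_set I ! r, sorted_list_of_set J ! \<sigma> r)) [0..<card I]) ((- q) ^ perm_length (card I) \<sigma>))"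
proof -
  have "(\<Prod>r\<leftarrow>rs. X (a r) (b r)) = Poly_Mapping.single (map (\<lambda>r. (a r, b r)) rs) (1::'k)" for a b and rs :: "nat list"
    by (induction rs) (simp_all add: X_def mult_single plus_list_def zero_list_def flip: single_one)
  then show ?thesis by (simp add: minor_poly_def const_mult)
qed

text \<open>\<open>K\<close> is kept abstract because normal forms are taken both modulo the ideal
  generated by the bad minors and modulo the kernel of the evaluation.\<close>

locale minor_quotient =
  fixes n :: nat and q :: "'k::field" and K :: "'k ncpoly set" and bad :: "(nat set \<times> nat set) set"
  assumes q: "q \<noteq> 0" and K: "ideal K (free_algebra n)" and rels: "quantum_relations n q \<subseteq> K"
    and minors: "(I, J) \<in> bad \<Longrightarrow> minor_poly q I J \<in> K"
    and bad: "(I, J) \<in> bad \<Longrightarrow> I \<subseteq> {1..n} \<and> J \<subseteq> {1..n} \<and> card I = card J"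
begin

abbreviation "word w \<equiv> Poly_Mapping.single w (1::'k)"

lemma K_add: "f \<in> K \<Longrightarrow> g \<in> K \<Longrightarrow> f + g \<in> K"
  using additive_subgroup.a_closed[OF ideal.axioms(1)[OF K]] by simp

lemma K_left: "f \<in> K \<Longrightarrow> Poly_Mapping.keys g \<subseteq> lists (letters n) \<Longrightarrow> g * f \<in> K"
  using ideal.I_l_closed[OF K, of f g] by (simp add: letters_def)

lemma K_right: "f \<in> K \<Longrightarrow> Poly_Mapping.keys g \<subseteq> lists (letters n) \<Longrightarrow> f * g \<in> K"
  using ideal.I_r_closed[OF K, of f g] by (simp add: letters_def)

lemma K_0: "0 \<in> K"
  using additive_subgroup.zero_closed[OF ideal.axioms(1)[OF K]] by simp

lemma K_const: "f \<in> K \<Longrightarrow> const c * f \<in> K"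
  by (rule K_left) (use keys_const[of c] in auto)

lemma K_uminus: "f \<in> K \<Longrightarrow> - f \<in> K"
proof -
  assume "f \<in> K"
  then have "const (- 1) * f \<in> K" by (rule K_const)
  moreover have "const (- 1) = (- 1 :: 'k ncpoly)"
    by (simp add: const_def zero_list_def[symmetric] single_uminus)
  ultimately show ?thesis by simp
qed

lemma K_sum: "(\<And>i. i \<in> A \<Longrightarrow> f i \<in> K) \<Longrightarrow> (\<Sum>i\<in>A. f i) \<in> K"
  by (induction A rule: infinite_finite_induct) (auto intro: K_0 K_add)

lemma K_rel: "r \<in> quantum_relations n q \<Longrightarrow> r \<in> K" using rels by blast

definition approx :: "(nat \<times> nat) list \<Rightarrow> (nat \<times> nat) list \<Rightarrow> bool" where
  "approx v w \<longleftrightarrow> (\<exists>c. \<exists>g\<in>lower_polys n (length v) (word_weight_ij v).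
     word v - (Poly_Mapping.single w c + g) \<in> K)"

lemma approx_refl: "approx v v"
  unfolding approx_def by (intro exI[of _ 1] bexI[of _ 0]) (simp_all add: K_0 lower_0)

lemma single_const: "const c * Poly_Mapping.single w d = Poly_Mapping.single w (c * d)"
  by (rule const_mult)

lemma approx_trans:
  assumes "approx u v" "approx v w" "mset u = mset v"
  shows "approx u w"
proof -
  obtain c g where g: "g \<in> lower_polys n (length u) (word_weight_ij u)" "word u - (Poly_Mapping.single v c + g) \<in> K"
    using assms(1) unfolding approx_def by blast
  obtain d h where h: "h \<in> lower_polys n (length v) (word_weight_ij v)" "word v - (Poly_Mapping.single w d + h) \<in> K"
    using assms(2) unfolding approx_def by blast
  have "const c * (word v - (Poly_Mapping.single w d + h)) \<in> K" by (rule K_const[OF h(2)])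
  then have "Poly_Mapping.single v c - (Poly_Mapping.single w (c * d) + const c * h) \<in> K"
    by (simp add: right_diff_distrib distrib_left single_const)
  from K_add[OF g(2) this] have "word u - (Poly_Mapping.single w (c * d) + (const c * h + g)) \<in> K"
    by (simp add: algebra_simps)
  moreover have "const c * h \<in> lower_polys n (length u) (word_weight_ij u)"
    using lower_single_mult(1)[OF h(1), of "[]" c] mset_eq_length[OF assms(3)] word_weight_ij_mset[OF assms(3)]
    by (simp add: const_def)
  ultimately show ?thesis unfolding approx_def using lower_add g(1) by blast
qed

lemma approx_left:
  assumes "approx v w" "x \<in> letters n"
  shows "approx (x # v) (x # w)"
proof -
  obtain c g where g: "g \<in> lower_polys n (length v) (word_weight_ij v)" "word v - (Poly_Mapping.single w c + g) \<in> K"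
    using assms(1) unfolding approx_def by blast
  have "word [x] * (word v - (Poly_Mapping.single w c + g)) \<in> K"
    by (rule K_left[OF g(2)]) (use assms in auto)
  then have "word (x # v) - (Poly_Mapping.single (x # w) c + word [x] * g) \<in> K"
    by (simp add: right_diff_distrib distrib_left mult_single plus_list_def)
  moreover have "word [x] * g \<in> lower_polys n (length (x # v)) (word_weight_ij (x # v))"
    using lower_single_mult(1)[OF g(1), of "[x]" 1] assms(2) by simp
  ultimately show ?thesis unfolding approx_def by blast
qed

lemma approx_right:
  assumes "approx v w" "u \<in> lists (letters n)"
  shows "approx (v @ u) (w @ u)"
proof -
  obtain c g where g: "g \<in> lower_polys n (length v) (word_weight_ij v)" "word v - (Poly_Mapping.single w c + g) \<in> K"
    using assms(1) unfolding approx_def by blast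
  have "(word v - (Poly_Mapping.single w c + g)) * word u \<in> K"
    by (rule K_right[OF g(2)]) (use assms in auto)
  then have "word (v @ u) - (Poly_Mapping.single (w @ u) c + g * word u) \<in> K"
    by (simp add: left_diff_distrib distrib_right mult_single plus_list_def)
  moreover have "g * word u \<in> lower_polys n (length (v @ u)) (word_weight_ij (v @ u))"
    using lower_single_mult(2)[OF g(1) assms(2), of 1] by simp
  ultimately show ?thesis unfolding approx_def by blast
qed

lemma approx_swapI:
  assumes "word [x, y] - Poly_Mapping.single [y, x] c \<in> K"
  shows "approx [x, y] [y, x]"
  unfolding approx_def using assms by (intro exI[of _ c] bexI[of _ 0]) (simp_all add: lower_0)

lemma scaled_relation:
  assumes "word v - Poly_Mapping.single w q \<in> K"
  shows "word w - Poly_Mapping.single v (inverse q) \<in> K"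
proof -
  have "const (- inverse q) * (word v - Poly_Mapping.single w q) \<in> K" by (rule K_const[OF assms])
  then show ?thesis using q
    by (simp add: right_diff_distrib single_const single_uminus)
qed

lemma approx_swap:
  assumes "x \<in> letters n" "y \<in> letters n"
  shows "approx [x, y] [y, x]"
proof -
  obtain i j l m where xy: "x = (i, j)" "y = (l, m)" by (metis surj_pair)
  have r: "i \<in> {1..n}" "j \<in> {1..n}" "l \<in> {1..n}" "m \<in> {1..n}" using assms by (auto simp: xy letters_def)
  note expand = X_def mult_single plus_list_def mult.assoc const_mult
  have col: "word [(i, j), (l, j)] - Poly_Mapping.single [(l, j), (i, j)] q \<in> K"
    if "i < l" "i \<in> {1..n}" "l \<in> {1..n}" "j \<in> {1..n}" for i j l
  proof -
    have "X i j * X l j - const q * X l j * X i j \<in> K"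
      by (intro K_rel quantum_relations_intros(1)[where m = j] that)
    then show ?thesis by (simp add: expand)
  qed
  have row: "word [(i, j), (i, m)] - Poly_Mapping.single [(i, m), (i, j)] q \<in> K"
    if "j < m" "i \<in> {1..n}" "m \<in> {1..n}" "j \<in> {1..n}" for i j m
  proof -
    have "X i j * X i m - const q * X i m * X i j \<in> K"
      by (intro K_rel quantum_relations_intros(2)[where l = i] that)
    then show ?thesis by (simp add: expand)
  qed
  have anti: "word [(i, j), (l, m)] - word [(l, m), (i, j)] \<in> K"
    if "i < l" "m < j" "i \<in> {1..n}" "l \<in> {1..n}" "m \<in> {1..n}" "j \<in> {1..n}" for i j l m
  proof -
    have "X i j * X l m - X l m * X i j \<in> K" by (intro K_rel quantum_relations_intros(3) that)
    then show ?thesis by (simp add: expand)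
  qed
  have diag: "word [(i, j), (l, m)] - word [(l, m), (i, j)] - Poly_Mapping.single [(i, m), (l, j)] (q - inverse q) \<in> K"
    if "i < l" "j < m" "i \<in> {1..n}" "l \<in> {1..n}" "m \<in> {1..n}" "j \<in> {1..n}" for i j l m
  proof -
    have "X i j * X l m - X l m * X i j - const (q - inverse q) * X i m * X l j \<in> K"
      by (intro K_rel quantum_relations_intros(4) that)
    then show ?thesis by (simp add: expand)
  qed
  \<comment> \<open>The difference of the two sides is \<open>(l - i) * (m - j)\<close>.\<close>
  have wt: "i * m + l * j < i * j + l * m" if il: "i < l" and jm: "j < m" for i j l m :: nat
  proof -
    obtain d where d: "l = Suc (i + d)" using il less_imp_Suc_add by blast
    have "Suc d * j < Suc d * m" using jm by (rule mult_less_mono2) simp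
    moreover have "l * j = i * j + Suc d * j" "l * m = i * m + Suc d * m"
      by (simp_all only: d add_Suc_right[symmetric] distrib_right)
    ultimately show ?thesis by linarith
  qed
  consider "i = l" "j = m" | "i = l" "j < m" | "i = l" "m < j" | "j = m" "i < l" | "j = m" "l < i"
    | "i < l" "m < j" | "l < i" "j < m" | "i < l" "j < m" | "l < i" "m < j" by linarith
  then show ?thesis
  proof cases
    case 1
    then show ?thesis using approx_refl xy by simp
  next
    case 2
    then show ?thesis using row[of j m i] r xy by (intro approx_swapI[of _ _ q]) simp
  next
    case 3
    then show ?thesis using scaled_relation[OF row[of m j i]] r xy by (intro approx_swapI[of _ _ "inverse q"]) simp
  next
    case 4
    then show ?thesis using col[of i l j] r xy by (intro approx_swapI[of _ _ q]) simp
  next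
    case 5
    then show ?thesis using scaled_relation[OF col[of l i j]] r xy by (intro approx_swapI[of _ _ "inverse q"]) simp
  next
    case 6
    then show ?thesis using anti[of i l m j] r xy by (intro approx_swapI[of _ _ 1]) simp
  next
    case 7
    then show ?thesis using K_uminus[OF anti[of l i j m]] r xy by (intro approx_swapI[of _ _ 1]) simp
  next
    case 8
    show ?thesis unfolding approx_def
    proof (intro exI bexI)
      show "word [x, y] - (Poly_Mapping.single [y, x] 1 + Poly_Mapping.single [(i, m), (l, j)] (q - inverse q)) \<in> K"
        using diag[of i l j m] 8 r xy by (simp add: algebra_simps)
      show "Poly_Mapping.single [(i, m), (l, j)] (q - inverse q) \<in> lower_polys n (length [x, y]) (word_weight_ij [x, y])"
        using wt[of i l j m] 8 r xy by (intro lower_single) (auto simp: letters_def)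
    qed
  next
    case 9
    show ?thesis unfolding approx_def
    proof (intro exI bexI)
      show "word [x, y] - (Poly_Mapping.single [y, x] 1 + - Poly_Mapping.single [(l, j), (i, m)] (q - inverse q)) \<in> K"
        using K_uminus[OF diag[of l i m j]] 9 r xy by (simp add: algebra_simps)
      show "- Poly_Mapping.single [(l, j), (i, m)] (q - inverse q) \<in> lower_polys n (length [x, y]) (word_weight_ij [x, y])"
        using wt[of l i m j] 9 r xy by (intro lower_uminus lower_single) (auto simp: letters_def)
    qed
  qed
qed

lemma approx_move: "set p \<subseteq> letters n \<Longrightarrow> x \<in> letters n \<Longrightarrow> s \<in> lists (letters n) \<Longrightarrow> approx (x # p @ s) (p @ x # s)"
proof (induction p)
  case (Cons a p)
  have "approx ([x, a] @ (p @ s)) ([a, x] @ (p @ s))"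
    using Cons.prems by (intro approx_right approx_swap) auto
  moreover have "approx (a # x # p @ s) (a # p @ x # s)"
    using Cons by (intro approx_left) auto
  ultimately show ?case using approx_trans[of "x # a # p @ s" "a # x # p @ s"] by simp
qed (simp add: approx_refl)

lemma approx_perm: "set v \<subseteq> letters n \<Longrightarrow> mset v = mset w \<Longrightarrow> approx v w"
proof (induction v arbitrary: w)
  case Nil
  then show ?case by (simp add: approx_refl)
next
  case (Cons x v)
  have "x \<in> set w" using Cons.prems(2) by (metis list.set_intros(1) set_mset_mset)
  then obtain p s where w: "w = p @ x # s" by (meson split_list)
  then have m: "mset v = mset (p @ s)" using Cons.prems(2) by simp
  then have "set (p @ s) \<subseteq> letters n" using Cons.prems(1) by (metis set_mset_mset set_subset_Cons subset_trans)
  then have "approx (x # p @ s) (p @ x # s)" using Cons.prems(1) by (intro approx_move) auto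
  moreover have "approx (x # v) (x # p @ s)" using Cons.IH[OF _ m] Cons.prems(1) by (intro approx_left) auto
  ultimately show ?case using approx_trans[of "x # v" "x # p @ s" w] m by (simp add: w)
qed

definition standard :: "(nat \<times> nat) multiset \<Rightarrow> bool" where
  "standard A \<longleftrightarrow> set_mset A \<subseteq> letters n \<and> (\<forall>(I, J)\<in>bad. \<not> mset (diagonal_word I J) \<subseteq># A)"

lemma bad_diagonal:
  assumes IJ: "(I, J) \<in> bad"
  shows "\<exists>g\<in>lower_polys n (length (diagonal_word I J)) (word_weight_ij (diagonal_word I J)).
    word (diagonal_word I J) - g \<in> K"
proof -
  let ?s = "card I" and ?D = "diagonal_word I J"
  let ?x = "\<lambda>r. sorted_list_of_set I ! r" and ?y = "\<lambda>r. sorted_list_of_set J ! r"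
  have fin: "finite I" "finite J" "card J = ?s" using bad[OF IJ] by (auto intro: finite_subset)
  define W where "W \<sigma> = map (\<lambda>r. (?x r, ?y (\<sigma> r))) [0..<?s]" for \<sigma>
  let ?P = "{\<sigma>. \<sigma> permutes {..<?s}}"
  let ?g = "\<Sum>\<sigma>\<in>?P - {id}. Poly_Mapping.single (W \<sigma>) ((- q) ^ perm_length ?s \<sigma>)"
  have D: "?D = W id" using fin by (intro nth_equalityI) (simp_all add: diagonal_word_def W_def)
  have "minor_poly q I J = (\<Sum>\<sigma>\<in>?P. Poly_Mapping.single (W \<sigma>) ((- q) ^ perm_length ?s \<sigma>))"
    by (simp add: minor_poly_sum W_def)
  also have "\<dots> = word ?D + ?g"
    by (subst sum.remove[of _ id]) (simp_all add: finite_permutations permutes_id perm_length_id D)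
  finally have "word ?D - - ?g \<in> K" using minors[OF IJ] by simp
  moreover have "?g \<in> lower_polys n (length ?D) (word_weight_ij ?D)"
  proof (intro lower_sum lower_single)
    fix \<sigma> assume "\<sigma> \<in> ?P - {id}"
    then have \<sigma>: "\<sigma> permutes {..<?s}" "\<sigma> \<noteq> id" by auto
    have im: "\<sigma> r < ?s" if "r < ?s" for r using permutes_in_image[OF \<sigma>(1)] that by simp
    have "(?x r, ?y (\<sigma> r)) \<in> letters n" if "r < ?s" for r
    proof -
      have "?x r \<in> I" "?y (\<sigma> r) \<in> J"
        using that im[OF that] fin nth_mem[of r "sorted_list_of_set I"] nth_mem[of "\<sigma> r" "sorted_list_of_set J"]
        by simp_all
      then show ?thesis using bad[OF IJ] unfolding letters_def by blast
    qed
    then show "W \<sigma> \<in> lists (letters n)" by (auto simp: W_def)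
    show "length (W \<sigma>) = length ?D" by (simp add: D W_def)
    have wt: "word_weight_ij (W \<tau>) = (\<Sum>r<?s. ?x r * ?y (\<tau> r))" for \<tau>
      by (simp add: word_weight_ij_def W_def comp_def interv_sum_list_conv_sum_set_nat atLeast0LessThan)
    show "word_weight_ij (W \<sigma>) < word_weight_ij ?D"
      unfolding D wt id_apply
    proof (rule rearrangement[OF \<sigma>])
      show "?x r < ?x (Suc r)" if "Suc r < ?s" for r
        using that sorted_wrt_nth_less[OF strict_sorted_list_of_set[of I]] fin by simp
      show "?y r < ?y r'" if "r < r'" "r' < ?s" for r r'
        using that sorted_wrt_nth_less[OF strict_sorted_list_of_set[of J]] fin by simp
    qed
  qed
  ultimately show ?thesis using lower_uminus by blast
qed

definition standard_polys :: "nat \<Rightarrow> 'k ncpoly set" where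
  "standard_polys d = {g. Poly_Mapping.keys g \<subseteq> word_rep ` {A. standard A \<and> size A = d}}"

lemma standard_polys_add: "f \<in> standard_polys d \<Longrightarrow> g \<in> standard_polys d \<Longrightarrow> f + g \<in> standard_polys d"
  using Poly_Mapping.keys_add[of f g] unfolding standard_polys_def by blast

lemma standard_polys_0: "0 \<in> standard_polys d" by (simp add: standard_polys_def)

lemma standard_polys_const: "f \<in> standard_polys d \<Longrightarrow> const c * f \<in> standard_polys d"
proof -
  assume "f \<in> standard_polys d"
  moreover have "Poly_Mapping.keys (const c * f) \<subseteq> Poly_Mapping.keys f"
    using Poly_Mapping.keys_mult[of "const c" f] keys_const[of c] by (fastforce simp: plus_list_def)
  ultimately show ?thesis by (auto simp: standard_polys_def)
qed

lemma standard_polys_sum: "(\<And>i. i \<in> A \<Longrightarrow> f i \<in> standard_polys d) \<Longrightarrow> (\<Sum>i\<in>A. f i) \<in> standard_polys d"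
  by (induction A rule: infinite_finite_induct) (auto intro: standard_polys_add standard_polys_0)

lemma normal_form_linear:
  assumes "\<And>w. w \<in> Poly_Mapping.keys f \<Longrightarrow> \<exists>g\<in>standard_polys d. word w - g \<in> K"
  shows "\<exists>g\<in>standard_polys d. f - g \<in> K"
proof -
  obtain G where G: "\<And>w. w \<in> Poly_Mapping.keys f \<Longrightarrow> G w \<in> standard_polys d \<and> word w - G w \<in> K"
    using assms by metis
  let ?c = "\<lambda>w. const (Poly_Mapping.lookup f w) :: 'k ncpoly"
  let ?g = "\<Sum>w\<in>Poly_Mapping.keys f. ?c w * G w"
  have "?g \<in> standard_polys d" using G by (intro standard_polys_sum standard_polys_const) auto
  moreover have "(\<Sum>w\<in>Poly_Mapping.keys f. ?c w * (word w - G w)) \<in> K"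
    using G by (intro K_sum K_const) auto
  moreover have "(\<Sum>w\<in>Poly_Mapping.keys f. ?c w * (word w - G w)) = f - ?g"
    using sum_singles[of f] by (simp add: right_diff_distrib sum_subtractf single_const)
  ultimately show ?thesis by auto
qed

text \<open>Induction on the weight. A word with standard letters is rearranged into its
  representative; any other word is rearranged so that the diagonal of a bad minor comes first, and
  the minor expresses this diagonal by lighter words.\<close>

lemma normal_form_word:
  "w \<in> lists (letters n) \<Longrightarrow> \<exists>g\<in>standard_polys (length w). word w - g \<in> K"
proof (induction "word_weight_ij w" arbitrary: w rule: less_induct)
  case less
  have lower: "\<exists>g\<in>standard_polys (length w). f - g \<in> K"
    if "f \<in> lower_polys n (length w) (word_weight_ij w)" for f
  proof (rule normal_form_linear)
    fix v assume "v \<in> Poly_Mapping.keys f"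
    then have "v \<in> lists (letters n)" "length v = length w" "word_weight_ij v < word_weight_ij w"
      using that by (auto simp: lower_polys_def)
    then show "\<exists>g\<in>standard_polys (length w). word v - g \<in> K" using less.hyps[of v] by simp
  qed
  have set: "set w \<subseteq> letters n" using less.prems by auto
  show ?case
  proof (cases "standard (mset w)")
    case True
    have "approx w (word_rep (mset w))" by (rule approx_perm[OF set]) simp
    then obtain c f where f: "f \<in> lower_polys n (length w) (word_weight_ij w)"
      "word w - (Poly_Mapping.single (word_rep (mset w)) c + f) \<in> K" unfolding approx_def by blast
    obtain g where g: "g \<in> standard_polys (length w)" "f - g \<in> K" using lower[OF f(1)] by blast
    have "word w - (Poly_Mapping.single (word_rep (mset w)) c + g) \<in> K"
      using K_add[OF f(2) g(2)] by (simp add: algebra_simps)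
    moreover have "Poly_Mapping.single (word_rep (mset w)) c \<in> standard_polys (length w)"
      using True by (auto simp: standard_polys_def)
    ultimately show ?thesis using g(1) standard_polys_add by blast
  next
    case False
    then obtain I J where IJ: "(I, J) \<in> bad" "mset (diagonal_word I J) \<subseteq># mset w"
      using set by (auto simp: standard_def)
    let ?D = "diagonal_word I J"
    obtain r where r: "mset w = mset (?D @ r)" using IJ(2) by (metis ex_mset mset_append subset_mset.add_diff_inverse)
    have rl: "r \<in> lists (letters n)" using set r by (metis in_listsI mset_eq_setD set_append Un_iff subsetD)
    obtain c f where f: "f \<in> lower_polys n (length w) (word_weight_ij w)"
      "word w - (Poly_Mapping.single (?D @ r) c + f) \<in> K"
      using approx_perm[OF set r] unfolding approx_def by blast
    obtain h where h: "h \<in> lower_polys n (length ?D) (word_weight_ij ?D)" "word ?D - h \<in> K"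
      using bad_diagonal[OF IJ(1)] by blast
    have "(word ?D - h) * Poly_Mapping.single r c \<in> K" by (rule K_right[OF h(2)]) (use rl in auto)
    then have "Poly_Mapping.single (?D @ r) c - h * Poly_Mapping.single r c \<in> K"
      by (simp add: left_diff_distrib mult_single plus_list_def)
    from K_add[OF f(2) this] have 1: "word w - (h * Poly_Mapping.single r c + f) \<in> K"
      by (simp add: algebra_simps)
    have "h * Poly_Mapping.single r c \<in> lower_polys n (length w) (word_weight_ij w)"
      using lower_single_mult(2)[OF h(1) rl, of c] mset_eq_length[OF r] word_weight_ij_mset[OF r] by simp
    then have "h * Poly_Mapping.single r c + f \<in> lower_polys n (length w) (word_weight_ij w)"
      using f(1) by (rule lower_add)
    then obtain g where g: "g \<in> standard_polys (length w)" "h * Poly_Mapping.single r c + f - g \<in> K"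
      using lower by blast
    have "word w - g \<in> K" using K_add[OF 1 g(2)] by simp
    then show ?thesis using g(1) by blast
  qed
qed

lemma normal_form:
  assumes "Poly_Mapping.keys f \<subseteq> {w \<in> lists (letters n). length w \<le> d}"
  shows "\<exists>g. Poly_Mapping.keys g \<subseteq> word_rep ` {A. standard A \<and> size A \<le> d} \<and> f - g \<in> K"
proof -
  have "\<exists>g. Poly_Mapping.keys g \<subseteq> word_rep ` {A. standard A \<and> size A \<le> d} \<and> word w - g \<in> K"
    if "w \<in> Poly_Mapping.keys f" for w
  proof -
    have w: "w \<in> lists (letters n)" "length w \<le> d" using assms that by auto
    obtain g where "g \<in> standard_polys (length w)" "word w - g \<in> K" using normal_form_word[OF w(1)] by blast
    then show ?thesis using w(2) by (intro exI[of _ g]) (auto simp: standard_polys_def)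
  qed
  then have "\<forall>w\<in>Poly_Mapping.keys f. \<exists>g. Poly_Mapping.keys g \<subseteq> word_rep ` {A. standard A \<and> size A \<le> d} \<and>
      word w - g \<in> K" by blast
  from bchoice[OF this] obtain G where G: "\<And>w. w \<in> Poly_Mapping.keys f \<Longrightarrow>
      Poly_Mapping.keys (G w) \<subseteq> word_rep ` {A. standard A \<and> size A \<le> d} \<and> word w - G w \<in> K" by blast
  let ?c = "\<lambda>w. const (Poly_Mapping.lookup f w) :: 'k ncpoly"
  let ?g = "\<Sum>w\<in>Poly_Mapping.keys f. ?c w * G w"
  have "Poly_Mapping.keys ?g \<subseteq> (\<Union>w\<in>Poly_Mapping.keys f. Poly_Mapping.keys (?c w * G w))"
    by (rule keys_sum)
  also have "\<dots> \<subseteq> word_rep ` {A. standard A \<and> size A \<le> d}"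
  proof -
    have "Poly_Mapping.keys (?c w * G w) \<subseteq> Poly_Mapping.keys (G w)" for w
      using Poly_Mapping.keys_mult[of "?c w" "G w"] keys_const[of "Poly_Mapping.lookup f w"] by (fastforce simp: plus_list_def)
    then show ?thesis using G by blast
  qed
  finally have "Poly_Mapping.keys ?g \<subseteq> word_rep ` {A. standard A \<and> size A \<le> d}" .
  moreover have "(\<Sum>w\<in>Poly_Mapping.keys f. ?c w * (word w - G w)) \<in> K"
    using G by (intro K_sum K_const) auto
  moreover have "(\<Sum>w\<in>Poly_Mapping.keys f. ?c w * (word w - G w)) = f - ?g"
    using sum_singles[of f] by (simp add: right_diff_distrib sum_subtractf single_const)
  ultimately show ?thesis by auto
qed

end

section \<open>The kernel of the evaluation map\<close>

lemma has_lead_unique: "has_lead W F u \<Longrightarrow> has_lead W F v \<Longrightarrow> u = v"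
proof -
  assume "has_lead W F u" "has_lead W F v"
  then have "v = u \<or> W v < W u" "u = v \<or> W u < W v" unfolding has_lead_def by blast+
  then show ?thesis by auto
qed

text \<open>A linear dependence among the \<open>w A\<close> would put the independent vectors
  \<open>F A\<close>, as many as \<open>D\<close> has elements, into the span of fewer
  vectors.\<close>

lemma spanning_family_independent:
  fixes F w :: "'a \<Rightarrow> (expo, 'k::field) operator"
  assumes D: "finite D" and lead: "\<And>A. A \<in> D \<Longrightarrow> has_lead W (F A) (e A)" and inj: "inj_on e D"
    and span: "\<And>A. A \<in> D \<Longrightarrow> F A \<in> operator_space.span (w ` D)"
    and zero: "(\<Sum>A\<in>D. scal (c A) * w A) = 0" and A: "A \<in> D"
  shows "c A = 0"
proof (rule ccontr)
  assume cA: "c A \<noteq> 0"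
  have injF: "inj_on F D"
  proof (rule inj_onI)
    fix B B' assume B: "B \<in> D" "B' \<in> D" "F B = F B'"
    have "has_lead W (F B) (e B')" using lead[OF B(2)] by (simp only: B(3))
    then have "e B = e B'" using has_lead_unique lead[OF B(1)] by blast
    then show "B = B'" using inj B(1,2) by (simp add: inj_on_def)
  qed
  have ind: "operator_space.independent (F ` D)"
  proof (rule operator_space.independent_if_scalars_zero)
    fix d x assume d: "(\<Sum>x\<in>F ` D. scal (d x) * x) = 0" and x: "x \<in> F ` D"
    obtain B where B: "B \<in> D" "x = F B" using x by blast
    have "(\<Sum>B\<in>D. scal (d (F B)) * F B) = 0" using d by (simp add: sum.reindex[OF injF])
    then show "d x = 0" using independent_leads[OF D lead inj _ B(1), of "\<lambda>B. d (F B)"] B(2) by simp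
  qed (use D in simp)
  let ?D = "D - {A}"
  have "scal (c A) * w A = - (\<Sum>B\<in>?D. scal (c B) * w B)"
    using zero by (simp add: sum.remove[OF D A] eq_neg_iff_add_eq_0)
  then have "scal (inverse (c A)) * (scal (c A) * w A) = scal (inverse (c A)) * - (\<Sum>B\<in>?D. scal (c B) * w B)"
    by (simp only:)
  then have "w A = scal (inverse (c A)) * - (\<Sum>B\<in>?D. scal (c B) * w B)"
    using cA by simp
  moreover have "(\<Sum>B\<in>?D. scal (c B) * w B) \<in> operator_space.span (w ` ?D)"
    by (intro operator_space.span_sum operator_space.span_scale operator_space.span_base) auto
  ultimately have "w A \<in> operator_space.span (w ` ?D)"
    by (simp only: operator_space.span_scale operator_space.span_neg)
  then have "w ` D \<subseteq> operator_space.span (w ` ?D)"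
    using operator_space.span_superset[of "w ` ?D"] by blast
  then have "operator_space.span (w ` D) \<subseteq> operator_space.span (w ` ?D)"
    by (rule operator_space.span_minimal[OF _ operator_space.subspace_span])
  then have "F ` D \<subseteq> operator_space.span (w ` ?D)" using span by blast
  moreover have "finite (w ` ?D)" using D by simp
  ultimately have "card (F ` D) \<le> card (w ` ?D)"
    using operator_space.independent_span_bound ind by blast
  also have "\<dots> \<le> card ?D" using D by (intro card_image_le) simp
  also have "\<dots> < card D" using D A by (intro psubset_card_mono) auto
  finally show False using card_image[OF injF] by simp
qed

section \<open>Columns counted from the right\<close>

definition reflect_if :: "bool \<Rightarrow> nat \<Rightarrow> nat \<Rightarrow> nat" where
  "reflect_if b n j = (if b then Suc n - j else j)"

definition reflect_list_if :: "bool \<Rightarrow> nat \<Rightarrow> nat list \<Rightarrow> nat list" where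
  "reflect_list_if b n ys = (if b then reflect_index n ys else ys)"

lemma length_reflect_list_if [simp]: "length (reflect_list_if b n ys) = length ys"
  by (simp add: reflect_list_if_def reflect_index_def)

lemma set_reflect_list_if [simp]: "set (reflect_list_if b n ys) = reflect_if b n ` set ys"
  by (auto simp: reflect_list_if_def reflect_index_def reflect_if_def)

lemma reflect_if_in: "j \<in> {1..n} \<Longrightarrow> reflect_if b n j \<in> {1..n}"
  by (auto simp: reflect_if_def)

lemma reflect_if_reflect_if: "j \<in> {1..n} \<Longrightarrow> reflect_if b n (reflect_if b n j) = j"
  by (auto simp: reflect_if_def)

lemma reflect_list_if_twice:
  "valid_index n ys \<Longrightarrow> reflect_list_if b n (reflect_list_if b n ys) = ys"
  by (cases b) (auto simp: reflect_list_if_def reflect_index_def valid_index_def rev_map comp_def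
      intro!: map_idI)

lemma valid_index_reflect:
  assumes ys: "valid_index n ys"
  shows "valid_index n (reflect_list_if b n ys)"
proof (cases b)
  case True
  show ?thesis
  proof (rule valid_indexI)
    fix r assume "Suc r < length (reflect_list_if b n ys)"
    then have r: "Suc r < length ys" by simp
    then have "ys ! (length ys - Suc (Suc r)) < ys ! (length ys - Suc r)"
      by (intro valid_index_less[OF ys]) auto
    moreover have "ys ! (length ys - Suc r) \<le> n" using valid_index_range[OF ys, of "length ys - Suc r"] r by simp
    ultimately show "reflect_list_if b n ys ! r < reflect_list_if b n ys ! Suc r"
      using True r by (simp add: reflect_list_if_def reflect_nth)
  next
    fix r assume "r < length (reflect_list_if b n ys)"
    then have "reflect_list_if b n ys ! r \<in> set (reflect_list_if b n ys)" by (rule nth_mem)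
    then obtain j where "j \<in> set ys" "reflect_list_if b n ys ! r = reflect_if b n j" by auto
    then show "1 \<le> reflect_list_if b n ys ! r \<and> reflect_list_if b n ys ! r \<le> n"
      using ys reflect_if_in[of j n b] by (auto simp: valid_index_def)
  qed
qed (use ys in \<open>simp add: reflect_list_if_def\<close>)

lemma sorted_list_of_valid_index: "valid_index n xs \<Longrightarrow> sorted_list_of_set (set xs) = xs"
  by (simp add: valid_index_def strict_sorted_iff sorted_list_of_set.idem_if_sorted_distinct)

lemma valid_sorted_list_of_set: "I \<subseteq> {1..n} \<Longrightarrow> valid_index n (sorted_list_of_set I)"
  by (simp add: valid_index_def finite_subset)

lemma keys_prod_list_lengths:
  assumes "\<And>x. x \<in> set xs \<Longrightarrow> Poly_Mapping.keys (p x :: 'k::field ncpoly) \<subseteq> {w \<in> lists L. length w = s x}"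
  shows "Poly_Mapping.keys (\<Prod>x\<leftarrow>xs. p x) \<subseteq> {w \<in> lists L. length w = (\<Sum>x\<leftarrow>xs. s x)}"
  using assms
proof (induction xs)
  case Nil
  show ?case by (simp add: zero_list_def)
next
  case (Cons x xs)
  have x: "Poly_Mapping.keys (p x) \<subseteq> {w \<in> lists L. length w = s x}" using Cons.prems by simp
  have xs: "Poly_Mapping.keys (\<Prod>x\<leftarrow>xs. p x) \<subseteq> {w \<in> lists L. length w = (\<Sum>x\<leftarrow>xs. s x)}"
    using Cons by simp
  show ?case
  proof
    fix w assume "w \<in> Poly_Mapping.keys (\<Prod>x\<leftarrow>x # xs. p x)"
    then have "w \<in> Poly_Mapping.keys (p x * (\<Prod>x\<leftarrow>xs. p x))" by simp
    then obtain u v where uv: "w = u + v" "u \<in> Poly_Mapping.keys (p x)" "v \<in> Poly_Mapping.keys (\<Prod>x\<leftarrow>xs. p x)"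
      using Poly_Mapping.keys_mult by blast
    have "u \<in> {w \<in> lists L. length w = s x}" using x uv(2) by (rule subsetD)
    moreover have "v \<in> {w \<in> lists L. length w = (\<Sum>x\<leftarrow>xs. s x)}" using xs uv(3) by (rule subsetD)
    ultimately show "w \<in> {w \<in> lists L. length w = (\<Sum>x\<leftarrow>x # xs. s x)}" by (simp add: uv(1) plus_list_def)
  qed
qed

text \<open>The ideal is formed in the free algebra and contains the defining relations, so that
  polynomials can be evaluated directly; the quotient is taken at the very end.\<close>

definition minor_ideal :: "nat \<Rightarrow> 'k::field \<Rightarrow> (nat set \<times> nat set) set \<Rightarrow> 'k ncpoly set" where
  "minor_ideal n q bad = Idl\<^bsub>free_algebra n\<^esub> (quantum_relations n q \<union> (\<lambda>(I, J). minor_poly q I J) ` bad)"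

definition index_pairs :: "nat \<Rightarrow> (nat set \<times> nat set) set" where
  "index_pairs n = {(I, J). I \<subseteq> {1..n} \<and> J \<subseteq> {1..n} \<and> card I = card J}"

lemma minor_poly_words:
  assumes "(I, J) \<in> index_pairs n"
  shows "Poly_Mapping.keys (minor_poly (q::'k::field) I J) \<subseteq> {w \<in> lists (letters n). length w = card I}"
proof -
  have fin: "finite I" "finite J" "card J = card I" "I \<subseteq> {1..n}" "J \<subseteq> {1..n}"
    using assms by (auto simp: index_pairs_def intro: finite_subset)
  let ?w = "\<lambda>\<sigma>. map (\<lambda>r. (sorted_list_of_set I ! r, sorted_list_of_set J ! \<sigma> r)) [0..<card I]"
  have "Poly_Mapping.keys (minor_poly q I J) \<subseteq> (\<Union>\<sigma>\<in>{\<sigma>. \<sigma> permutes {..<card I}}. {?w \<sigma>})"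
  proof -
    have "minor_poly q I J = (\<Sum>\<sigma> | \<sigma> permutes {..<card I}. Poly_Mapping.single (?w \<sigma>) ((- q) ^ perm_length (card I) \<sigma>))"
      by (rule minor_poly_sum)
    then have "Poly_Mapping.keys (minor_poly q I J) \<subseteq> (\<Union>\<sigma>\<in>{\<sigma>. \<sigma> permutes {..<card I}}.
        Poly_Mapping.keys (Poly_Mapping.single (?w \<sigma>) ((- q) ^ perm_length (card I) \<sigma>)))"
      by (simp only: keys_sum)
    also have "\<dots> \<subseteq> (\<Union>\<sigma>\<in>{\<sigma>. \<sigma> permutes {..<card I}}. {?w \<sigma>})" by (intro UN_mono) auto
    finally show ?thesis .
  qed
  also have "\<dots> \<subseteq> {w \<in> lists (letters n). length w = card I}"
  proof (intro UN_least)
    fix \<sigma> assume "\<sigma> \<in> {\<sigma>. \<sigma> permutes {..<card I}}"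
    then have \<sigma>: "\<sigma> r < card I" if "r < card I" for r using permutes_in_image[of \<sigma> "{..<card I}" r] that by simp
    have "(sorted_list_of_set I ! r, sorted_list_of_set J ! \<sigma> r) \<in> letters n" if "r < card I" for r
    proof -
      have "sorted_list_of_set I ! r \<in> I" "sorted_list_of_set J ! \<sigma> r \<in> J"
        using that \<sigma>[OF that] fin nth_mem[of r "sorted_list_of_set I"] nth_mem[of "\<sigma> r" "sorted_list_of_set J"]
        by simp_all
      then show ?thesis using fin unfolding letters_def by blast
    qed
    then show "{?w \<sigma>} \<subseteq> {w \<in> lists (letters n). length w = card I}" by auto
  qed
  finally show ?thesis .
qed

lemma minor_poly_carrier: "(I, J) \<in> index_pairs n \<Longrightarrow> minor_poly q I J \<in> carrier (free_algebra n)"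
  using minor_poly_words[of I J n q] by (simp add: letters_def) blast

lemma minor_ideal_generators:
  assumes "bad \<subseteq> index_pairs n"
  shows "quantum_relations n q \<union> (\<lambda>(I, J). minor_poly q I J) ` bad \<subseteq> carrier (free_algebra n)"
proof (rule Un_least[OF quantum_relations_carrier], rule image_subsetI)
  fix x assume "x \<in> bad"
  then have "(fst x, snd x) \<in> index_pairs n" using assms by auto
  then show "(case x of (I, J) \<Rightarrow> minor_poly q I J) \<in> carrier (free_algebra n)"
    unfolding case_prod_beta by (rule minor_poly_carrier)
qed

lemma minor_quotient_minor_ideal:
  assumes "q \<noteq> 0" "bad \<subseteq> index_pairs n"
  shows "minor_quotient n q (minor_ideal n q bad) bad"
proof (rule minor_quotient.intro)
  have self: "quantum_relations n q \<union> (\<lambda>(I, J). minor_poly q I J) ` bad \<subseteq> minor_ideal n q bad"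
    unfolding minor_ideal_def
    by (rule ring.genideal_self[OF ring_free_algebra minor_ideal_generators[OF assms(2)]])
  show "ideal (minor_ideal n q bad) (free_algebra n)"
    unfolding minor_ideal_def
    by (rule ring.genideal_ideal[OF ring_free_algebra minor_ideal_generators[OF assms(2)]])
  show "quantum_relations n q \<subseteq> minor_ideal n q bad" using self by blast
  show "minor_poly q I J \<in> minor_ideal n q bad" if "(I, J) \<in> bad" for I J
    using self that by (force simp: image_iff)
  show "I \<subseteq> {1..n} \<and> J \<subseteq> {1..n} \<and> card I = card J" if "(I, J) \<in> bad" for I J
    using assms(2) that by (auto simp: index_pairs_def)
qed (fact assms(1))

lemma minor_ideal_minimal:
  assumes "ideal K (free_algebra n)" "quantum_relations n q \<subseteq> K" "\<And>I J. (I, J) \<in> bad \<Longrightarrow> minor_poly q I J \<in> K"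
  shows "minor_ideal n q bad \<subseteq> K"
  unfolding minor_ideal_def
  by (rule ring.genideal_minimal[OF ring_free_algebra assms(1)]) (use assms(2,3) in auto)

text \<open>The row indices are distinct, so the diagonal has no repeated letter and it suffices
  that each letter occurs.\<close>

lemma diagonal_word_submset:
  assumes xs: "valid_index n xs" and len: "length xs = length ys"
    and pos: "\<And>k. k < length xs \<Longrightarrow> (xs ! k, ys ! k) \<in># A"
  shows "mset (zip xs ys) \<subseteq># A"
proof -
  have "distinct (zip xs ys)" using xs by (intro distinct_zipI1) (simp add: valid_index_def strict_sorted_iff)
  moreover have "set (zip xs ys) \<subseteq> set_mset A" using pos len by (auto simp: set_zip)
  ultimately show ?thesis
    by (metis finite_set_mset mset_set_set mset_set_set_mset_msubset msubset_mset_set_iff subset_mset.order_trans finite_set)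
qed

text \<open>What is needed to identify the kernel: a growth rule whose rows are governed by the chains of
  the bad minors, and a network whose minors have leading exponents recording the two boundary
  tableaux. With \<open>b\<close> the columns are counted from the right.\<close>

locale minor_model = growth_rule n loc for n loc +
  fixes q :: "'k::field" and f g :: "nat \<Rightarrow> nat" and b :: bool and sts :: "stage list"
    and ex :: "nat list \<Rightarrow> nat list \<Rightarrow> expo" and va vb :: "nat \<Rightarrow> nat \<Rightarrow> nat \<times> nat \<times> bool"
    and bad :: "(nat set \<times> nat set) set"
  assumes q: "q \<noteq> 0" and f_pos: "\<And>r. 1 \<le> f r" and g_pos: "\<And>r. 1 \<le> g r"
    and rel: "\<And>S. Rel S \<in> set sts \<Longrightarrow> increasing_rel S"
    and bad: "bad \<subseteq> index_pairs n"
    and bad_zero: "\<And>I J. (I, J) \<in> bad \<Longrightarrow> net_minor n q sts (sorted_list_of_set I) (sorted_list_of_set J) = 0"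
    and lead: "\<And>xs ys. valid_index n xs \<Longrightarrow> valid_index n ys \<Longrightarrow> length xs = length ys \<Longrightarrow>
      (\<And>r. r < length ys \<Longrightarrow> f r \<le> xs ! r) \<Longrightarrow> (\<And>r. r < length ys \<Longrightarrow> g r \<le> reflect_list_if b n ys ! r) \<Longrightarrow>
      has_lead (net_weight n) (net_minor n q sts xs ys) (ex xs ys)"
    and lookup_va: "\<And>xs ys r j. valid_index n ys \<Longrightarrow> length xs = length ys \<Longrightarrow> j < n \<Longrightarrow>
      Poly_Mapping.lookup (ex xs ys) (va r j) = (if r < length ys \<and> xs ! r \<le> f r + j then 1 else 0)"
    and lookup_vb: "\<And>xs ys r j. valid_index n ys \<Longrightarrow> length xs = length ys \<Longrightarrow> j < n \<Longrightarrow>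
      Poly_Mapping.lookup (ex xs ys) (vb r j) =
        (if r < length ys \<and> g r + j < reflect_list_if b n ys ! r then 1 else 0)"
    and chain: "\<And>N i j r. i \<le> n \<Longrightarrow> j \<le> n \<Longrightarrow> growth loc N i j r > 0 \<Longrightarrow>
      \<exists>xs ys. valid_index n xs \<and> valid_index n ys \<and> length xs = Suc r \<and> length ys = Suc r \<and>
        set xs \<subseteq> {..i} \<and> reflect_if b n ` set ys \<subseteq> {..j} \<and>
        (\<forall>k\<le>r. N (xs ! k) (reflect_if b n (ys ! k)) > 0)"
    and bad_chain: "\<And>xs ys r. valid_index n xs \<Longrightarrow> valid_index n ys \<Longrightarrow> length xs = Suc r \<Longrightarrow> length ys = Suc r \<Longrightarrow>
      set xs \<subseteq> {..<f r} \<or> reflect_if b n ` set ys \<subseteq> {..<g r} \<Longrightarrow>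
      \<exists>(I, J)\<in>bad. mset (diagonal_word I J) \<subseteq># mset (zip xs ys)"
begin

abbreviation "op_net \<equiv> network n q sts"
abbreviation "ker \<equiv> {p \<in> carrier (free_algebra n). eval_op op_net p = 0}"
abbreviation "std \<equiv> minor_quotient.standard n bad"

lemma minor_quotient_ideal: "minor_quotient n q (minor_ideal n q bad) bad"
  by (rule minor_quotient_minor_ideal[OF q bad])

lemma eval_minor: "(I, J) \<in> index_pairs n \<Longrightarrow>
    eval_op op_net (minor_poly q I J) = net_minor n q sts (sorted_list_of_set I) (sorted_list_of_set J)"
  unfolding net_minor_def by (rule eval_op_minor) (auto simp: index_pairs_def intro: finite_subset)

lemma ideal_le_ker: "minor_ideal n q bad \<subseteq> ker"
proof (rule minor_ideal_minimal)
  show "ideal ker (free_algebra n)" by (rule ideal_kernel[OF network_in_torus_alg])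
  show "quantum_relations n q \<subseteq> ker"
    using eval_op_relation[OF quantum_matrix_network[OF q rel] q] quantum_relations_carrier by blast
  show "minor_poly q I J \<in> ker" if "(I, J) \<in> bad" for I J
    using eval_minor[OF subsetD[OF bad that]] bad_zero[OF that] minor_poly_carrier[OF subsetD[OF bad that], of q]
    by (simp only: mem_Collect_eq simp_thms)
qed

lemma minor_quotient_ker: "minor_quotient n q ker bad"
proof (rule minor_quotient.intro)
  show "ideal ker (free_algebra n)" by (rule ideal_kernel[OF network_in_torus_alg])
  interpret I: minor_quotient n q "minor_ideal n q bad" bad by (rule minor_quotient_ideal)
  show "quantum_relations n q \<subseteq> ker" using I.rels ideal_le_ker by blast
  show "minor_poly q I J \<in> ker" if "(I, J) \<in> bad" for I J using I.minors[OF that] ideal_le_ker by blast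
  show "I \<subseteq> {1..n} \<and> J \<subseteq> {1..n} \<and> card I = card J" if "(I, J) \<in> bad" for I J
    using I.bad[OF that] .
qed (fact q)

text \<open>If \<open>b\<close> holds, this reversal turns the diagonals of minors into decreasing
  chains of cells.\<close>

definition entries :: "(nat \<times> nat) multiset \<Rightarrow> nat \<Rightarrow> nat \<Rightarrow> nat" where
  "entries A i j = count A (i, reflect_if b n j)"

definition row_shape :: "(nat \<times> nat) multiset \<Rightarrow> nat \<Rightarrow> nat \<Rightarrow> nat" where
  "row_shape A i = growth loc (entries A) i n"

definition col_shape :: "(nat \<times> nat) multiset \<Rightarrow> nat \<Rightarrow> nat \<Rightarrow> nat" where
  "col_shape A j = growth loc (entries A) n j"

lemma gt_row: "gt_pattern n (row_shape A)"
  by unfold_locales (auto simp: row_shape_def growth_strip_left growth_zero)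

lemma gt_col: "gt_pattern n (col_shape A)"
  by unfold_locales (auto simp: col_shape_def growth_strip_right growth_zero)

lemma shapes_n: "row_shape A n = col_shape A n" by (simp add: row_shape_def col_shape_def)

text \<open>A positive row \<open>r\<close> produces a chain of \<open>Suc r\<close> letters of
  \<open>A\<close>. If one of the bounds failed, \<open>bad_chain\<close> would find the diagonal of
  a bad minor among these letters.\<close>

lemma std_chain:
  assumes A: "std A" and ij: "i \<le> n" "j \<le> n" and pos: "growth loc (entries A) i j r > 0"
  shows "f r \<le> i" "g r \<le> j"
proof -
  interpret I: minor_quotient n q "minor_ideal n q bad" bad by (rule minor_quotient_ideal)
  obtain xs ys where c: "valid_index n xs" "valid_index n ys" "length xs = Suc r" "length ys = Suc r"
    "set xs \<subseteq> {..i}" "reflect_if b n ` set ys \<subseteq> {..j}"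
    "\<forall>k\<le>r. entries A (xs ! k) (reflect_if b n (ys ! k)) > 0"
    using chain[OF ij pos] by blast
  have "(xs ! k, ys ! k) \<in># A" if "k < length xs" for k
  proof -
    have "ys ! k \<in> {1..n}" using valid_index_range[OF c(2), of k] that c(3,4) by simp
    then have "entries A (xs ! k) (reflect_if b n (ys ! k)) = count A (xs ! k, ys ! k)"
      by (simp add: entries_def reflect_if_reflect_if)
    moreover have "entries A (xs ! k) (reflect_if b n (ys ! k)) > 0" using c(7) that c(3) by simp
    ultimately show ?thesis by (simp only: count_greater_zero_iff)
  qed
  then have sub: "mset (zip xs ys) \<subseteq># A" using c by (intro diagonal_word_submset) auto
  have "\<not> (set xs \<subseteq> {..<f r} \<or> reflect_if b n ` set ys \<subseteq> {..<g r})"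
  proof
    assume "set xs \<subseteq> {..<f r} \<or> reflect_if b n ` set ys \<subseteq> {..<g r}"
    then obtain I J where IJ: "(I, J) \<in> bad" "mset (diagonal_word I J) \<subseteq># mset (zip xs ys)"
      using bad_chain[OF c(1-4)] by blast
    then have "mset (diagonal_word I J) \<subseteq># A" using sub subset_mset.order_trans by blast
    then show False using A IJ(1) unfolding I.standard_def by blast
  qed
  then have "\<not> set xs \<subseteq> {..<f r}" "\<not> reflect_if b n ` set ys \<subseteq> {..<g r}" by simp_all
  then show "f r \<le> i" "g r \<le> j" using c(5,6) by (meson lessThan_iff atMost_iff le_less_trans not_le subset_iff)+
qed

definition row_list :: "(nat \<times> nat) multiset \<Rightarrow> nat \<Rightarrow> nat list" where
  "row_list A c = gt_pattern.col n (row_shape A) c"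

definition col_list :: "(nat \<times> nat) multiset \<Rightarrow> nat \<Rightarrow> nat list" where
  "col_list A c = reflect_list_if b n (gt_pattern.col n (col_shape A) c)"

definition n_cols :: "(nat \<times> nat) multiset \<Rightarrow> nat" where "n_cols A = row_shape A n 0"

definition bitableau :: "(nat \<times> nat) multiset \<Rightarrow> 'k ncpoly" where
  "bitableau A = (\<Prod>c\<leftarrow>[0..<n_cols A]. minor_poly q (set (row_list A c)) (set (col_list A c)))"

definition bitableau_expo :: "(nat \<times> nat) multiset \<Rightarrow> expo" where
  "bitableau_expo A = (\<Sum>c\<leftarrow>[0..<n_cols A]. ex (row_list A c) (col_list A c))"

text \<open>Both boundary tableaux end in the shape at \<open>(n, n)\<close>, so their columns pair
  up into index lists of equal length.\<close>

lemma col_size_eq: "gt_pattern.col_size n (row_shape A) c = gt_pattern.col_size n (col_shape A) c"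
  unfolding gt_pattern.col_size_def[OF gt_row] gt_pattern.col_size_def[OF gt_col] shapes_n ..

lemma valid_row_list: "valid_index n (row_list A c)"
  unfolding row_list_def by (rule gt_pattern.valid_index_col[OF gt_row])

lemma valid_col_list: "valid_index n (col_list A c)"
  unfolding col_list_def by (rule valid_index_reflect[OF gt_pattern.valid_index_col[OF gt_col]])

lemma length_row_list: "length (row_list A c) = gt_pattern.col_size n (row_shape A) c"
  by (simp add: row_list_def gt_pattern.length_col[OF gt_row])

lemma length_col_list: "length (col_list A c) = gt_pattern.col_size n (row_shape A) c"
  by (simp add: col_list_def gt_pattern.length_col[OF gt_col] col_size_eq)

lemma reflect_col_list: "reflect_list_if b n (col_list A c) = gt_pattern.col n (col_shape A) c"
  unfolding col_list_def by (rule reflect_list_if_twice[OF gt_pattern.valid_index_col[OF gt_col]])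

lemma bitableau_pair: "(set (row_list A c), set (col_list A c)) \<in> index_pairs n"
  using valid_row_list[of A c] valid_col_list[of A c] length_row_list[of A c] length_col_list[of A c]
  by (auto simp: index_pairs_def valid_index_def strict_sorted_iff distinct_card)

lemma bitableau_lead:
  assumes A: "std A"
  shows "has_lead (net_weight n) (eval_op op_net (bitableau A)) (bitableau_expo A)"
proof -
  have "net_minor n q sts (row_list A c) (col_list A c) \<in> torus_alg q (length sts) \<and>
      has_lead (net_weight n) (net_minor n q sts (row_list A c) (col_list A c)) (ex (row_list A c) (col_list A c))" for c
  proof (intro conjI net_minor_in_torus_alg lead valid_row_list valid_col_list)
    show "length (row_list A c) = length (col_list A c)" by (simp add: length_row_list length_col_list)
  next
    fix r assume r: "r < length (col_list A c)"
    then have r': "r < gt_pattern.col_size n (row_shape A) c" by (simp add: length_col_list)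
    let ?v = "row_list A c ! r"
    have v: "?v \<le> n" using valid_index_range[OF valid_row_list, of r A c] r' by (simp add: length_row_list)
    \<comment> \<open>The entry is an index at which row \<open>r\<close> of the boundary shape is
      already present, so \<open>std_chain\<close> bounds it.\<close>
    have "c < row_shape A ?v r" using gt_pattern.col_le_iff[OF gt_row r' v] by (simp add: row_list_def)
    then show "f r \<le> ?v" using std_chain(1)[OF A v order_refl, of r] by (simp add: row_shape_def)
  next
    fix r assume r: "r < length (col_list A c)"
    then have r': "r < gt_pattern.col_size n (col_shape A) c" by (simp add: length_col_list col_size_eq)
    let ?v = "gt_pattern.col n (col_shape A) c ! r"
    have v: "?v \<le> n"
      using valid_index_range[OF gt_pattern.valid_index_col[OF gt_col], of r A c] r'
      by (simp add: gt_pattern.length_col[OF gt_col])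
    have "c < col_shape A ?v r" using gt_pattern.col_le_iff[OF gt_col r' v] by simp
    then show "g r \<le> reflect_list_if b n (col_list A c) ! r"
      using std_chain(2)[OF A order_refl v, of r] by (simp add: col_shape_def reflect_col_list)
  qed
  then have "has_lead (net_weight n) (\<Prod>c\<leftarrow>[0..<n_cols A]. net_minor n q sts (row_list A c) (col_list A c)) (bitableau_expo A)"
    unfolding bitableau_expo_def by (intro has_lead_prod_list[OF q net_weight_add]) auto
  moreover have "eval_op op_net (bitableau A) = (\<Prod>c\<leftarrow>[0..<n_cols A]. net_minor n q sts (row_list A c) (col_list A c))"
    by (simp only: bitableau_def eval_op_prod_list eval_minor[OF bitableau_pair]
        sorted_list_of_valid_index[OF valid_row_list] sorted_list_of_valid_index[OF valid_col_list])
  ultimately show ?thesis by simp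
qed

lemma lookup_bitableau_expo:
  "Poly_Mapping.lookup (bitableau_expo A) p =
     (\<Sum>c<n_cols A. Poly_Mapping.lookup (ex (row_list A c) (col_list A c)) p)"
proof -
  have "bitableau_expo A = (\<Sum>c<n_cols A. ex (row_list A c) (col_list A c))"
    by (simp add: bitableau_expo_def interv_sum_list_conv_sum_set_nat atLeast0LessThan)
  then show ?thesis by (simp add: lookup_sum_expo)
qed

lemma lookup_bitableau_va:
  assumes j: "j < n" "f r + j \<le> n"
  shows "Poly_Mapping.lookup (bitableau_expo A) (va r j) = row_shape A (f r + j) r"
proof -
  have "Poly_Mapping.lookup (bitableau_expo A) (va r j) = (\<Sum>c<row_shape A n 0.
      if r < gt_pattern.col_size n (row_shape A) c \<and> gt_pattern.col n (row_shape A) c ! r \<le> f r + j then 1 else 0)"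
    unfolding lookup_bitableau_expo n_cols_def
    by (rule sum.cong[OF refl], subst lookup_va)
      (simp_all add: valid_col_list length_row_list length_col_list j row_list_def gt_pattern.length_col[OF gt_row])
  then show ?thesis using gt_pattern.count_col[OF gt_row j(2)] by simp
qed

lemma lookup_bitableau_vb:
  assumes j: "j < n" "g r + j \<le> n"
  shows "Poly_Mapping.lookup (bitableau_expo A) (vb r j) + col_shape A (g r + j) r = row_shape A n r"
proof -
  have "Poly_Mapping.lookup (bitableau_expo A) (vb r j) = (\<Sum>c<col_shape A n 0.
      if r < gt_pattern.col_size n (col_shape A) c \<and> g r + j < gt_pattern.col n (col_shape A) c ! r then 1 else 0)"
    unfolding lookup_bitableau_expo n_cols_def shapes_n
    by (rule sum.cong[OF refl], subst lookup_vb)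
      (simp_all add: valid_col_list length_row_list length_col_list j reflect_col_list col_size_eq)
  then show ?thesis using gt_pattern.count_col_greater[OF gt_col j(2), of r A] by (simp add: shapes_n)
qed

lemma std_carrier: "std A \<Longrightarrow> set_mset A \<subseteq> letters n"
  using minor_quotient.standard_def[OF minor_quotient_ideal] by blast

text \<open>The exponent returns both boundary patterns: from the bounds \<open>f r\<close> and
  \<open>g r\<close> upwards through the variables \<open>va\<close> and \<open>vb\<close>, below
  them because the shapes vanish there by \<open>std_chain\<close>. The growth diagram then returns
  the entries.\<close>

lemma bitableau_expo_inj: "inj_on bitableau_expo {A. std A}"
proof (rule inj_onI)
  fix A B assume "A \<in> {A. std A}" "B \<in> {A. std A}" and eq: "bitableau_expo A = bitableau_expo B"
  then have A: "std A" and B: "std B" by auto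
  have row0: "row_shape C v r = 0" if "std C" "v \<le> n" "v < f r" for C v r
    using std_chain(1)[OF that(1,2) order_refl, of r] that(3) by (auto simp: row_shape_def)
  have col0: "col_shape C v r = 0" if "std C" "v \<le> n" "v < g r" for C v r
    using std_chain(2)[OF that(1) order_refl that(2), of r] that(3) by (auto simp: col_shape_def)
  have row: "row_shape A v r = row_shape B v r" if v: "v \<le> n" for v r
  proof (cases "v < f r")
    case True
    then show ?thesis using row0 A B v by simp
  next
    case False
    \<comment> \<open>Since \<open>f r\<close> is positive, the number of the step to be inspected
      stays below \<open>n\<close>.\<close>
    then have "v - f r < n" "f r + (v - f r) = v" using f_pos[of r] v by auto
    then show ?thesis using lookup_bitableau_va[of "v - f r" r A] lookup_bitableau_va[of "v - f r" r B] eq v by simp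
  qed
  have col: "col_shape A v r = col_shape B v r" if v: "v \<le> n" for v r
  proof (cases "v < g r")
    case True
    then show ?thesis using col0 A B v by simp
  next
    case False
    then have "v - g r < n" "g r + (v - g r) = v" using g_pos[of r] v by auto
    then show ?thesis
      using lookup_bitableau_vb[of "v - g r" r A] lookup_bitableau_vb[of "v - g r" r B] eq v row[of n r] by simp
  qed
  have entries: "entries A i j = entries B i j" if "i \<in> {1..n}" "j \<in> {1..n}" for i j
    by (rule growth_inj[OF _ _ that]) (auto simp: fun_eq_iff row[unfolded row_shape_def] col[unfolded col_shape_def])
  show "A = B"
  proof (rule multiset_eqI)
    fix p :: "nat \<times> nat"
    obtain i j where p: "p = (i, j)" by fastforce
    show "count A p = count B p"
    proof (cases "p \<in> letters n")
      case True
      then have ij: "i \<in> {1..n}" "j \<in> {1..n}" by (auto simp: p letters_def)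
      show ?thesis using entries[OF ij(1) reflect_if_in[OF ij(2), of b]]
        by (simp add: entries_def p reflect_if_reflect_if[OF ij(2)])
    next
      case False
      then have "p \<notin># A" "p \<notin># B" using std_carrier A B by blast+
      then show ?thesis by (simp add: not_in_iff)
    qed
  qed
qed

lemma size_eq_shape: "std A \<Longrightarrow> (\<Sum>r<n. row_shape A n r) = size A"
proof -
  assume A: "std A"
  have "(\<Sum>r<n. row_shape A n r) = (\<Sum>i\<in>{1..n}. \<Sum>j\<in>{1..n}. entries A i j)"
    unfolding row_shape_def by (rule growth_size) auto
  also have "\<dots> = (\<Sum>i\<in>{1..n}. \<Sum>j\<in>{1..n}. count A (i, j))"
  proof (rule sum.cong[OF refl])
    fix i
    show "(\<Sum>j\<in>{1..n}. entries A i j) = (\<Sum>j\<in>{1..n}. count A (i, j))"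
      unfolding entries_def
      by (rule sum.reindex_bij_witness[of _ "reflect_if b n" "reflect_if b n"])
        (use reflect_if_in reflect_if_reflect_if in auto)
  qed
  also have "\<dots> = (\<Sum>p\<in>letters n. count A p)"
    unfolding letters_def by (simp add: sum.cartesian_product)
  also have "\<dots> = (\<Sum>p\<in>set_mset A. count A p)"
    using std_carrier[OF A] by (intro sum.mono_neutral_right) (auto simp: letters_def not_in_iff)
  finally show ?thesis by (simp add: size_multiset_overloaded_eq)
qed

text \<open>The degree of \<open>A\<close> is preserved; this confines the products of minors to the
  span of the standard words of the same bounded degree.\<close>

lemma bitableau_words:
  assumes A: "std A"
  shows "Poly_Mapping.keys (bitableau A) \<subseteq> {w \<in> lists (letters n). length w = size A}"
proof -
  have card: "card (set (row_list A c)) = gt_pattern.col_size n (row_shape A) c" for c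
    using valid_row_list[of A c] length_row_list[of A c]
    by (simp add: valid_index_def strict_sorted_iff distinct_card)
  have "Poly_Mapping.keys (bitableau A) \<subseteq> {w \<in> lists (letters n).
      length w = (\<Sum>c\<leftarrow>[0..<n_cols A]. gt_pattern.col_size n (row_shape A) c)}"
    unfolding bitableau_def
    by (rule keys_prod_list_lengths) (rule minor_poly_words[OF bitableau_pair[of A], unfolded card])
  moreover have "(\<Sum>c\<leftarrow>[0..<n_cols A]. gt_pattern.col_size n (row_shape A) c) = size A"
    using gt_pattern.sum_col_size[OF gt_row, of A] size_eq_shape[OF A]
    by (simp add: interv_sum_list_conv_sum_set_nat atLeast0LessThan n_cols_def)
  ultimately show ?thesis by simp
qed

section \<open>Transfer of independence to the standard words\<close>

lemma finite_std: "finite {A. std A \<and> size A \<le> d}"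
proof (rule finite_subset)
  show "{A. std A \<and> size A \<le> d} \<subseteq> mset ` {w. set w \<subseteq> letters n \<and> length w \<le> d}"
  proof
    fix A assume A: "A \<in> {A. std A \<and> size A \<le> d}"
    obtain w where w: "mset w = A" using ex_mset by blast
    then show "A \<in> mset ` {w. set w \<subseteq> letters n \<and> length w \<le> d}"
      using A std_carrier[of A] by (intro image_eqI[of _ _ w]) auto
  qed
  show "finite (mset ` {w. set w \<subseteq> letters n \<and> length w \<le> d})"
    by (intro finite_imageI finite_lists_length_le) (simp add: letters_def)
qed

lemma inj_word_rep: "inj_on word_rep S"
  by (rule inj_on_inverseI[of _ mset]) simp

lemma eval_standard:
  assumes D: "finite D" and h: "Poly_Mapping.keys h \<subseteq> word_rep ` D"
  shows "eval_op op_net h = (\<Sum>A\<in>D. scal (Poly_Mapping.lookup h (word_rep A)) * word_op op_net (word_rep A))"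
  using eval_op_superset[of "word_rep ` D" h op_net] D h
  by (simp add: sum.reindex[OF inj_word_rep])

text \<open>An element of the kernel reduces to a combination \<open>h\<close> of standard words
  modulo the ideal of minors. The value of \<open>h\<close> is 0, and the values of the standard
  words are independent, hence \<open>h = 0\<close>.\<close>

theorem ker_eq: "minor_ideal n q bad = ker"
proof
  show "minor_ideal n q bad \<subseteq> ker" by (rule ideal_le_ker)
  interpret I: minor_quotient n q "minor_ideal n q bad" bad by (rule minor_quotient_ideal)
  interpret K: minor_quotient n q ker bad by (rule minor_quotient_ker)
  show "ker \<subseteq> minor_ideal n q bad"
  proof
    fix p assume p: "p \<in> ker"
    \<comment> \<open>Bounding the degree leaves finitely many standard multisets, as the count
      requires.\<close>
    define d where "d = Max (insert 0 (length ` Poly_Mapping.keys p))"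
    have "length w \<le> d" if "w \<in> Poly_Mapping.keys p" for w using that by (simp add: d_def)
    then have "Poly_Mapping.keys p \<subseteq> {w \<in> lists (letters n). length w \<le> d}"
      using p by (auto simp: letters_def)
    then obtain h where h: "Poly_Mapping.keys h \<subseteq> word_rep ` {A. std A \<and> size A \<le> d}" "p - h \<in> minor_ideal n q bad"
      using I.normal_form by blast
    let ?D = "{A. std A \<and> size A \<le> d}" and ?w = "\<lambda>A. word_op op_net (word_rep A)"
    have "eval_op op_net (p - h) = 0" using h(2) ideal_le_ker by blast
    then have "eval_op op_net h = 0" using p by (simp add: eval_op_diff)
    then have zero: "(\<Sum>A\<in>?D. scal (Poly_Mapping.lookup h (word_rep A)) * ?w A) = 0"
      using eval_standard[OF finite_std h(1)] by simp
    have "Poly_Mapping.lookup h (word_rep A) = 0" if "A \<in> ?D" for A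
    proof (rule spanning_family_independent[OF finite_std _ _ _ zero that])
      show "has_lead (net_weight n) (eval_op op_net (bitableau A)) (bitableau_expo A)" if "A \<in> ?D" for A
        using bitableau_lead that by simp
      show "inj_on bitableau_expo ?D" by (rule inj_on_subset[OF bitableau_expo_inj]) auto
      show "eval_op op_net (bitableau A) \<in> operator_space.span (?w ` ?D)" if A: "A \<in> ?D" for A
      proof -
        have "Poly_Mapping.keys (bitableau A) \<subseteq> {w \<in> lists (letters n). length w \<le> d}"
          using bitableau_words[of A] A by auto
        then obtain k where k: "Poly_Mapping.keys k \<subseteq> word_rep ` ?D" "bitableau A - k \<in> ker"
          using K.normal_form by blast
        have "eval_op op_net (bitableau A - k) = 0" using k(2) by blast
        then have "eval_op op_net (bitableau A) = eval_op op_net k" by (simp add: eval_op_diff)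
        also have "\<dots> = (\<Sum>A\<in>?D. scal (Poly_Mapping.lookup k (word_rep A)) * ?w A)"
          by (rule eval_standard[OF finite_std k(1)])
        also have "\<dots> \<in> operator_space.span (?w ` ?D)"
          by (intro operator_space.span_sum operator_space.span_scale operator_space.span_base) auto
        finally show ?thesis .
      qed
    qed
    then have "w \<notin> Poly_Mapping.keys h" for w using h(1) by (auto simp: in_keys_iff simp del: lookup_not_eq_zero_eq_in_keys)
    then have "h = 0" by (metis all_not_in_conv keys_eq_empty)
    then show "p \<in> minor_ideal n q bad" using h(2) by simp
  qed
qed

theorem ideal_prime:
  assumes "p \<in> carrier (free_algebra n)" "p' \<in> carrier (free_algebra n)" "p * p' \<in> minor_ideal n q bad"
  shows "p \<in> minor_ideal n q bad \<or> p' \<in> minor_ideal n q bad"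
proof -
  have alg: "eval_op op_net p \<in> torus_alg q (length sts)" for p
    unfolding eval_op_def word_op_def split_beta
    by (intro torus_alg_sum torus_alg_scal torus_alg_prod_list network_in_torus_alg)
  have "eval_op op_net p * eval_op op_net p' = 0"
    using assms(3) unfolding ker_eq by (simp add: eval_op_mult)
  then have "eval_op op_net p = 0 \<or> eval_op op_net p' = 0" by (rule torus_alg_domain[OF alg alg q])
  then show ?thesis using assms(1,2) unfolding ker_eq by blast
qed

theorem ideal_proper: "1 \<notin> minor_ideal n q bad"
proof
  assume "1 \<in> minor_ideal n q bad"
  then have "eval_op op_net 1 = 0" unfolding ker_eq by blast
  then have "coef (1 :: (expo, 'k) operator) 0 = 0" by (simp add: eval_op_1)
  then show False by (simp add: coef_1)
qed

end

section \<open>The two models\<close>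

text \<open>The minors that generate the sum of the two ideals; \<open>U\<close> and
  \<open>V\<close> encode the choice of signs.\<close>

definition sign_bad :: "nat \<Rightarrow> nat \<Rightarrow> nat set \<Rightarrow> nat set \<Rightarrow> (nat set \<times> nat set) set" where
  "sign_bad n t U V = {(I, J) \<in> index_pairs n. card I = t + 1 \<or> card I = t \<and> (I \<subseteq> U \<or> J \<subseteq> V)}"

text \<open>With rows counted from 0, a standard tableau has no entry below \<open>bound_seq n t l r\<close> in row \<open>r\<close>.\<close>

definition bound_seq :: "nat \<Rightarrow> nat \<Rightarrow> nat \<Rightarrow> nat \<Rightarrow> nat" where
  "bound_seq n t l r = (if Suc r < t then Suc r else if Suc r = t then max t (Suc l) else Suc n + r)"

lemma strict_mono_bound_seq:
  assumes "t \<le> n" "l \<le> n"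
  shows "strict_mono (bound_seq n t l)"
  unfolding strict_mono_Suc_iff using assms by (auto simp: bound_seq_def)

lemma bound_seq_pos: "1 \<le> bound_seq n t l r"
  by (auto simp: bound_seq_def)

lemma valid_index_lower:
  assumes "valid_index n xs" "r < length xs"
  shows "Suc r \<le> xs ! r"
  using assms(2)
proof (induction r)
  case 0
  then show ?case using valid_index_range[OF assms(1), of 0] by simp
next
  case (Suc r)
  then show ?case using valid_index_less[OF assms(1), of r "Suc r"] by simp
qed

text \<open>Entry \<open>r\<close> of an increasing index list is at least \<open>Suc r\<close>.
  Below the size \<open>t\<close> it can miss the bound only for \<open>Suc r = t\<close>, and then
  only because the bound there is \<open>Suc l\<close>.\<close>

lemma bound_seq_chain:
  assumes "valid_index n xs" "length xs = Suc r" "set xs \<subseteq> {..<bound_seq n t l r}" "r < t"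
  shows "Suc r = t \<and> set xs \<subseteq> {..l}"
proof -
  have "xs ! r \<in> set xs" using assms(2) by simp
  then have "xs ! r < bound_seq n t l r" using assms(3) by auto
  moreover have "Suc r \<le> xs ! r" using valid_index_lower[OF assms(1)] assms(2) by simp
  ultimately have "Suc r = t \<and> bound_seq n t l r = Suc l"
    using assms(4) by (auto simp: bound_seq_def max_def split: if_splits)
  then show ?thesis using assms(3) by (auto simp: less_Suc_eq_le)
qed

text \<open>For \<open>r < t\<close> the chain itself is the diagonal of a bad minor of size
  \<open>t\<close>. A longer chain begins with the diagonal of a minor of size
  \<open>t + 1\<close>.\<close>

lemma sign_bad_chain:
  assumes xs: "valid_index n xs" "length xs = Suc r" and ys: "valid_index n ys" "length ys = Suc r"
    and small: "set xs \<subseteq> {..<bound_seq n t l r} \<or> reflect_if b n ` set ys \<subseteq> {..<bound_seq n t l' r}"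
  shows "\<exists>(I, J)\<in>sign_bad n t {1..l} {j \<in> {1..n}. reflect_if b n j \<le> l'}.
    mset (diagonal_word I J) \<subseteq># mset (zip xs ys)"
proof (cases "r < t")
  case True
  have sets: "set xs \<subseteq> {1..n}" "set ys \<subseteq> {1..n}" using xs ys by (auto simp: valid_index_def)
  have cards: "card (set xs) = Suc r" "card (set ys) = Suc r"
    using xs ys by (auto simp: valid_index_def strict_sorted_iff distinct_card)
  have "Suc r = t \<and> (set xs \<subseteq> {1..l} \<or> set ys \<subseteq> {j \<in> {1..n}. reflect_if b n j \<le> l'})"
    using small
  proof
    assume "set xs \<subseteq> {..<bound_seq n t l r}"
    from bound_seq_chain[OF xs this True] have "Suc r = t" "set xs \<subseteq> {..l} \<inter> {1..n}" using sets by blast+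
    moreover have "{..l} \<inter> {1..n} \<subseteq> {1..l}" by auto
    ultimately show ?thesis by blast
  next
    assume "reflect_if b n ` set ys \<subseteq> {..<bound_seq n t l' r}"
    then have "set (reflect_list_if b n ys) \<subseteq> {..<bound_seq n t l' r}" by simp
    from bound_seq_chain[OF valid_index_reflect[OF ys(1)] _ this True]
    have "Suc r = t" "reflect_if b n ` set ys \<subseteq> {..l'}" using ys(2) by simp_all
    then show ?thesis using sets(2) by blast
  qed
  then have "(set xs, set ys) \<in> sign_bad n t {1..l} {j \<in> {1..n}. reflect_if b n j \<le> l'}"
    using sets cards by (auto simp: sign_bad_def index_pairs_def)
  then show ?thesis
    by (rule rev_bexI) (simp add: diagonal_word_def sorted_list_of_valid_index[OF xs(1)] sorted_list_of_valid_index[OF ys(1)])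
next
  case False
  have take: "valid_index n (take (Suc t) zs) \<and> length (take (Suc t) zs) = Suc t"
    if "valid_index n zs" "length zs = Suc r" for zs
    using that False set_take_subset[of "Suc t" zs]
    by (auto simp: valid_index_def intro: sorted_wrt_take)
  have tx: "valid_index n (take (Suc t) xs)" "length (take (Suc t) xs) = Suc t" using take[OF xs] by auto
  have ty: "valid_index n (take (Suc t) ys)" "length (take (Suc t) ys) = Suc t" using take[OF ys] by auto
  have "(set (take (Suc t) xs), set (take (Suc t) ys)) \<in> sign_bad n t {1..l} {j \<in> {1..n}. reflect_if b n j \<le> l'}"
    using tx ty by (auto simp: sign_bad_def index_pairs_def valid_index_def strict_sorted_iff distinct_card)
  moreover have "mset (zip (take (Suc t) xs) (take (Suc t) ys)) \<subseteq># mset (zip xs ys)"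
    by (metis append_take_drop_id mset_append mset_subset_eq_add_left take_zip)
  ultimately show ?thesis
    by (intro rev_bexI[of "(set (take (Suc t) xs), set (take (Suc t) ys))"])
      (simp_all add: diagonal_word_def sorted_list_of_valid_index[OF tx(1)] sorted_list_of_valid_index[OF ty(1)])
qed

text \<open>In each case one index would violate its bound: entry \<open>t\<close> of a list of
  length \<open>t + 1\<close> would exceed \<open>n\<close>, or entry \<open>t - 1\<close> of a list
  of length \<open>t\<close> would exceed \<open>l\<close> or \<open>l'\<close>.\<close>

lemma sign_bad_zero:
  assumes t: "1 \<le> t" and IJ: "(I, J) \<in> sign_bad n t {1..l} {j \<in> {1..n}. reflect_if b n j \<le> l'}"
    and zero: "\<And>r. net_minor n q sts (sorted_list_of_set I) (sorted_list_of_set J) \<noteq> 0 \<Longrightarrow>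
      r < length (sorted_list_of_set J) \<Longrightarrow>
      bound_seq n t l r \<le> sorted_list_of_set I ! r \<and>
      bound_seq n t l' r \<le> reflect_list_if b n (sorted_list_of_set J) ! r"
  shows "net_minor n q sts (sorted_list_of_set I) (sorted_list_of_set J) = 0"
proof (rule ccontr)
  assume nz: "net_minor n q sts (sorted_list_of_set I) (sorted_list_of_set J) \<noteq> 0"
  have IJ': "I \<subseteq> {1..n}" "J \<subseteq> {1..n}" "finite I" "finite J" "card J = card I"
    using IJ by (auto simp: sign_bad_def index_pairs_def intro: finite_subset)
  have mem: "sorted_list_of_set I ! r \<in> I" "reflect_list_if b n (sorted_list_of_set J) ! r \<in> reflect_if b n ` J"
    if "r < card I" for r
    using that IJ' nth_mem[of r "sorted_list_of_set I"] nth_mem[of r "reflect_list_if b n (sorted_list_of_set J)"]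
    by simp_all
  have ge: "bound_seq n t l r \<le> sorted_list_of_set I ! r"
    "bound_seq n t l' r \<le> reflect_list_if b n (sorted_list_of_set J) ! r" if "r < card I" for r
    using zero[OF nz, of r] that IJ' by auto
  consider "card I = t + 1" | "card I = t" "I \<subseteq> {1..l}" | "card I = t" "J \<subseteq> {j \<in> {1..n}. reflect_if b n j \<le> l'}"
    using IJ by (auto simp: sign_bad_def)
  then show False
  proof cases
    case 1
    then show False using ge(1)[of t] mem(1)[of t] IJ'(1) by (auto simp: bound_seq_def)
  next
    case 2
    then have "sorted_list_of_set I ! (t - 1) \<le> l" using mem(1)[of "t - 1"] t by auto
    moreover have "Suc l \<le> bound_seq n t l (t - 1)" using t by (simp add: bound_seq_def)
    ultimately show False using ge(1)[of "t - 1"] 2(1) t by simp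
  next
    case 3
    then have "reflect_list_if b n (sorted_list_of_set J) ! (t - 1) \<le> l'" using mem(2)[of "t - 1"] t by auto
    moreover have "Suc l' \<le> bound_seq n t l' (t - 1)" using t by (simp add: bound_seq_def)
    ultimately show False using ge(2)[of "t - 1"] 3(1) t by simp
  qed
qed

lemma valid_index_of_map:
  assumes "\<And>k. k < r \<Longrightarrow> a k < (a (Suc k) :: nat)" "\<And>k. k \<le> r \<Longrightarrow> 1 \<le> a k \<and> a k \<le> n"
  shows "valid_index n (map a [0..<Suc r])"
  using assms by (intro valid_indexI) (auto simp: less_Suc_eq_le simp del: upt_Suc)

text \<open>With columns counted from the left, the diagonals of minors are the increasing chains
  that the Burge rule detects.\<close>

lemma model_same:
  assumes q: "(q::'k::field) \<noteq> 0" and n: "n > 0" and t: "1 \<le> t" "t \<le> n" and l: "l \<le> n" "l' \<le> n"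
  defines "f \<equiv> bound_seq n t l" and "g \<equiv> bound_seq n t l'"
  shows "minor_model n (burge_rule n) q f g False (net_same n f g) (same_expo n f g)
    (\<lambda>r j. (Suc n + (n - 1 - j), f r, False)) (\<lambda>r j. (n - 1 - j, Suc (g r + j), True))
    (sign_bad n t {1..l} {j \<in> {1..n}. reflect_if False n j \<le> l'})"
proof (rule minor_model.intro[OF growth_rule_burge[OF n]], unfold_locales)
  have f: "strict_mono f" "1 \<le> f 0" and g: "strict_mono g" "1 \<le> g 0"
    using strict_mono_bound_seq t l bound_seq_pos by (auto simp: f_def g_def)
  note fg = q f g
  show "q \<noteq> 0" by fact
  show "1 \<le> f r" "1 \<le> g r" for r by (simp_all only: f_def g_def bound_seq_pos)
  show "Rel S \<in> set (net_same n f g) \<Longrightarrow> increasing_rel S" for S by (rule rel_same[OF fg])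
  show "sign_bad n t {1..l} {j \<in> {1..n}. reflect_if False n j \<le> l'} \<subseteq> index_pairs n"
    by (auto simp: sign_bad_def)
  show "net_minor n q (net_same n f g) (sorted_list_of_set I) (sorted_list_of_set J) = 0"
    if "(I, J) \<in> sign_bad n t {1..l} {j \<in> {1..n}. reflect_if False n j \<le> l'}" for I J
  proof (rule sign_bad_zero[OF t(1) that], unfold f_def[symmetric] g_def[symmetric])
    fix r assume nz: "net_minor n q (net_same n f g) (sorted_list_of_set I) (sorted_list_of_set J) \<noteq> 0"
      and r: "r < length (sorted_list_of_set J)"
    have IJ: "valid_index n (sorted_list_of_set I)" "valid_index n (sorted_list_of_set J)"
      "length (sorted_list_of_set I) = length (sorted_list_of_set J)"
      using that by (auto simp: sign_bad_def index_pairs_def valid_sorted_list_of_set)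
    show "f r \<le> sorted_list_of_set I ! r \<and> g r \<le> reflect_list_if False n (sorted_list_of_set J) ! r"
      using net_same_zero[OF fg IJ nz r] by (simp add: reflect_list_if_def)
  qed
  show "has_lead (net_weight n) (net_minor n q (net_same n f g) xs ys) (same_expo n f g xs ys)"
    if "valid_index n xs" "valid_index n ys" "length xs = length ys" "\<And>r. r < length ys \<Longrightarrow> f r \<le> xs ! r"
      "\<And>r. r < length ys \<Longrightarrow> g r \<le> reflect_list_if False n ys ! r" for xs ys
    by (rule net_same_lead[OF fg]) (use that in \<open>simp_all add: reflect_list_if_def\<close>)
  show "Poly_Mapping.lookup (same_expo n f g xs ys) (Suc n + (n - 1 - j), f r, False) =
      (if r < length ys \<and> xs ! r \<le> f r + j then 1 else 0)"
    if "valid_index n ys" "length xs = length ys" "j < n" for xs ys r j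
    by (rule lookup_same_expo(1)[OF fg that(3,2)])
  show "Poly_Mapping.lookup (same_expo n f g xs ys) (n - 1 - j, Suc (g r + j), True) =
      (if r < length ys \<and> g r + j < reflect_list_if False n ys ! r then 1 else 0)"
    if "valid_index n ys" "length xs = length ys" "j < n" for xs ys r j
    using lookup_same_expo(2)[OF fg that(3,2)] by (simp add: reflect_list_if_def)
  show "\<exists>xs ys. valid_index n xs \<and> valid_index n ys \<and> length xs = Suc r \<and> length ys = Suc r \<and>
        set xs \<subseteq> {..i} \<and> reflect_if False n ` set ys \<subseteq> {..j} \<and>
        (\<forall>k\<le>r. N (xs ! k) (reflect_if False n (ys ! k)) > 0)"
    if ij: "i \<le> n" "j \<le> n" and pos: "growth (burge_rule n) N i j r > 0" for N i j r
  proof -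
    obtain a b where ab: "\<And>k. k \<le> r \<Longrightarrow> 1 \<le> a k \<and> a k \<le> i \<and> 1 \<le> b k \<and> b k \<le> j \<and> N (a k) (b k) > 0"
      "\<And>k. k < r \<Longrightarrow> a k < a (Suc k) \<and> b k < b (Suc k)"
      using burge_chain[OF n ij pos] unfolding chain_in_def by blast
    have le: "a k \<le> n" "b k \<le> n" if "k \<le> r" for k using ab(1)[OF that] ij by auto
    show ?thesis
    proof (intro exI conjI)
      show "valid_index n (map a [0..<Suc r])" "valid_index n (map b [0..<Suc r])"
        using ab le by (intro valid_index_of_map; simp)+
    qed (use ab in \<open>auto simp: reflect_if_def less_Suc_eq_le simp del: upt_Suc\<close>)
  qed
  show "\<exists>(I, J)\<in>sign_bad n t {1..l} {j \<in> {1..n}. reflect_if False n j \<le> l'}.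
      mset (diagonal_word I J) \<subseteq># mset (zip xs ys)"
    if "valid_index n xs" "valid_index n ys" "length xs = Suc r" "length ys = Suc r"
      "set xs \<subseteq> {..<f r} \<or> reflect_if False n ` set ys \<subseteq> {..<g r}" for xs ys r
    using sign_bad_chain[OF that(1,3,2,4)] that(5) by (simp only: f_def g_def)
qed

text \<open>With columns counted from the right, the diagonals of minors are the decreasing chains
  that the RSK rule detects; reflecting the columns of such a chain gives back an increasing index
  list.\<close>

lemma model_opposite:
  assumes q: "(q::'k::field) \<noteq> 0" and n: "n > 0" and t: "1 \<le> t" "t \<le> n" and l: "l \<le> n" "l' \<le> n"
  defines "f \<equiv> bound_seq n t l" and "g \<equiv> bound_seq n t l'"
  shows "minor_model n rsk_rule q f g True (net_opposite n f g) (opposite_expo n f g)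
    (\<lambda>r j. (2 * n + 2 + (n - 1 - j), f r, False)) (\<lambda>r j. (n - 1 - j, Suc n - g r - j, True))
    (sign_bad n t {1..l} {j \<in> {1..n}. reflect_if True n j \<le> l'})"
proof (rule minor_model.intro[OF growth_rule_rsk[OF n]], unfold_locales)
  have f: "strict_mono f" "1 \<le> f 0" and g: "strict_mono g" "1 \<le> g 0"
    using strict_mono_bound_seq t l bound_seq_pos by (auto simp: f_def g_def)
  note fg = q f g
  show "q \<noteq> 0" by fact
  show "1 \<le> f r" "1 \<le> g r" for r by (simp_all only: f_def g_def bound_seq_pos)
  show "Rel S \<in> set (net_opposite n f g) \<Longrightarrow> increasing_rel S" for S by (rule rel_opposite[OF fg])
  show "sign_bad n t {1..l} {j \<in> {1..n}. reflect_if True n j \<le> l'} \<subseteq> index_pairs n"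
    by (auto simp: sign_bad_def)
  show "net_minor n q (net_opposite n f g) (sorted_list_of_set I) (sorted_list_of_set J) = 0"
    if "(I, J) \<in> sign_bad n t {1..l} {j \<in> {1..n}. reflect_if True n j \<le> l'}" for I J
  proof (rule sign_bad_zero[OF t(1) that], unfold f_def[symmetric] g_def[symmetric])
    fix r assume nz: "net_minor n q (net_opposite n f g) (sorted_list_of_set I) (sorted_list_of_set J) \<noteq> 0"
      and r: "r < length (sorted_list_of_set J)"
    have IJ: "valid_index n (sorted_list_of_set I)" "valid_index n (sorted_list_of_set J)"
      "length (sorted_list_of_set I) = length (sorted_list_of_set J)"
      using that by (auto simp: sign_bad_def index_pairs_def valid_sorted_list_of_set)
    show "f r \<le> sorted_list_of_set I ! r \<and> g r \<le> reflect_list_if True n (sorted_list_of_set J) ! r"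
      using net_opposite_zero[OF fg IJ nz r] by (simp add: reflect_list_if_def)
  qed
  show "has_lead (net_weight n) (net_minor n q (net_opposite n f g) xs ys) (opposite_expo n f g xs ys)"
    if "valid_index n xs" "valid_index n ys" "length xs = length ys" "\<And>r. r < length ys \<Longrightarrow> f r \<le> xs ! r"
      "\<And>r. r < length ys \<Longrightarrow> g r \<le> reflect_list_if True n ys ! r" for xs ys
    by (rule net_opposite_lead[OF fg]) (use that in \<open>simp_all add: reflect_list_if_def\<close>)
  show "Poly_Mapping.lookup (opposite_expo n f g xs ys) (2 * n + 2 + (n - 1 - j), f r, False) =
      (if r < length ys \<and> xs ! r \<le> f r + j then 1 else 0)"
    if "valid_index n ys" "length xs = length ys" "j < n" for xs ys r j
    by (rule lookup_opposite_expo(1)[OF fg that(3,2,1)])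
  show "Poly_Mapping.lookup (opposite_expo n f g xs ys) (n - 1 - j, Suc n - g r - j, True) =
      (if r < length ys \<and> g r + j < reflect_list_if True n ys ! r then 1 else 0)"
    if "valid_index n ys" "length xs = length ys" "j < n" for xs ys r j
    using lookup_opposite_expo(2)[OF fg that(3,2,1)] by (simp add: reflect_list_if_def)
  show "\<exists>xs ys. valid_index n xs \<and> valid_index n ys \<and> length xs = Suc r \<and> length ys = Suc r \<and>
        set xs \<subseteq> {..i} \<and> reflect_if True n ` set ys \<subseteq> {..j} \<and>
        (\<forall>k\<le>r. N (xs ! k) (reflect_if True n (ys ! k)) > 0)"
    if ij: "i \<le> n" "j \<le> n" and pos: "growth rsk_rule N i j r > 0" for N i j r
  proof -
    obtain a b where ab: "\<And>k. k \<le> r \<Longrightarrow> 1 \<le> a k \<and> a k \<le> i \<and> 1 \<le> b k \<and> b k \<le> j \<and> N (a k) (b k) > 0"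
      "\<And>k. k < r \<Longrightarrow> a k < a (Suc k) \<and> b (Suc k) < b k"
      using rsk_chain[OF n ij pos] unfolding antichain_in_def by blast
    have le: "a k \<le> n" "b k \<le> n" "1 \<le> b k" if "k \<le> r" for k using ab(1)[OF that] ij by auto
    have refl: "reflect_if True n (Suc n - b k) = b k" if "k \<le> r" for k
      using le[OF that] by (simp add: reflect_if_def)
    have "Suc n - b k < Suc n - b (Suc k)" if "k < r" for k using ab(2)[OF that] le(2)[of k] that by linarith
    moreover have "1 \<le> Suc n - b k \<and> Suc n - b k \<le> n" if "k \<le> r" for k using le[OF that] by linarith
    ultimately have vb: "valid_index n (map (\<lambda>k. Suc n - b k) [0..<Suc r])" by (rule valid_index_of_map)
    have va: "valid_index n (map a [0..<Suc r])" by (rule valid_index_of_map) (use ab le in auto)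
    show ?thesis
    proof (rule exI[of _ "map a [0..<Suc r]"], rule exI[of _ "map (\<lambda>k. Suc n - b k) [0..<Suc r]"],
        intro conjI va vb allI impI)
      fix k assume k: "k \<le> r"
      then have "map a [0..<Suc r] ! k = a k" "map (\<lambda>k. Suc n - b k) [0..<Suc r] ! k = Suc n - b k"
        by (simp_all del: upt_Suc)
      then show "N (map a [0..<Suc r] ! k) (reflect_if True n (map (\<lambda>k. Suc n - b k) [0..<Suc r] ! k)) > 0"
        using ab(1)[OF k] refl[OF k] by simp
    next
      show "set (map a [0..<Suc r]) \<subseteq> {..i}" using ab(1) by (auto simp: less_Suc_eq_le simp del: upt_Suc)
      show "reflect_if True n ` set (map (\<lambda>k. Suc n - b k) [0..<Suc r]) \<subseteq> {..j}"
        using ab(1) refl by (auto simp: less_Suc_eq_le simp del: upt_Suc)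
    qed simp_all
  qed
  show "\<exists>(I, J)\<in>sign_bad n t {1..l} {j \<in> {1..n}. reflect_if True n j \<le> l'}.
      mset (diagonal_word I J) \<subseteq># mset (zip xs ys)"
    if "valid_index n xs" "valid_index n ys" "length xs = Suc r" "length ys = Suc r"
      "set xs \<subseteq> {..<f r} \<or> reflect_if True n ` set ys \<subseteq> {..<g r}" for xs ys r
    using sign_bad_chain[OF that(1,3,2,4)] that(5) by (simp only: f_def g_def)
qed

text \<open>Complete primeness of a proper ideal, phrased for its preimage in the free
  algebra.\<close>

definition prime_proper :: "nat \<Rightarrow> 'k::field ncpoly set \<Rightarrow> bool" where
  "prime_proper n K \<longleftrightarrow> 1 \<notin> K \<and>
     (\<forall>p\<in>carrier (free_algebra n). \<forall>p'\<in>carrier (free_algebra n). p * p' \<in> K \<longrightarrow> p \<in> K \<or> p' \<in> K)"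

lemma prime_proper_sign_bad:
  assumes "(q::'k::field) \<noteq> 0" "n > 0" "1 \<le> t" "t \<le> n" "l \<le> n" "l' \<le> n"
  shows "prime_proper n (minor_ideal n q (sign_bad n t {1..l} {j \<in> {1..n}. reflect_if b n j \<le> l'}))"
proof (cases b)
  case False
  then have "b = False" by simp
  show ?thesis
    using minor_model.ideal_prime[OF model_same[OF assms]] minor_model.ideal_proper[OF model_same[OF assms]]
    unfolding prime_proper_def \<open>b = False\<close> by blast
next
  case True
  then have "b = True" by simp
  show ?thesis
    using minor_model.ideal_prime[OF model_opposite[OF assms]] minor_model.ideal_proper[OF model_opposite[OF assms]]
    unfolding prime_proper_def \<open>b = True\<close> by blast
qed

section \<open>Reversing both index sets\<close>

definition rev_word :: "nat \<Rightarrow> (nat \<times> nat) list \<Rightarrow> (nat \<times> nat) list" where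
  "rev_word n w = rev (map (\<lambda>(i, j). (Suc n - i, Suc n - j)) w)"

text \<open>The anti-automorphism \<open>X i j \<mapsto> X (n + 1 - i) (n + 1 - j)\<close>.\<close>

definition rev_poly :: "nat \<Rightarrow> 'k::field ncpoly \<Rightarrow> 'k ncpoly" where
  "rev_poly n p = (\<Sum>w\<in>Poly_Mapping.keys p. Poly_Mapping.single (rev_word n w) (Poly_Mapping.lookup p w))"

lemma rev_poly_superset:
  assumes "finite S" "Poly_Mapping.keys p \<subseteq> S"
  shows "rev_poly n p = (\<Sum>w\<in>S. Poly_Mapping.single (rev_word n w) (Poly_Mapping.lookup p w))"
  unfolding rev_poly_def by (rule sum.mono_neutral_left) (use assms in \<open>auto simp: in_keys_iff\<close>)

lemma rev_poly_add: "rev_poly n (p + p') = rev_poly n p + rev_poly n p'"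
proof -
  let ?S = "Poly_Mapping.keys p \<union> Poly_Mapping.keys p'"
  have "Poly_Mapping.keys (p + p') \<subseteq> ?S" by (rule Poly_Mapping.keys_add)
  then show ?thesis
    using rev_poly_superset[of ?S "p + p'" n] rev_poly_superset[of ?S p n] rev_poly_superset[of ?S p' n]
    by (simp add: lookup_add single_add sum.distrib)
qed

lemma rev_poly_0 [simp]: "rev_poly n 0 = 0" by (simp add: rev_poly_def)

lemma rev_poly_uminus: "rev_poly n (- p) = - rev_poly n p"
  using rev_poly_add[of n p "- p"] by (simp add: eq_neg_iff_add_eq_0 add.commute)

lemma rev_poly_diff: "rev_poly n (p - p') = rev_poly n p - rev_poly n p'"
  using rev_poly_add[of n p "- p'"] by (simp add: rev_poly_uminus)

lemma rev_poly_sum: "rev_poly n (\<Sum>i\<in>A. p i) = (\<Sum>i\<in>A. rev_poly n (p i))"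
  by (induction A rule: infinite_finite_induct) (simp_all add: rev_poly_add)

lemma rev_poly_single: "rev_poly n (Poly_Mapping.single w c) = Poly_Mapping.single (rev_word n w) c"
  by (simp add: rev_poly_def)

lemma rev_word_append: "rev_word n (v @ w) = rev_word n w @ rev_word n v"
  by (simp add: rev_word_def)

lemma rev_poly_mult: "rev_poly n (p * p') = rev_poly n p' * rev_poly n p"
proof -
  let ?s = "\<lambda>p w. Poly_Mapping.single w (Poly_Mapping.lookup p w) :: 'a ncpoly"
  have "rev_poly n (p * p') = rev_poly n
      ((\<Sum>w\<in>Poly_Mapping.keys p. ?s p w) * (\<Sum>w\<in>Poly_Mapping.keys p'. ?s p' w))"
    using sum_singles[of p] sum_singles[of p'] by simp
  also have "\<dots> = (\<Sum>w\<in>Poly_Mapping.keys p. \<Sum>v\<in>Poly_Mapping.keys p'.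
      rev_poly n (?s p' v) * rev_poly n (?s p w))"
    by (simp add: sum_product rev_poly_sum mult_single rev_poly_single plus_list_def rev_word_append mult.commute)
  also have "\<dots> = (\<Sum>v\<in>Poly_Mapping.keys p'. \<Sum>w\<in>Poly_Mapping.keys p.
      rev_poly n (?s p' v) * rev_poly n (?s p w))"
    by (rule sum.swap)
  also have "\<dots> = rev_poly n (\<Sum>w\<in>Poly_Mapping.keys p'. ?s p' w) * rev_poly n (\<Sum>w\<in>Poly_Mapping.keys p. ?s p w)"
    by (simp add: sum_product rev_poly_sum)
  finally show ?thesis
    using sum_singles[of p] sum_singles[of p'] by simp
qed

lemma rev_word_lists: "w \<in> lists ({1..n} \<times> {1..n}) \<Longrightarrow> rev_word n w \<in> lists ({1..n} \<times> {1..n})"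
  by (induction w) (auto simp: rev_word_def)

lemma rev_word_twice: "w \<in> lists ({1..n} \<times> {1..n}) \<Longrightarrow> rev_word n (rev_word n w) = w"
  by (induction w) (auto simp: rev_word_def)

lemma rev_poly_carrier:
  assumes "p \<in> carrier (free_algebra n)"
  shows "rev_poly n p \<in> carrier (free_algebra n)"
proof -
  have "Poly_Mapping.keys (rev_poly n p) \<subseteq> (\<Union>w\<in>Poly_Mapping.keys p. {rev_word n w})"
    unfolding rev_poly_def by (rule order_trans[OF keys_sum]) (intro UN_mono, auto)
  also have "\<dots> \<subseteq> lists ({1..n} \<times> {1..n})" using assms rev_word_lists[of _ n] by auto
  finally show ?thesis by simp
qed

lemma rev_poly_twice:
  assumes "p \<in> carrier (free_algebra n)"
  shows "rev_poly n (rev_poly n p) = p"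
proof -
  have "rev_poly n (rev_poly n p) = (\<Sum>w\<in>Poly_Mapping.keys p. Poly_Mapping.single (rev_word n (rev_word n w)) (Poly_Mapping.lookup p w))"
    by (simp add: rev_poly_def[of n p] rev_poly_sum rev_poly_single)
  also have "\<dots> = (\<Sum>w\<in>Poly_Mapping.keys p. Poly_Mapping.single w (Poly_Mapping.lookup p w))"
  proof (rule sum.cong[OF refl])
    fix w assume "w \<in> Poly_Mapping.keys p"
    then have "w \<in> lists ({1..n} \<times> {1..n})"
      using assms by (simp only: free_algebra_simps mem_Collect_eq) blast
    then show "Poly_Mapping.single (rev_word n (rev_word n w)) (Poly_Mapping.lookup p w) = Poly_Mapping.single w (Poly_Mapping.lookup p w)"
      by (simp only: rev_word_twice)
  qed
  finally show ?thesis by (simp flip: sum_singles)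
qed

lemma rev_poly_X: "rev_poly n (X i j) = X (Suc n - i) (Suc n - j)"
  by (simp add: X_def rev_poly_single rev_word_def)

lemma rev_poly_const: "rev_poly n (const c) = const c"
  by (simp add: const_def rev_poly_single rev_word_def)

lemma const_comm: "p * const c = const c * (p :: 'k::field ncpoly)"
proof -
  let ?s = "\<lambda>w. Poly_Mapping.single w (Poly_Mapping.lookup p w)"
  have "(\<Sum>w\<in>Poly_Mapping.keys p. ?s w) * const c = const c * (\<Sum>w\<in>Poly_Mapping.keys p. ?s w)"
    by (simp add: sum_distrib_left sum_distrib_right const_mult)
      (simp add: const_def mult_single plus_list_def mult.commute)
  then show ?thesis using sum_singles[of p] by simp
qed

text \<open>Reversing the indices alone would replace \<open>q\<close> by \<open>inverse q\<close>
  in the relations; reversing the order of the factors as well undoes this.\<close>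

lemma rev_poly_relation:
  assumes "r \<in> quantum_relations n q"
  shows "rev_poly n r \<in> quantum_relations n q"
proof -
  note rv = rev_poly_diff rev_poly_mult rev_poly_X rev_poly_const
  have cc: "X a b * (X c d * const e) = const e * X a b * X c d" for a b c d and e :: 'a
    by (metis const_comm mult.assoc)
  have S: "Suc n - i \<in> {1..n}" if "i \<in> {1..n}" for i using that by auto
  consider i l j where "r = X i j * X l j - const q * X l j * X i j" "i \<in> {1..n}" "l \<in> {1..n}" "j \<in> {1..n}" "i < l"
    | i j m where "r = X i j * X i m - const q * X i m * X i j" "i \<in> {1..n}" "j \<in> {1..n}" "m \<in> {1..n}" "j < m"
    | i j l m where "r = X i j * X l m - X l m * X i j" "i \<in> {1..n}" "j \<in> {1..n}" "l \<in> {1..n}" "m \<in> {1..n}" "i < l" "m < j"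
    | i j l m where "r = X i j * X l m - X l m * X i j - const (q - inverse q) * X i m * X l j"
        "i \<in> {1..n}" "j \<in> {1..n}" "l \<in> {1..n}" "m \<in> {1..n}" "i < l" "j < m"
    using assms unfolding quantum_relations_def by blast
  then show ?thesis
  proof cases
    case 1
    have "Suc n - l < Suc n - i" using 1 by auto
    from quantum_relations_intros(1)[OF S[OF 1(3)] S[OF 1(4)] S[OF 1(2)] S[OF 1(4)] this]
    show ?thesis by (simp add: 1(1) rv cc)
  next
    case 2
    have "Suc n - m < Suc n - j" using 2 by auto
    from quantum_relations_intros(2)[OF S[OF 2(2)] S[OF 2(4)] S[OF 2(2)] S[OF 2(3)] this]
    show ?thesis by (simp add: 2(1) rv cc)
  next
    case 3
    have "Suc n - l < Suc n - i" "Suc n - j < Suc n - m" using 3 by auto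
    from quantum_relations_intros(3)[OF S[OF 3(4)] S[OF 3(5)] S[OF 3(2)] S[OF 3(3)] this]
    show ?thesis by (simp add: 3(1) rv)
  next
    case 4
    have "Suc n - l < Suc n - i" "Suc n - m < Suc n - j" using 4 by auto
    from quantum_relations_intros(4)[OF S[OF 4(4)] S[OF 4(5)] S[OF 4(2)] S[OF 4(3)] this]
    show ?thesis by (simp add: 4(1) rv cc)
  qed
qed

text \<open>Conjugation by the longest permutation. It describes how a term of a minor changes when
  both index lists and the order of the factors are reversed.\<close>

definition conj_rev :: "nat \<Rightarrow> (nat \<Rightarrow> nat) \<Rightarrow> nat \<Rightarrow> nat" where
  "conj_rev s \<sigma> r = (if r < s then s - Suc (\<sigma> (s - Suc r)) else r)"

lemma conj_rev_permutes:
  assumes \<sigma>: "\<sigma> permutes {..<s}"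
  shows "conj_rev s \<sigma> permutes {..<s}"
proof (rule bij_imp_permutes)
  have im: "\<sigma> r < s" if "r < s" for r using permutes_in_image[OF \<sigma>] that by simp
  have "inj_on (conj_rev s \<sigma>) {..<s}"
  proof (rule inj_onI)
    fix a b assume ab: "a \<in> {..<s}" "b \<in> {..<s}" "conj_rev s \<sigma> a = conj_rev s \<sigma> b"
    then have "s - Suc (\<sigma> (s - Suc a)) = s - Suc (\<sigma> (s - Suc b))" by (simp add: conj_rev_def)
    moreover have "\<sigma> (s - Suc a) < s" "\<sigma> (s - Suc b) < s" using ab im by auto
    ultimately have "\<sigma> (s - Suc a) = \<sigma> (s - Suc b)" by linarith
    then have "s - Suc a = s - Suc b" using permutes_inj[OF \<sigma>] by (simp add: inj_eq)
    then show "a = b" using ab(1,2) by auto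
  qed
  moreover have "conj_rev s \<sigma> ` {..<s} \<subseteq> {..<s}" by (auto simp: conj_rev_def)
  ultimately show "bij_betw (conj_rev s \<sigma>) {..<s} {..<s}"
    by (simp add: bij_betw_def endo_inj_surj)
qed (simp add: conj_rev_def)

lemma conj_rev_twice:
  assumes \<sigma>: "\<sigma> permutes {..<s}"
  shows "conj_rev s (conj_rev s \<sigma>) = \<sigma>"
proof
  fix r
  show "conj_rev s (conj_rev s \<sigma>) r = \<sigma> r"
  proof (cases "r < s")
    case True
    then have "\<sigma> r < s" using permutes_in_image[OF \<sigma>] by simp
    then show ?thesis using True by (simp add: conj_rev_def)
  next
    case False
    then show ?thesis using permutes_not_in[OF \<sigma>, of r] by (simp add: conj_rev_def)
  qed
qed

text \<open>An inversion at the positions \<open>(a, b)\<close> corresponds to one at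
  \<open>(s - Suc b, s - Suc a)\<close>.\<close>

lemma perm_length_conj_rev:
  assumes \<sigma>: "\<sigma> permutes {..<s}"
  shows "perm_length s (conj_rev s \<sigma>) = perm_length s \<sigma>"
  unfolding perm_length_def
proof (rule bij_betw_same_card)
  let ?h = "\<lambda>(a, b). (s - Suc b, s - Suc a)"
  let ?A = "{(a, b). a < b \<and> b < s \<and> conj_rev s \<sigma> a > conj_rev s \<sigma> b}"
  let ?B = "{(a, b). a < b \<and> b < s \<and> \<sigma> a > \<sigma> b}"
  have im: "\<sigma> r < s" if "r < s" for r using permutes_in_image[OF \<sigma>] that by simp
  show "bij_betw ?h ?A ?B"
  proof (rule bij_betw_byWitness[where f' = ?h])
    show "\<forall>x\<in>?A. ?h (?h x) = x" "\<forall>x\<in>?B. ?h (?h x) = x" by auto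
    show "?h ` ?A \<subseteq> ?B"
    proof (rule image_subsetI)
      fix x assume "x \<in> ?A"
      then obtain a b where ab: "x = (a, b)" "a < b" "b < s" "conj_rev s \<sigma> a > conj_rev s \<sigma> b" by auto
      then have "s - Suc (\<sigma> (s - Suc b)) < s - Suc (\<sigma> (s - Suc a))" by (simp add: conj_rev_def)
      then have "\<sigma> (s - Suc a) < \<sigma> (s - Suc b)" by linarith
      then show "?h x \<in> ?B" using ab by auto
    qed
    show "?h ` ?B \<subseteq> ?A"
    proof (rule image_subsetI)
      fix x assume "x \<in> ?B"
      then obtain a b where ab: "x = (a, b)" "a < b" "b < s" "\<sigma> a > \<sigma> b" by auto
      have "s - Suc (\<sigma> a) < s - Suc (\<sigma> b)" using ab im[of a] by linarith
      then show "?h x \<in> ?A" using ab by (auto simp: conj_rev_def)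
    qed
  qed
qed

definition reflect_set :: "nat \<Rightarrow> nat set \<Rightarrow> nat set" where
  "reflect_set n I = (\<lambda>i. Suc n - i) ` I"

lemma reflect_set_properties:
  assumes "I \<subseteq> {1..n}"
  shows "reflect_set n I \<subseteq> {1..n}" "card (reflect_set n I) = card I"
    "sorted_list_of_set (reflect_set n I) = reflect_index n (sorted_list_of_set I)"
proof -
  show "reflect_set n I \<subseteq> {1..n}"
    unfolding reflect_set_def
  proof (rule image_subsetI)
    fix i assume "i \<in> I"
    then have "i \<in> {1..n}" using assms by blast
    then show "Suc n - i \<in> {1..n}" by auto
  qed
  have "inj_on (\<lambda>i. Suc n - i) I"
  proof (rule inj_onI)
    fix x y assume "x \<in> I" "y \<in> I" "Suc n - x = Suc n - y"
    moreover from this have "x \<in> {1..n}" "y \<in> {1..n}" using assms by blast+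
    ultimately show "x = y" by auto
  qed
  then show "card (reflect_set n I) = card I" by (simp add: reflect_set_def card_image)
  have fin: "finite I" using assms by (rule finite_subset) simp
  have "valid_index n (reflect_list_if True n (sorted_list_of_set I))"
    by (intro valid_index_reflect valid_sorted_list_of_set assms)
  from sorted_list_of_valid_index[OF this]
  show "sorted_list_of_set (reflect_set n I) = reflect_index n (sorted_list_of_set I)"
    using fin by (simp add: reflect_if_def reflect_set_def reflect_list_if_def[of True])
      (simp add: reflect_index_def)
qed

lemma rev_poly_minor:
  assumes IJ: "(I, J) \<in> index_pairs n"
  shows "rev_poly n (minor_poly (q::'k::field) I J) = minor_poly q (reflect_set n I) (reflect_set n J)"
proof -
  have sub: "I \<subseteq> {1..n}" "J \<subseteq> {1..n}" "card J = card I" "finite I" "finite J"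
    using IJ by (auto simp: index_pairs_def intro: finite_subset)
  let ?s = "card I" and ?x = "sorted_list_of_set I" and ?y = "sorted_list_of_set J"
  let ?P = "{\<sigma>. \<sigma> permutes {..<?s}}"
  define W where "W \<sigma> = map (\<lambda>r. (?x ! r, ?y ! \<sigma> r)) [0..<?s]" for \<sigma>
  define W' where "W' \<sigma> = map (\<lambda>r. (reflect_index n ?x ! r, reflect_index n ?y ! \<sigma> r)) [0..<?s]" for \<sigma>
  have W: "rev_word n (W \<sigma>) = W' (conj_rev ?s \<sigma>)" if \<sigma>: "\<sigma> permutes {..<?s}" for \<sigma>
  proof (rule nth_equalityI)
    show "length (rev_word n (W \<sigma>)) = length (W' (conj_rev ?s \<sigma>))" by (simp add: rev_word_def W_def W'_def)
    fix r assume "r < length (rev_word n (W \<sigma>))"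
    then have r: "r < ?s" by (simp add: rev_word_def W_def)
    then have "\<sigma> (?s - Suc r) < ?s" using permutes_in_image[OF \<sigma>, of "?s - Suc r"] by simp
    then have "reflect_index n ?y ! conj_rev ?s \<sigma> r = Suc n - ?y ! \<sigma> (?s - Suc r)"
      using r sub by (simp add: conj_rev_def reflect_nth)
    then show "rev_word n (W \<sigma>) ! r = W' (conj_rev ?s \<sigma>) ! r"
      using r sub by (simp add: rev_word_def W_def W'_def rev_nth reflect_nth)
  qed
  have "rev_poly n (minor_poly q I J) = (\<Sum>\<sigma>\<in>?P. Poly_Mapping.single (rev_word n (W \<sigma>)) ((- q) ^ perm_length ?s \<sigma>))"
    by (simp add: minor_poly_sum rev_poly_sum rev_poly_single W_def)
  also have "\<dots> = (\<Sum>\<sigma>\<in>?P. Poly_Mapping.single (W' (conj_rev ?s \<sigma>)) ((- q) ^ perm_length ?s (conj_rev ?s \<sigma>)))"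
    by (rule sum.cong[OF refl]) (simp add: W perm_length_conj_rev)
  also have "\<dots> = (\<Sum>\<sigma>\<in>?P. Poly_Mapping.single (W' \<sigma>) ((- q) ^ perm_length ?s \<sigma>))"
    by (rule sum.reindex_bij_witness[of _ "conj_rev ?s" "conj_rev ?s"])
      (simp_all add: conj_rev_permutes conj_rev_twice)
  also have "\<dots> = minor_poly q (reflect_set n I) (reflect_set n J)"
    using reflect_set_properties[OF sub(1)] reflect_set_properties[OF sub(2)]
    by (simp add: minor_poly_sum W'_def)
  finally show ?thesis .
qed

lemma rev_poly_minor_ideal:
  assumes q: "(q::'k::field) \<noteq> 0" and B: "B \<subseteq> index_pairs n" and B': "B' \<subseteq> index_pairs n"
    and map: "\<And>I J. (I, J) \<in> B \<Longrightarrow> (reflect_set n I, reflect_set n J) \<in> B'"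
    and p: "p \<in> minor_ideal n q B"
  shows "rev_poly n p \<in> minor_ideal n q B'"
proof -
  interpret Q: minor_quotient n q "minor_ideal n q B'" B' by (rule minor_quotient_minor_ideal[OF q B'])
  let ?K = "{p \<in> carrier (free_algebra n). rev_poly n p \<in> minor_ideal n q B'}"
  have "minor_ideal n q B \<subseteq> ?K"
  proof (rule minor_ideal_minimal)
    show "ideal ?K (free_algebra n)"
    proof (rule free_algebra_idealI)
      fix p r :: "'k ncpoly"
      assume p: "p \<in> ?K"
      show "- p \<in> ?K" using p by (simp add: rev_poly_uminus Q.K_uminus)
      assume r: "r \<in> carrier (free_algebra n)"
      have rr: "Poly_Mapping.keys (rev_poly n r) \<subseteq> lists (letters n)"
        using rev_poly_carrier[OF r] by (simp add: letters_def)
      show "r * p \<in> ?K" "p * r \<in> ?K"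
        using p r keys_mult_lists[of r _ p] keys_mult_lists[of p _ r] Q.K_left[OF _ rr] Q.K_right[OF _ rr]
        by (simp_all add: rev_poly_mult)
    next
      fix p r :: "'k ncpoly"
      assume pr: "p \<in> ?K" "r \<in> ?K"
      then have "Poly_Mapping.keys (p + r) \<subseteq> lists ({1..n} \<times> {1..n})"
        using Poly_Mapping.keys_add[of p r] by (simp only: free_algebra_simps mem_Collect_eq) blast
      then show "p + r \<in> ?K" using pr by (simp add: rev_poly_add Q.K_add)
    qed (auto simp: Q.K_0)
    show "quantum_relations n q \<subseteq> ?K"
      using rev_poly_relation Q.rels quantum_relations_carrier by blast
    show "minor_poly q I J \<in> ?K" if "(I, J) \<in> B" for I J
      using rev_poly_minor[OF subsetD[OF B that], of q] Q.minors[OF map[OF that]]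
        minor_poly_carrier[OF subsetD[OF B that], of q] by (simp only: mem_Collect_eq simp_thms)
  qed
  then show ?thesis using p by blast
qed

lemma prime_proper_reflect:
  assumes q: "(q::'k::field) \<noteq> 0" and B: "B \<subseteq> index_pairs n" and B': "B' \<subseteq> index_pairs n"
    and map: "\<And>I J. (I, J) \<in> B \<Longrightarrow> (reflect_set n I, reflect_set n J) \<in> B'"
    and map': "\<And>I J. (I, J) \<in> B' \<Longrightarrow> (reflect_set n I, reflect_set n J) \<in> B"
    and prime: "prime_proper n (minor_ideal n q B)"
  shows "prime_proper n (minor_ideal n q B')"
proof -
  have iff: "p \<in> minor_ideal n q B' \<longleftrightarrow> rev_poly n p \<in> minor_ideal n q B" if "p \<in> carrier (free_algebra n)" for p
    using rev_poly_minor_ideal[OF q B' B map', of p] rev_poly_minor_ideal[OF q B B' map, of "rev_poly n p"]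
      rev_poly_twice[OF that] by auto
  have one: "(1 :: 'k ncpoly) \<in> carrier (free_algebra n)" "rev_poly n (1 :: 'k ncpoly) = 1"
    using rev_poly_const[of n "1 :: 'k"] by (simp_all add: const_def zero_list_def flip: single_one)
  have "p \<in> minor_ideal n q B' \<or> p' \<in> minor_ideal n q B'"
    if "p \<in> carrier (free_algebra n)" "p' \<in> carrier (free_algebra n)" "p * p' \<in> minor_ideal n q B'" for p p'
  proof -
    have "p * p' \<in> carrier (free_algebra n)" using that keys_mult_lists[of p _ p'] by simp
    then have "rev_poly n p' * rev_poly n p \<in> minor_ideal n q B" using that(3) iff by (simp add: rev_poly_mult)
    then show ?thesis
      using prime rev_poly_carrier[OF that(1)] rev_poly_carrier[OF that(2)] iff[OF that(1)] iff[OF that(2)]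
      unfolding prime_proper_def by blast
  qed
  moreover have "1 \<notin> minor_ideal n q B'" using iff[OF one(1)] prime by (simp add: one(2) prime_proper_def)
  ultimately show ?thesis unfolding prime_proper_def by blast
qed

section \<open>Passage to the quotient\<close>

lemma ring_hom_qclass: "ring_hom_ring (free_algebra n) (quantum_matrices n q) (qclass n q)"
  unfolding qclass_def quantum_matrices_def by (rule ideal.rcos_ring_hom_ring[OF ideal_quantum_ideal])

lemma carrier_quantum_matrices: "carrier (quantum_matrices n q) = qclass n q ` carrier (free_algebra n)"
  unfolding quantum_matrices_def FactRing_def A_RCOSETS_def' qclass_def by (auto simp del: free_algebra_simps)

lemma qclass_eqD:
  assumes "qclass n q f = qclass n q g"
  shows "f - g \<in> quantum_ideal n q"
proof -
  have coset: "qclass n q g = (\<lambda>r. r + g) ` quantum_ideal n q" for g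
    by (auto simp: qclass_def a_r_coset_def')
  have "0 \<in> quantum_ideal n q"
    using additive_subgroup.zero_closed[OF ideal.axioms(1)[OF ideal_quantum_ideal]] by simp
  then have "f \<in> qclass n q g" using assms unfolding coset by force
  then show ?thesis unfolding coset by auto
qed

lemma ideal_qclass_image:
  assumes "ideal K (free_algebra n)"
  shows "ideal (qclass n q ` K) (quantum_matrices n q)"
  unfolding qclass_def quantum_matrices_def
  by (rule ring.ring_ideal_imp_quot_ideal[OF ring_free_algebra ideal_quantum_ideal assms])

text \<open>The ideal contains the defining ideal of the quotient, so it is a union of
  classes.\<close>

lemma qclass_in_image_iff:
  assumes q: "(q::'k::field) \<noteq> 0" and B: "B \<subseteq> index_pairs n"
  shows "qclass n q p \<in> qclass n q ` minor_ideal n q B \<longleftrightarrow> p \<in> minor_ideal n q B"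
proof
  interpret Q: minor_quotient n q "minor_ideal n q B" B by (rule minor_quotient_minor_ideal[OF q B])
  assume "qclass n q p \<in> qclass n q ` minor_ideal n q B"
  then obtain r where r: "r \<in> minor_ideal n q B" "qclass n q p = qclass n q r" by blast
  have "quantum_ideal n q \<subseteq> minor_ideal n q B"
    unfolding quantum_ideal_def by (rule ring.genideal_minimal[OF ring_free_algebra Q.K Q.rels])
  then have "p - r \<in> minor_ideal n q B" using qclass_eqD[OF r(2)] by blast
  from Q.K_add[OF this r(1)] show "p \<in> minor_ideal n q B" by simp
qed blast

text \<open>Every term of a minor uses each of its rows and each of its columns once, so all terms
  have the same torus weight.\<close>

lemma free_torus_act_minor:
  assumes "card I = card J" "finite J"
  shows "\<exists>c. free_torus_act h (minor_poly (q::'k::field) I J) = const c * minor_poly q I J"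
proof -
  let ?s = "card I" and ?x = "sorted_list_of_set I" and ?y = "sorted_list_of_set J"
  define c where "c = (\<Prod>r<?s. fst h (?x ! r)) * (\<Prod>r<?s. snd h (?y ! r))"
  have w: "word_weight h (map (\<lambda>r. (?x ! r, ?y ! \<sigma> r)) [0..<?s]) = c" if "\<sigma> permutes {..<?s}" for \<sigma>
  proof -
    have "word_weight h (map (\<lambda>r. (?x ! r, ?y ! \<sigma> r)) [0..<?s]) = (\<Prod>r<?s. fst h (?x ! r) * snd h (?y ! \<sigma> r))"
      by (simp add: word_weight_def o_def atLeast0LessThan flip: prod.distinct_set_conv_list)
    also have "\<dots> = (\<Prod>r<?s. fst h (?x ! r)) * (\<Prod>r<?s. snd h (?y ! \<sigma> r))" by (rule prod.distrib)
    also have "(\<Prod>r<?s. snd h (?y ! \<sigma> r)) = (\<Prod>r<?s. snd h (?y ! r))"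
      using prod.permute[OF that, of "\<lambda>r. snd h (?y ! r)"] by (simp add: o_def)
    finally show ?thesis by (simp add: c_def)
  qed
  have "free_torus_act h (minor_poly q I J) = const c * minor_poly q I J"
    unfolding minor_poly_sum free_torus_act_sum free_torus_act_single sum_distrib_left const_mult
    by (rule sum.cong[OF refl]) (simp only: mem_Collect_eq w mult.commute[of c])
  then show ?thesis by blast
qed

lemma free_torus_act_minor_ideal:
  assumes q: "(q::'k::field) \<noteq> 0" and B: "B \<subseteq> index_pairs n" and p: "p \<in> minor_ideal n q B"
  shows "free_torus_act h p \<in> minor_ideal n q B"
proof -
  interpret Q: minor_quotient n q "minor_ideal n q B" B by (rule minor_quotient_minor_ideal[OF q B])
  let ?K = "{p \<in> carrier (free_algebra n). free_torus_act h p \<in> minor_ideal n q B}"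
  have act: "Poly_Mapping.keys (free_torus_act h r) \<subseteq> lists (letters n)"
    if "r \<in> carrier (free_algebra n)" for r :: "'k ncpoly"
    using that keys_free_torus_act[of h r] by (auto simp: letters_def)
  have "minor_ideal n q B \<subseteq> ?K"
  proof (rule minor_ideal_minimal)
    show "ideal ?K (free_algebra n)"
    proof (rule free_algebra_idealI)
      fix p r :: "'k ncpoly"
      assume p: "p \<in> ?K"
      have "free_torus_act h (- p) = - free_torus_act h p"
        using free_torus_act_diff[of h 0 p] by (simp add: free_torus_act_zero)
      then show "- p \<in> ?K" using p by (simp add: Q.K_uminus)
      assume r: "r \<in> carrier (free_algebra n)"
      show "r * p \<in> ?K" "p * r \<in> ?K"
        using p r keys_mult_lists[of r _ p] keys_mult_lists[of p _ r] Q.K_left[OF _ act[OF r]] Q.K_right[OF _ act[OF r]]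
        by (simp_all add: free_torus_act_mult)
    next
      fix p r :: "'k ncpoly"
      assume pr: "p \<in> ?K" "r \<in> ?K"
      then have "Poly_Mapping.keys (p + r) \<subseteq> lists ({1..n} \<times> {1..n})"
        using Poly_Mapping.keys_add[of p r] by (simp only: free_algebra_simps mem_Collect_eq) blast
      then show "p + r \<in> ?K" using pr by (simp add: free_torus_act_add Q.K_add)
    qed (auto simp: Q.K_0 free_torus_act_zero)
    show "quantum_relations n q \<subseteq> ?K"
    proof
      fix r assume r: "r \<in> quantum_relations n q"
      obtain c where "free_torus_act h r = const c * r" using free_torus_act_relation[OF r] by blast
      then show "r \<in> ?K" using subsetD[OF Q.rels r] subsetD[OF quantum_relations_carrier r] Q.K_const
        by simp
    qed
    show "minor_poly q I J \<in> ?K" if IJ: "(I, J) \<in> B" for I J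
    proof -
      have "(I, J) \<in> index_pairs n" using IJ B by blast
      then have "card I = card J" "finite J" by (auto simp: index_pairs_def intro: finite_subset)
      then obtain c where "free_torus_act h (minor_poly q I J) = const c * minor_poly q I J"
        using free_torus_act_minor by blast
      then show ?thesis using Q.minors[OF IJ] minor_poly_carrier[OF subsetD[OF B IJ], of q] Q.K_const
        by simp
    qed
  qed
  then show ?thesis using p by blast
qed

text \<open>Complete primeness gives primeness for any two ideals: elements of the two factors lying
  outside the ideal have their product outside it.\<close>

lemma H_prime_minor_ideal:
  assumes q: "(q::'k::field) \<noteq> 0" and B: "B \<subseteq> index_pairs n" and prime: "prime_proper n (minor_ideal n q B)"
  shows "H_prime_ideal n q (qclass n q ` minor_ideal n q B)"
proof -
  interpret Q: minor_quotient n q "minor_ideal n q B" B by (rule minor_quotient_minor_ideal[OF q B])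
  interpret hom: ring_hom_ring "free_algebra n" "quantum_matrices n q" "qclass n q" by (rule ring_hom_qclass)
  let ?P = "qclass n q ` minor_ideal n q B"
  note mem = qclass_in_image_iff[OF q B]
  have sub: "minor_ideal n q B \<subseteq> carrier (free_algebra n)"
    using additive_subgroup.a_subset[OF ideal.axioms(1)[OF Q.K]] .
  have inv: "H_invariant_ideal n q ?P"
    unfolding H_invariant_ideal_def
  proof (intro conjI ballI)
    show "ideal ?P (quantum_matrices n q)" by (rule ideal_qclass_image[OF Q.K])
    fix h :: "(nat \<Rightarrow> 'k) \<times> (nat \<Rightarrow> 'k)" and a
    assume h: "h \<in> torus n" and "a \<in> ?P"
    then obtain p where p: "p \<in> minor_ideal n q B" "a = qclass n q p" by blast
    then show "torus_act h a \<in> ?P"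
      using torus_act_qclass[OF h subsetD[OF sub p(1)]] free_torus_act_minor_ideal[OF q B p(1)] by simp
  qed
  have "qclass n q 1 \<in> carrier (quantum_matrices n q)" "qclass n q 1 \<notin> ?P"
    using hom.hom_closed[OF hom.R.one_closed] prime mem by (simp_all add: prime_proper_def)
  then have proper: "?P \<noteq> carrier (quantum_matrices n q)" by blast
  have "I \<subseteq> ?P \<or> J \<subseteq> ?P"
    if I: "H_invariant_ideal n q I" and J: "H_invariant_ideal n q J"
      and prod: "ideal_prod (quantum_matrices n q) I J \<subseteq> ?P" for I J
  proof (rule ccontr)
    assume "\<not> (I \<subseteq> ?P \<or> J \<subseteq> ?P)"
    then obtain x y where xy: "x \<in> I" "x \<notin> ?P" "y \<in> J" "y \<notin> ?P" by blast
    have "I \<subseteq> carrier (quantum_matrices n q)" "J \<subseteq> carrier (quantum_matrices n q)"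
      using I J unfolding H_invariant_ideal_def
      by (auto dest!: ideal.axioms(1) additive_subgroup.a_subset simp del: free_algebra_simps)
    then obtain p p' where p: "p \<in> carrier (free_algebra n)" "x = qclass n q p"
      and p': "p' \<in> carrier (free_algebra n)" "y = qclass n q p'"
      using xy(1,3) unfolding carrier_quantum_matrices by blast
    have "qclass n q (p * p') = x \<otimes>\<^bsub>quantum_matrices n q\<^esub> y"
      using hom.hom_mult[OF p(1) p'(1)] by (simp add: p(2) p'(2))
    then have "qclass n q (p * p') \<in> ?P" using ideal_prod.prod[OF xy(1,3)] prod by auto
    then have "p * p' \<in> minor_ideal n q B" using mem by blast
    then show False using prime p(1) p'(1) xy(2,4) unfolding p(2) p'(2) prime_proper_def by blast
  qed
  then show ?thesis using inv proper unfolding H_prime_ideal_def by blast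
qed

section \<open>Sums of ideals of minors in the quotient\<close>

lemma (in ring) subset_set_add:
  assumes "ideal I R" "ideal J R"
  shows "I \<subseteq> I <+>\<^bsub>R\<^esub> J" "J \<subseteq> I <+>\<^bsub>R\<^esub> J"
proof -
  interpret I: ideal I R by fact
  interpret J: ideal J R by fact
  show "I \<subseteq> I <+>\<^bsub>R\<^esub> J"
  proof
    fix x assume x: "x \<in> I"
    have "x = x \<oplus> \<zero>" using r_zero[OF I.a_Hcarr[OF x]] by (rule sym)
    with x show "x \<in> I <+>\<^bsub>R\<^esub> J" unfolding set_add_def' using J.zero_closed by blast
  qed
  show "J \<subseteq> I <+>\<^bsub>R\<^esub> J"
  proof
    fix x assume x: "x \<in> J"
    have "x = \<zero> \<oplus> x" using l_zero[OF J.a_Hcarr[OF x]] by (rule sym)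
    with x show "x \<in> I <+>\<^bsub>R\<^esub> J" unfolding set_add_def' using I.zero_closed by blast
  qed
qed

lemma set_add_subset:
  assumes "ideal K R" "I \<subseteq> K" "J \<subseteq> K"
  shows "I <+>\<^bsub>R\<^esub> J \<subseteq> K"
  using assms additive_subgroup.a_closed[OF ideal.axioms(1)[OF assms(1)]] unfolding set_add_def' by blast

text \<open>Both inclusions are checked on generators. Each summand is generated by classes of bad
  minors; conversely, the preimage of the sum is an ideal of the free algebra that contains the
  relations and all bad minors.\<close>

lemma minors_sum_eq:
  assumes q: "(q::'k::field) \<noteq> 0" and U: "U \<subseteq> {1..n}" and V: "V \<subseteq> {1..n}"
  shows "(minors_ideal n q (t + 1) {1..n} {1..n} <+>\<^bsub>quantum_matrices n q\<^esub> minors_ideal n q t U {1..n})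
      <+>\<^bsub>quantum_matrices n q\<^esub>
      (minors_ideal n q (t + 1) {1..n} {1..n} <+>\<^bsub>quantum_matrices n q\<^esub> minors_ideal n q t {1..n} V)
    = qclass n q ` minor_ideal n q (sign_bad n t U V)" (is "?L = qclass n q ` ?M")
proof
  interpret A: ring "quantum_matrices n q" by (rule ring_quantum_matrices)
  interpret hom: ring_hom_ring "free_algebra n" "quantum_matrices n q" "qclass n q" by (rule ring_hom_qclass)
  interpret QI: ideal "quantum_ideal n q" "free_algebra n" by (rule ideal_quantum_ideal)
  have B: "sign_bad n t U V \<subseteq> index_pairs n" by (auto simp: sign_bad_def)
  interpret Q: minor_quotient n q ?M "sign_bad n t U V" by (rule minor_quotient_minor_ideal[OF q B])
  have gens: "{quantum_minor n q I J |I J. I \<subseteq> U' \<and> J \<subseteq> V' \<and> card I = s \<and> card J = s} \<subseteq> carrier (quantum_matrices n q)"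
    if "U' \<subseteq> {1..n}" "V' \<subseteq> {1..n}" for U' V' s
  proof -
    have "quantum_minor n q I J \<in> carrier (quantum_matrices n q)"
      if "I \<subseteq> U'" "J \<subseteq> V'" "card I = s" "card J = s" for I J
    proof -
      have "(I, J) \<in> index_pairs n" using that \<open>U' \<subseteq> _\<close> \<open>V' \<subseteq> _\<close> by (auto simp: index_pairs_def)
      then show ?thesis unfolding quantum_minor_def by (intro hom.hom_closed minor_poly_carrier)
    qed
    then show ?thesis by blast
  qed
  have id: "ideal (minors_ideal n q s U' V') (quantum_matrices n q)" if "U' \<subseteq> {1..n}" "V' \<subseteq> {1..n}" for U' V' s
    unfolding minors_ideal_def by (rule A.genideal_ideal[OF gens[OF that]])
  have self: "qclass n q (minor_poly q I J) \<in> minors_ideal n q s U' V'"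
    if "U' \<subseteq> {1..n}" "V' \<subseteq> {1..n}" "I \<subseteq> U'" "J \<subseteq> V'" "card I = s" "card J = s" for U' V' s I J
    unfolding minors_ideal_def quantum_minor_def[symmetric]
    by (rule subsetD[OF A.genideal_self[OF gens[OF that(1,2)]]]) (use that in blast)
  have P: "ideal (qclass n q ` ?M) (quantum_matrices n q)" by (rule ideal_qclass_image[OF Q.K])
  have le: "minors_ideal n q s U' V' \<subseteq> qclass n q ` ?M"
    if "\<And>I J. I \<subseteq> U' \<Longrightarrow> J \<subseteq> V' \<Longrightarrow> card I = s \<Longrightarrow> card J = s \<Longrightarrow> (I, J) \<in> sign_bad n t U V" for s U' V'
    unfolding minors_ideal_def
    by (rule A.genideal_minimal[OF P]) (use that Q.minors in \<open>auto simp: quantum_minor_def\<close>)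
  have les: "minors_ideal n q (t + 1) {1..n} {1..n} \<subseteq> qclass n q ` ?M"
    "minors_ideal n q t U {1..n} \<subseteq> qclass n q ` ?M" "minors_ideal n q t {1..n} V \<subseteq> qclass n q ` ?M"
    using U V by (intro le; auto simp: sign_bad_def index_pairs_def)+
  show "?L \<subseteq> qclass n q ` ?M" by (intro set_add_subset[OF P] les)
  let ?T = "minors_ideal n q (t + 1) {1..n} {1..n}" and ?U = "minors_ideal n q t U {1..n}"
    and ?V = "minors_ideal n q t {1..n} V"
  have ids: "ideal ?T (quantum_matrices n q)" "ideal ?U (quantum_matrices n q)" "ideal ?V (quantum_matrices n q)"
    using id U V by auto
  have sum: "ideal (?T <+>\<^bsub>quantum_matrices n q\<^esub> ?U) (quantum_matrices n q)"
    "ideal (?T <+>\<^bsub>quantum_matrices n q\<^esub> ?V) (quantum_matrices n q)"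
    using ids by (auto intro: A.add_ideals)
  have L: "ideal ?L (quantum_matrices n q)" by (rule A.add_ideals[OF sum])
  have incl: "?T \<subseteq> ?L" "?U \<subseteq> ?L" "?V \<subseteq> ?L"
    using A.subset_set_add[OF ids(1,2)] A.subset_set_add[OF ids(1,3)] A.subset_set_add[OF sum] by blast+
  let ?K = "{p \<in> carrier (free_algebra n). qclass n q p \<in> ?L}"
  have "?M \<subseteq> ?K"
  proof (rule minor_ideal_minimal)
    show "ideal ?K (free_algebra n)" by (rule hom.ideal_vimage[OF L])
    show "quantum_relations n q \<subseteq> ?K"
    proof
      fix r assume r: "r \<in> quantum_relations n q"
      then have "r \<in> quantum_ideal n q" unfolding quantum_ideal_def
        using ring.genideal_self[OF ring_free_algebra quantum_relations_carrier] by blast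
      then have "qclass n q r = quantum_ideal n q"
        unfolding qclass_def by (rule QI.a_rcos_const)
      moreover have "\<zero>\<^bsub>quantum_matrices n q\<^esub> = quantum_ideal n q"
        by (simp add: quantum_matrices_def FactRing_def)
      ultimately show "r \<in> ?K"
        using additive_subgroup.zero_closed[OF ideal.axioms(1)[OF L]] subsetD[OF quantum_relations_carrier r] by simp
    qed
    show "minor_poly q I J \<in> ?K" if IJ: "(I, J) \<in> sign_bad n t U V" for I J
    proof -
      have "I \<subseteq> {1..n}" "J \<subseteq> {1..n}" "card I = card J"
        "card I = t + 1 \<or> card I = t \<and> I \<subseteq> U \<or> card I = t \<and> J \<subseteq> V"
        using IJ by (auto simp: sign_bad_def index_pairs_def)
      then have "qclass n q (minor_poly q I J) \<in> ?T \<union> ?U \<union> ?V"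
        using self[OF subset_refl subset_refl] self[OF U subset_refl] self[OF subset_refl V] by auto
      then show ?thesis using incl minor_poly_carrier[OF subsetD[OF B IJ], of q] by blast
    qed
  qed
  then show "qclass n q ` ?M \<subseteq> ?L" by blast
qed

lemma H_prime_minors_sum:
  assumes q: "(q::'k::field) \<noteq> 0" and U: "U \<subseteq> {1..n}" and V: "V \<subseteq> {1..n}"
    and prime: "prime_proper n (minor_ideal n q (sign_bad n t U V))"
  shows "H_prime_ideal n q
     ((minors_ideal n q (t + 1) {1..n} {1..n} <+>\<^bsub>quantum_matrices n q\<^esub> minors_ideal n q t U {1..n})
      <+>\<^bsub>quantum_matrices n q\<^esub>
      (minors_ideal n q (t + 1) {1..n} {1..n} <+>\<^bsub>quantum_matrices n q\<^esub> minors_ideal n q t {1..n} V))"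
  unfolding minors_sum_eq[OF q U V]
  by (rule H_prime_minor_ideal[OF q _ prime]) (auto simp: sign_bad_def)

lemma prime_proper_sign_bad_reflect:
  assumes q: "(q::'k::field) \<noteq> 0" and U: "U \<subseteq> {1..n}" and V: "V \<subseteq> {1..n}"
    and prime: "prime_proper n (minor_ideal n q (sign_bad n t U V))"
  shows "prime_proper n (minor_ideal n q (sign_bad n t (reflect_set n U) (reflect_set n V)))"
proof (rule prime_proper_reflect[OF q _ _ _ _ prime])
  have mono: "reflect_set n I \<subseteq> reflect_set n U" if "I \<subseteq> U" for I U
    using that by (auto simp: reflect_set_def)
  have twice: "reflect_set n (reflect_set n I) = I" if "I \<subseteq> {1..n}" for I
  proof -
    have "Suc n - (Suc n - i) = i" if "i \<in> I" for i
    proof -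
      have "i \<in> {1..n}" using that \<open>I \<subseteq> {1..n}\<close> by blast
      then show ?thesis by simp
    qed
    then show ?thesis by (simp add: reflect_set_def image_image cong: image_cong_simp)
  qed
  have map: "(reflect_set n I, reflect_set n J) \<in> sign_bad n t (reflect_set n U') (reflect_set n V')"
    if "(I, J) \<in> sign_bad n t U' V'" for I J U' V'
  proof -
    have IJ: "I \<subseteq> {1..n}" "J \<subseteq> {1..n}" using that by (auto simp: sign_bad_def index_pairs_def)
    show ?thesis
      using that reflect_set_properties(1,2)[OF IJ(1)] reflect_set_properties(1,2)[OF IJ(2)]
        mono[of I U'] mono[of J V'] unfolding sign_bad_def index_pairs_def by simp metis
  qed
  show "(reflect_set n I, reflect_set n J) \<in> sign_bad n t (reflect_set n U) (reflect_set n V)"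
    if "(I, J) \<in> sign_bad n t U V" for I J by (rule map[OF that])
  show "(reflect_set n I, reflect_set n J) \<in> sign_bad n t U V"
    if "(I, J) \<in> sign_bad n t (reflect_set n U) (reflect_set n V)" for I J
    using map[OF that] twice[OF U] twice[OF V] by simp
qed (auto simp: sign_bad_def)

lemma reflect_set_intervals:
  assumes "l \<le> n"
  shows "reflect_set n {1..l} = {n - l + 1..n}" "reflect_set n {n - l + 1..n} = {1..l}"
proof -
  have "i \<in> reflect_set n {1..l}" if "i \<in> {n - l + 1..n}" for i
    unfolding reflect_set_def by (rule image_eqI[of _ _ "Suc n - i"]) (use that in auto)
  then show "reflect_set n {1..l} = {n - l + 1..n}" using assms by (auto simp: reflect_set_def)
  have "i \<in> reflect_set n {n - l + 1..n}" if "i \<in> {1..l}" for i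
    unfolding reflect_set_def by (rule image_eqI[of _ _ "Suc n - i"]) (use that assms in auto)
  then show "reflect_set n {n - l + 1..n} = {1..l}" using assms by (auto simp: reflect_set_def)
qed

theorem theorem6p6:
  fixes q :: "'k::field" and n t l l' :: nat
  assumes "n \<ge> 1"
    and "q \<noteq> 0"
    and "\<forall>m::nat. m \<ge> 1 \<longrightarrow> q ^ m \<noteq> 1"
    and "1 \<le> t" "t \<le> n"
    and "1 \<le> l" "l \<le> n"
    and "1 \<le> l'" "l' \<le> n"
  shows "H_prime_ideal n q (P_minus n q t l <+>\<^bsub>quantum_matrices n q\<^esub> Q_minus n q t l')
       \<and> H_prime_ideal n q (P_minus n q t l <+>\<^bsub>quantum_matrices n q\<^esub> Q_plus n q t l')
       \<and> H_prime_ideal n q (P_plus n q t l <+>\<^bsub>quantum_matrices n q\<^esub> Q_minus n q t l')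
       \<and> H_prime_ideal n q (P_plus n q t l <+>\<^bsub>quantum_matrices n q\<^esub> Q_plus n q t l')"
proof -
  have sub: "{1..l} \<subseteq> {1..n}" "{1..l'} \<subseteq> {1..n}" "{n - l + 1..n} \<subseteq> {1..n}" "{n - l' + 1..n} \<subseteq> {1..n}"
    using assms by auto
  have sets: "{j \<in> {1..n}. reflect_if False n j \<le> l'} = {1..l'}"
    "{j \<in> {1..n}. reflect_if True n j \<le> l'} = {n - l' + 1..n}"
    using assms by (auto simp: reflect_if_def)
  have "n > 0" using assms by simp
  note prime = prime_proper_sign_bad[OF assms(2) this assms(4,5,7,9)]
  have mm: "prime_proper n (minor_ideal n q (sign_bad n t {1..l} {1..l'}))"
    and mp: "prime_proper n (minor_ideal n q (sign_bad n t {1..l} {n - l' + 1..n}))"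
    using prime[of False] prime[of True] by (simp_all only: sets)
  \<comment> \<open>The reversal changes both signs at once: (-,-) becomes (+,+), and (-,+) becomes
    (+,-).\<close>
  have pp: "prime_proper n (minor_ideal n q (sign_bad n t {n - l + 1..n} {n - l' + 1..n}))"
    and pm: "prime_proper n (minor_ideal n q (sign_bad n t {n - l + 1..n} {1..l'}))"
    using prime_proper_sign_bad_reflect[OF assms(2) sub(1,2) mm] prime_proper_sign_bad_reflect[OF assms(2) sub(1,4) mp]
    by (simp_all only: reflect_set_intervals[OF assms(7)] reflect_set_intervals[OF assms(9)])
  note H = H_prime_minors_sum[OF assms(2)]
  show ?thesis
    unfolding P_minus_def P_plus_def Q_minus_def Q_plus_def
    by (intro conjI H[OF sub(1,2) mm] H[OF sub(1,4) mp] H[OF sub(3,2) pm] H[OF sub(3,4) pp])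
qed

end
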